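(* Assume the Symmetric setup below. (1) Every self-adjoint extension of $T_{min}$ that commutes with the reflection $P$, $(Pf)(x)=f(a+b-x)$, is unitarily equivalent to a direct sum $T^{(a,c)}_{\alpha,\pi}\oplus T^{(a,c)}_{\alpha',\pi/2}$ for some $\alpha,\alpha'\in(0,\pi]$. (2) Conversely, for any $\alpha,\alpha'\in(0,\pi]$, $T^{(a,c)}_{\alpha,\pi}\oplus T^{(a,c)}_{\alpha',\pi/2}$ is unitarily equivalent to a self-adjoint extension of $T_{min}$ commuting with $P$: if $\alpha=\alpha'$ it is $T_{\alpha,\alpha}$, and if $\alpha\ne\alpha'$ it is $T_{0,R'}$ for some $R'\in SL(2,\mathbb R)$ with equal diagonal entries, related to $(\alpha,\alpha')$ by the rule: $\alpha=\cot^{-1}\frac{R_{11}+1}{R_{12}}$, $\alpha'=\cot^{-1}\frac{R_{11}-1}{R_{12}}$ if $R_{12}\ne0$; $\alpha=\cot^{-1}\frac{-R_{21}}2$, $\alpha'=\pi$ if $R_{12}=0$, $R_{11}=-1$; $\alpha=\pi$, $\alpha'=\cot^{-1}\frac{R_{21}}2$ if $R_{12}=0$, $R_{11}=1$.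
   Context: Symmetric setup. Let $-\infty<a<b<\infty$, $c=(a+b)/2$, and let $p,q,r$ be real measurable on $(a,b)$ with $p,r>0$ a.e., $1/p,q,r\in L^1_{loc}((a,b))$, and $p(x)=p(a+b-x)$, $q(x)=q(a+b-x)$, $r(x)=r(a+b-x)$. Let $\tau=\frac1r[-\frac{d}{dx}p\frac{d}{dx}+q]$, $y^{[1]}=py'$, $W(f,g)=fg^{[1]}-f^{[1]}g$. $T_{max}$ is $\tau$ on $\{g\in L^2((a,b);rdx):g,g^{[1]}\in AC_{loc}((a,b)),\ \tau g\in L^2((a,b);rdx)\}$, and $T_{min}$ is the closure of its restriction to compactly supported functions. Assume $\tau$ is limit circle and nonoscillatory at both $a$ and $b$, so $T_{min}\ge\lambda_0 I$ for some $\lambda_0\in\mathbb R$. Let $u_a,\hat u_a$ be principal and nonprincipal solutions of $\tau u=\lambda_0u$ at $a$ (principal: real solution nonvanishing near $a$ with $\int_a p^{-1}u^{-2}=\infty$ near $a$; nonprincipal: linearly independent real solution), $W(\hat u_a,u_a)=1$, and at $b$ use $u_b(x)=-u_a(a+b-x)$, $\hat u_b(x)=\hat u_a(a+b-x)$. Generalized boundary values: $\tilde g(a)=-\lim_{x\downarrow a}W(u_a,g)$, $\tilde g'(a)=\lim_{x\downarrow a}W(\hat u_a,g)$, $\tilde g(b)=-\lim_{x\uparrow b}W(u_b,g)$, $\tilde g'(b)=\lim_{x\uparrow b}W(\hat u_b,g)$. $T_{\alpha,\beta}$: restriction of $T_{max}$ to $\{g:\tilde g(a)\cos\alpha+\tilde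 g'(a)\sin\alpha=0,\ \tilde g(b)\cos\beta-\tilde g'(b)\sin\beta=0\}$; $T_{\eta,R}$: restriction of $T_{max}$ to $\{g:(\tilde g(b),\tilde g'(b))^T=e^{i\eta}R(\tilde g(a),\tilde g'(a))^T\}$, $\eta\in[0,\pi)$, $R\in SL(2,\mathbb R)$. Half-interval operators $T^{(a,c)}_{\alpha,\beta}$ ($\beta\in\{\pi,\pi/2\}$): $\tau$ in $L^2((a,c);rdx)$ on $g$ with $g,g^{[1]}\in AC_{loc}((a,c])$, $\tau g\in L^2$, $\tilde g(a)\cos\alpha+\tilde g'(a)\sin\alpha=0$, and $g(c)=0$ ($\beta=\pi$) or $g^{[1]}(c)=0$ ($\beta=\pi/2$). $\cot^{-1}$ takes values in $(0,\pi)$. *)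

theory Defs
  imports "HOL-Analysis.Analysis"
begin

definition acot :: "real \<Rightarrow> real" where
  "acot x = pi / 2 - arctan x"

definition L2w :: "(real \<Rightarrow> real) \<Rightarrow> real set \<Rightarrow> (real \<Rightarrow> complex) \<Rightarrow> bool" where
  "L2w r S f \<longleftrightarrow> f \<in> borel_measurable lborel \<and>
     set_integrable lborel S (\<lambda>x. r x * (cmod (f x))^2)"

definition ipw :: "(real \<Rightarrow> real) \<Rightarrow> real set \<Rightarrow> (real \<Rightarrow> complex) \<Rightarrow> (real \<Rightarrow> complex) \<Rightarrow> complex" where
  "ipw r S f g = (LINT x:S|lborel. complex_of_real (r x) * f x * cnj (g x))"

definition normw :: "(real \<Rightarrow> real) \<Rightarrow> real set \<Rightarrow> (real \<Rightarrow> complex) \<Rightarrow> real" where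
  "normw r S f = sqrt (LINT x:S|lborel. r x * (cmod (f x))^2)"

definition aeq :: "real set \<Rightarrow> (real \<Rightarrow> complex) \<Rightarrow> (real \<Rightarrow> complex) \<Rightarrow> bool" where
  "aeq S f g \<longleftrightarrow> (AE x in lborel. x \<in> S \<longrightarrow> f x = g x)"

text \<open>f is locally absolutely continuous on the interval I with a.e. derivative f'
  (integral representation on every compact subinterval).\<close>
definition ac_rep :: "real set \<Rightarrow> (real \<Rightarrow> complex) \<Rightarrow> (real \<Rightarrow> complex) \<Rightarrow> bool" where
  "ac_rep I f f' \<longleftrightarrow> (\<forall>s\<in>I. \<forall>t\<in>I. s \<le> t \<longrightarrow>
      set_integrable lborel {s..t} f' \<and> f t - f s = (LINT x:{s..t}|lborel. f' x))"

text \<open>g, g1 in AC_loc(I), g1 = p g' (the quasi-derivative) and tau g = h, i.e.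
  -(g1)' + q g = r h a.e.\<close>
definition qd_sys :: "(real \<Rightarrow> real) \<Rightarrow> (real \<Rightarrow> real) \<Rightarrow> (real \<Rightarrow> real) \<Rightarrow> real set \<Rightarrow>
    (real \<Rightarrow> complex) \<Rightarrow> (real \<Rightarrow> complex) \<Rightarrow> (real \<Rightarrow> complex) \<Rightarrow> bool" where
  "qd_sys p q r I g g1 h \<longleftrightarrow>
     ac_rep I g (\<lambda>x. g1 x / complex_of_real (p x)) \<and>
     ac_rep I g1 (\<lambda>x. complex_of_real (q x) * g x - complex_of_real (r x) * h x)"

definition sol :: "(real \<Rightarrow> real) \<Rightarrow> (real \<Rightarrow> real) \<Rightarrow> (real \<Rightarrow> real) \<Rightarrow> real set \<Rightarrow> complex \<Rightarrow>
    (real \<Rightarrow> complex) \<Rightarrow> (real \<Rightarrow> complex) \<Rightarrow> bool" where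
  "sol p q r I lam u u1 \<longleftrightarrow> qd_sys p q r I u u1 (\<lambda>x. lam * u x)"

definition rsol :: "(real \<Rightarrow> real) \<Rightarrow> (real \<Rightarrow> real) \<Rightarrow> (real \<Rightarrow> real) \<Rightarrow> real set \<Rightarrow> real \<Rightarrow>
    (real \<Rightarrow> real) \<Rightarrow> (real \<Rightarrow> real) \<Rightarrow> bool" where
  "rsol p q r I lam u u1 \<longleftrightarrow>
     sol p q r I (complex_of_real lam) (\<lambda>x. complex_of_real (u x)) (\<lambda>x. complex_of_real (u1 x))"

definition LC_left :: "(real \<Rightarrow> real) \<Rightarrow> (real \<Rightarrow> real) \<Rightarrow> (real \<Rightarrow> real) \<Rightarrow> real \<Rightarrow> real \<Rightarrow> bool" where
  "LC_left p q r a b \<longleftrightarrow> (\<exists>lam. \<forall>u u1. sol p q r {a<..<b} lam u u1 \<longrightarrow>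
      (\<exists>d. a < d \<and> d < b \<and> set_integrable lborel {a<..<d} (\<lambda>x. r x * (cmod (u x))^2)))"

definition LC_right :: "(real \<Rightarrow> real) \<Rightarrow> (real \<Rightarrow> real) \<Rightarrow> (real \<Rightarrow> real) \<Rightarrow> real \<Rightarrow> real \<Rightarrow> bool" where
  "LC_right p q r a b \<longleftrightarrow> (\<exists>lam. \<forall>u u1. sol p q r {a<..<b} lam u u1 \<longrightarrow>
      (\<exists>d. a < d \<and> d < b \<and> set_integrable lborel {d<..<b} (\<lambda>x. r x * (cmod (u x))^2)))"

definition NO_left :: "(real \<Rightarrow> real) \<Rightarrow> (real \<Rightarrow> real) \<Rightarrow> (real \<Rightarrow> real) \<Rightarrow> real \<Rightarrow> real \<Rightarrow> bool" where
  "NO_left p q r a b \<longleftrightarrow> (\<exists>lam. \<forall>u u1. rsol p q r {a<..<b} lam u u1 \<and> (\<exists>x\<in>{a<..<b}. u x \<noteq> 0) \<longrightarrow>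
      (\<exists>d. a < d \<and> d < b \<and> finite {x \<in> {a<..<d}. u x = 0}))"

definition NO_right :: "(real \<Rightarrow> real) \<Rightarrow> (real \<Rightarrow> real) \<Rightarrow> (real \<Rightarrow> real) \<Rightarrow> real \<Rightarrow> real \<Rightarrow> bool" where
  "NO_right p q r a b \<longleftrightarrow> (\<exists>lam. \<forall>u u1. rsol p q r {a<..<b} lam u u1 \<and> (\<exists>x\<in>{a<..<b}. u x \<noteq> 0) \<longrightarrow>
      (\<exists>d. a < d \<and> d < b \<and> finite {x \<in> {d<..<b}. u x = 0}))"

text \<open>Maximal operator (graph, as pairs (f, tau f) of L2 functions).\<close>
definition Tmax :: "(real \<Rightarrow> real) \<Rightarrow> (real \<Rightarrow> real) \<Rightarrow> (real \<Rightarrow> real) \<Rightarrow> real \<Rightarrow> real \<Rightarrow>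
    ((real \<Rightarrow> complex) \<times> (real \<Rightarrow> complex)) set" where
  "Tmax p q r a b = {(f, h). L2w r {a<..<b} f \<and> L2w r {a<..<b} h \<and>
      (\<exists>g g1. aeq {a<..<b} f g \<and> qd_sys p q r {a<..<b} g g1 h)}"

definition T0 :: "(real \<Rightarrow> real) \<Rightarrow> (real \<Rightarrow> real) \<Rightarrow> (real \<Rightarrow> real) \<Rightarrow> real \<Rightarrow> real \<Rightarrow>
    ((real \<Rightarrow> complex) \<times> (real \<Rightarrow> complex)) set" where
  "T0 p q r a b = {(f, h). L2w r {a<..<b} f \<and> L2w r {a<..<b} h \<and>
      (\<exists>g g1 s t. aeq {a<..<b} f g \<and> qd_sys p q r {a<..<b} g g1 h \<and>
         a < s \<and> s \<le> t \<and> t < b \<and> (\<forall>x\<in>{a<..<b} - {s..t}. g x = 0))}"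

definition Tmin :: "(real \<Rightarrow> real) \<Rightarrow> (real \<Rightarrow> real) \<Rightarrow> (real \<Rightarrow> real) \<Rightarrow> real \<Rightarrow> real \<Rightarrow>
    ((real \<Rightarrow> complex) \<times> (real \<Rightarrow> complex)) set" where
  "Tmin p q r a b = {(f, h). L2w r {a<..<b} f \<and> L2w r {a<..<b} h \<and>
      (\<exists>F H. (\<forall>n. (F n, H n) \<in> T0 p q r a b) \<and>
         (\<lambda>n. normw r {a<..<b} (\<lambda>x. F n x - f x)) \<longlonglongrightarrow> 0 \<and>
         (\<lambda>n. normw r {a<..<b} (\<lambda>x. H n x - h x)) \<longlonglongrightarrow> 0)}"

definition adjw :: "(real \<Rightarrow> real) \<Rightarrow> real set \<Rightarrow> ((real \<Rightarrow> complex) \<times> (real \<Rightarrow> complex)) set \<Rightarrow>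
    ((real \<Rightarrow> complex) \<times> (real \<Rightarrow> complex)) set" where
  "adjw r S T = {(u, v). L2w r S u \<and> L2w r S v \<and>
      (\<forall>(f, g)\<in>T. ipw r S g u = ipw r S f v)}"

definition sa_ext :: "(real \<Rightarrow> real) \<Rightarrow> (real \<Rightarrow> real) \<Rightarrow> (real \<Rightarrow> real) \<Rightarrow> real \<Rightarrow> real \<Rightarrow>
    ((real \<Rightarrow> complex) \<times> (real \<Rightarrow> complex)) set \<Rightarrow> bool" where
  "sa_ext p q r a b S \<longleftrightarrow> Tmin p q r a b \<subseteq> S \<and> S = adjw r {a<..<b} S"

text \<open>S commutes with the reflection (P f)(x) = f(a+b-x): P S \<subseteq> S P.\<close>
definition commP :: "real \<Rightarrow> real \<Rightarrow> ((real \<Rightarrow> complex) \<times> (real \<Rightarrow> complex)) set \<Rightarrow> bool" where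
  "commP a b S \<longleftrightarrow> (\<forall>(f, g)\<in>S. ((\<lambda>x. f (a + b - x)), (\<lambda>x. g (a + b - x))) \<in> S)"

definition wlim :: "real filter \<Rightarrow> (real \<Rightarrow> real) \<Rightarrow> (real \<Rightarrow> real) \<Rightarrow>
    (real \<Rightarrow> complex) \<Rightarrow> (real \<Rightarrow> complex) \<Rightarrow> complex" where
  "wlim F u u1 g g1 = Lim F (\<lambda>x. complex_of_real (u x) * g1 x - complex_of_real (u1 x) * g x)"

text \<open>Generalized boundary values. At b we use u_b(x) = -u_a(a+b-x), \<hat>u_b(x) = \<hat>u_a(a+b-x),
  whose quasi-derivatives (p symmetric) are u_b^[1](x) = u_a^[1](a+b-x),
  \<hat>u_b^[1](x) = -\<hat>u_a^[1](a+b-x).\<close>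
definition bv_a :: "real \<Rightarrow> (real \<Rightarrow> real) \<Rightarrow> (real \<Rightarrow> real) \<Rightarrow> (real \<Rightarrow> complex) \<Rightarrow> (real \<Rightarrow> complex) \<Rightarrow> complex" where
  "bv_a a ua ua1 g g1 = - wlim (at_right a) ua ua1 g g1"

definition bv'_a :: "real \<Rightarrow> (real \<Rightarrow> real) \<Rightarrow> (real \<Rightarrow> real) \<Rightarrow> (real \<Rightarrow> complex) \<Rightarrow> (real \<Rightarrow> complex) \<Rightarrow> complex" where
  "bv'_a a hua hua1 g g1 = wlim (at_right a) hua hua1 g g1"

definition bv_b :: "real \<Rightarrow> real \<Rightarrow> (real \<Rightarrow> real) \<Rightarrow> (real \<Rightarrow> real) \<Rightarrow> (real \<Rightarrow> complex) \<Rightarrow> (real \<Rightarrow> complex) \<Rightarrow> complex" where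
  "bv_b a b ua ua1 g g1 = - wlim (at_left b) (\<lambda>x. - ua (a + b - x)) (\<lambda>x. ua1 (a + b - x)) g g1"

definition bv'_b :: "real \<Rightarrow> real \<Rightarrow> (real \<Rightarrow> real) \<Rightarrow> (real \<Rightarrow> real) \<Rightarrow> (real \<Rightarrow> complex) \<Rightarrow> (real \<Rightarrow> complex) \<Rightarrow> complex" where
  "bv'_b a b hua hua1 g g1 = wlim (at_left b) (\<lambda>x. hua (a + b - x)) (\<lambda>x. - hua1 (a + b - x)) g g1"

definition Tab :: "(real \<Rightarrow> real) \<Rightarrow> (real \<Rightarrow> real) \<Rightarrow> (real \<Rightarrow> real) \<Rightarrow> real \<Rightarrow> real \<Rightarrow>
    (real \<Rightarrow> real) \<Rightarrow> (real \<Rightarrow> real) \<Rightarrow> (real \<Rightarrow> real) \<Rightarrow> (real \<Rightarrow> real) \<Rightarrow> real \<Rightarrow> real \<Rightarrow>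
    ((real \<Rightarrow> complex) \<times> (real \<Rightarrow> complex)) set" where
  "Tab p q r a b ua ua1 hua hua1 \<alpha> \<beta> = {(f, h). L2w r {a<..<b} f \<and> L2w r {a<..<b} h \<and>
      (\<exists>g g1. aeq {a<..<b} f g \<and> qd_sys p q r {a<..<b} g g1 h \<and>
        complex_of_real (cos \<alpha>) * bv_a a ua ua1 g g1 + complex_of_real (sin \<alpha>) * bv'_a a hua hua1 g g1 = 0 \<and>
        complex_of_real (cos \<beta>) * bv_b a b ua ua1 g g1 - complex_of_real (sin \<beta>) * bv'_b a b hua hua1 g g1 = 0)}"

definition TetaR :: "(real \<Rightarrow> real) \<Rightarrow> (real \<Rightarrow> real) \<Rightarrow> (real \<Rightarrow> real) \<Rightarrow> real \<Rightarrow> real \<Rightarrow>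
    (real \<Rightarrow> real) \<Rightarrow> (real \<Rightarrow> real) \<Rightarrow> (real \<Rightarrow> real) \<Rightarrow> (real \<Rightarrow> real) \<Rightarrow> real \<Rightarrow>
    real \<Rightarrow> real \<Rightarrow> real \<Rightarrow> real \<Rightarrow>
    ((real \<Rightarrow> complex) \<times> (real \<Rightarrow> complex)) set" where
  "TetaR p q r a b ua ua1 hua hua1 \<eta> R11 R12 R21 R22 = {(f, h). L2w r {a<..<b} f \<and> L2w r {a<..<b} h \<and>
      (\<exists>g g1. aeq {a<..<b} f g \<and> qd_sys p q r {a<..<b} g g1 h \<and>
        bv_b a b ua ua1 g g1 = cis \<eta> * (complex_of_real R11 * bv_a a ua ua1 g g1 + complex_of_real R12 * bv'_a a hua hua1 g g1) \<and>
        bv'_b a b hua hua1 g g1 = cis \<eta> * (complex_of_real R21 * bv_a a ua ua1 g g1 + complex_of_real R22 * bv'_a a hua hua1 g g1))}"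

text \<open>Half-interval operator T^{(a,c)}_{alpha,beta} in L2((a,c); r dx), regular at c.
  The condition g(c) cos beta - g^[1](c) sin beta = 0 gives g(c) = 0 for beta = pi and
  g^[1](c) = 0 for beta = pi/2.\<close>
definition Thalf :: "(real \<Rightarrow> real) \<Rightarrow> (real \<Rightarrow> real) \<Rightarrow> (real \<Rightarrow> real) \<Rightarrow> real \<Rightarrow> real \<Rightarrow>
    (real \<Rightarrow> real) \<Rightarrow> (real \<Rightarrow> real) \<Rightarrow> (real \<Rightarrow> real) \<Rightarrow> (real \<Rightarrow> real) \<Rightarrow> real \<Rightarrow> real \<Rightarrow>
    ((real \<Rightarrow> complex) \<times> (real \<Rightarrow> complex)) set" where
  "Thalf p q r a c ua ua1 hua hua1 \<alpha> \<beta> = {(f, h). L2w r {a<..<c} f \<and> L2w r {a<..<c} h \<and>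
      (\<exists>g g1. aeq {a<..<c} f g \<and> qd_sys p q r {a<..c} g g1 h \<and>
        complex_of_real (cos \<alpha>) * bv_a a ua ua1 g g1 + complex_of_real (sin \<alpha>) * bv'_a a hua hua1 g g1 = 0 \<and>
        complex_of_real (cos \<beta>) * g c - complex_of_real (sin \<beta>) * g1 c = 0)}"

definition unitary2 :: "(real \<Rightarrow> real) \<Rightarrow> real set \<Rightarrow> real set \<Rightarrow>
    ((real \<Rightarrow> complex) \<times> (real \<Rightarrow> complex) \<Rightarrow> (real \<Rightarrow> complex)) \<Rightarrow> bool" where
  "unitary2 r I J U \<longleftrightarrow>
     (\<forall>f1 f2. L2w r J f1 \<and> L2w r J f2 \<longrightarrow> L2w r I (U (f1, f2))) \<and>
     (\<forall>f1 f2 g1 g2 (c::complex). L2w r J f1 \<and> L2w r J f2 \<and> L2w r J g1 \<and> L2w r J g2 \<longrightarrow>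
        aeq I (U ((\<lambda>x. c * f1 x + g1 x), (\<lambda>x. c * f2 x + g2 x)))
              (\<lambda>x. c * U (f1, f2) x + U (g1, g2) x)) \<and>
     (\<forall>f1 f2. L2w r J f1 \<and> L2w r J f2 \<longrightarrow>
        (normw r I (U (f1, f2)))^2 = (normw r J f1)^2 + (normw r J f2)^2) \<and>
     (\<forall>h. L2w r I h \<longrightarrow> (\<exists>f1 f2. L2w r J f1 \<and> L2w r J f2 \<and> aeq I (U (f1, f2)) h))"

definition ueq_sum :: "(real \<Rightarrow> real) \<Rightarrow> real set \<Rightarrow> real set \<Rightarrow>
    ((real \<Rightarrow> complex) \<times> (real \<Rightarrow> complex)) set \<Rightarrow>
    ((real \<Rightarrow> complex) \<times> (real \<Rightarrow> complex)) set \<Rightarrow>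
    ((real \<Rightarrow> complex) \<times> (real \<Rightarrow> complex)) set \<Rightarrow> bool" where
  "ueq_sum r I J S A B \<longleftrightarrow> (\<exists>U. unitary2 r I J U \<and>
     S = {(\<phi>, \<psi>). L2w r I \<phi> \<and> L2w r I \<psi> \<and>
           (\<exists>f1 g1 f2 g2. (f1, g1) \<in> A \<and> (f2, g2) \<in> B \<and>
              aeq I \<phi> (U (f1, f2)) \<and> aeq I \<psi> (U (g1, g2)))})"

end

theory Submission
  imports Defs
begin

text \<open>
  The generalized boundary values turn the boundary term of Green's formula on \<open>(a, b)\<close> into the symplectic
  form \<open>x cnj y' - y cnj x'\<close>, applied to the boundary values at \<open>a\<close> of \<open>g\<close> and of its reflection \<open>P g\<close>, hence,
  equivalently, to those of \<open>g - P g\<close> and \<open>g + P g\<close>. The boundary values can be prescribed arbitrarily, and the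
  adjoint of the operator on compactly supported functions lies in the maximal operator. So self-adjoint extensions
  correspond to Lagrangian subspaces, and those that commute with the reflection to pairs of real lines in
  \<open>\<complex>\<^sup>2\<close>: one condition with angle \<open>\<alpha>\<close> on the odd part and one with angle \<open>\<alpha>'\<close> on the even part. At the midpoint
  the odd part satisfies a Dirichlet and the even part a Neumann condition, which gives the direct sum.

  Every solution for \<open>lam0\<close> that is needed is explicit in terms of \<open>ua\<close> and \<open>hua\<close>. The only other existence
  theorem (a Picard iteration) serves to transport the limit circle property, given for some spectral
  parameter, to \<open>lam0\<close>.
\<close>

section \<open>Locally absolutely continuous functions\<close>

text \<open>An L2 element is a function here, not a class, so membership in an operator always
  passes through a representative \<open>g\<close> with quasi-derivative \<open>g1\<close> that
  equals \<open>f\<close> almost everywhere. The endpoint \<open>b\<close> gets no theory of its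
  own: boundary values at \<open>b\<close> are those of the mirror image at \<open>a\<close>, and
  reflection reverses the sign of a quasi-derivative. Two solutions with Wronskian 1 do most of the
  work. Variation of constants with a source supported in \<open>{s..t}\<close> shifts the two
  coefficients by two moments of the source, and the Gram matrix of the solutions on
  \<open>{s..t}\<close> is invertible, so these moments can be prescribed. This yields both the
  arbitrary boundary values and enough test functions to identify the adjoint of \<open>T0\<close>.
  A self-adjoint \<open>S\<close> a priori controls only the sum of the forms on odd and even
  boundary values. Applying the identity once more after reflecting one argument flips the sign of
  the odd form alone; so both forms vanish separately, and each part is a maximal isotropic set in a
  two-dimensional space.\<close>

lemma interval_subset_real:
  assumes "is_interval I" "s \<in> I" "t \<in> (I::real set)"
  shows "{s..t} \<subseteq> I"
  by (metis assms is_interval_1 atLeastAtMost_iff subsetI)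

lemma set_integrable_mult_continuous:
  fixes f g :: "real \<Rightarrow> complex"
  assumes f: "set_integrable lborel {s..t} f" and g: "continuous_on {s..t} g"
  shows "set_integrable lborel {s..t} (\<lambda>x. f x * g x)"
proof -
  have "bounded (g ` {s..t})"
    using g by (intro compact_imp_bounded compact_continuous_image) auto
  then obtain B where B: "\<And>x. x \<in> {s..t} \<Longrightarrow> cmod (g x) \<le> B"
    unfolding bounded_iff by (metis imageI)
  have g': "set_borel_measurable lborel {s..t} g"
    using borel_integrable_atLeastAtMost'[OF g] unfolding set_integrable_def set_borel_measurable_def
    by auto
  have eq: "(\<lambda>x. indicator {s..t} x *\<^sub>R (f x * g x)) =
      (\<lambda>x. (indicator {s..t} x *\<^sub>R f x) * (indicator {s..t} x *\<^sub>R g x))"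
    by (auto simp: fun_eq_iff split: split_indicator)
  show ?thesis
  proof (rule set_integrable_bound)
    show "set_integrable lborel {s..t} (\<lambda>x. complex_of_real B * f x)"
      using f by simp
    show "set_borel_measurable lborel {s..t} (\<lambda>x. f x * g x)"
      using f g' unfolding set_borel_measurable_def set_integrable_def eq
      by (intro borel_measurable_times) auto
    show "AE x in lborel. x \<in> {s..t} \<longrightarrow> cmod (f x * g x) \<le> cmod (complex_of_real B * f x)"
    proof (intro always_eventually allI impI)
      fix x assume x: "x \<in> {s..t}"
      have "cmod (g x) * cmod (f x) \<le> \<bar>B\<bar> * cmod (f x)"
        using B[OF x] by (intro mult_right_mono) auto
      then show "cmod (f x * g x) \<le> cmod (complex_of_real B * f x)"
        by (simp add: norm_mult mult.commute)
    qed
  qed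
qed

lemma set_integral_Icc_split:
  fixes f :: "real \<Rightarrow> 'a::{banach, second_countable_topology}"
  assumes "set_integrable lborel {s..u} f" "s \<le> t" "t \<le> u"
  shows "(LINT x:{s..u}|lborel. f x) = (LINT x:{s..t}|lborel. f x) + (LINT x:{t..u}|lborel. f x)"
proof -
  have "AE x in lborel. \<not> (x \<in> {s..t} \<and> x \<in> {t..u})"
    using AE_lborel_singleton[of t] by eventually_elim auto
  then have "(LINT x:{s..t} \<union> {t..u}|lborel. f x) = (LINT x:{s..t}|lborel. f x) + (LINT x:{t..u}|lborel. f x)"
    using assms by (intro set_integral_Un_AE) (auto intro: set_integrable_subset)
  moreover have "{s..t} \<union> {t..u} = {s..u}" using assms by auto
  ultimately show ?thesis by simp
qed

lemma ac_repD:
  assumes "ac_rep I f f'" "s \<in> I" "t \<in> I" "s \<le> t"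
  shows "set_integrable lborel {s..t} f'" "(LINT x:{s..t}|lborel. f' x) = f t - f s"
  using assms unfolding ac_rep_def by simp_all

lemma ac_repI:
  assumes "\<And>s t. s \<in> I \<Longrightarrow> t \<in> I \<Longrightarrow> s \<le> t \<Longrightarrow> set_integrable lborel {s..t} f'"
    and "\<And>s t. s \<in> I \<Longrightarrow> t \<in> I \<Longrightarrow> s \<le> t \<Longrightarrow> (LINT x:{s..t}|lborel. f' x) = f t - f s"
  shows "ac_rep I f f'"
  unfolding ac_rep_def using assms by simp

lemma ac_rep_mono: "ac_rep I f f' \<Longrightarrow> J \<subseteq> I \<Longrightarrow> ac_rep J f f'"
  unfolding ac_rep_def by blast

lemma ac_rep_add:
  "ac_rep I f f' \<Longrightarrow> ac_rep I g g' \<Longrightarrow> ac_rep I (\<lambda>x. f x + g x) (\<lambda>x. f' x + g' x)"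
  by (rule ac_repI) (simp_all add: ac_repD)

lemma ac_rep_cmult:
  "ac_rep I f f' \<Longrightarrow> ac_rep I (\<lambda>x. c * f x) (\<lambda>x. c * f' x)"
  by (rule ac_repI) (simp_all add: ac_repD right_diff_distrib)

lemma ac_rep_diff:
  "ac_rep I f f' \<Longrightarrow> ac_rep I g g' \<Longrightarrow> ac_rep I (\<lambda>x. f x - g x) (\<lambda>x. f' x - g' x)"
  by (rule ac_repI) (simp_all add: ac_repD)

lemma ac_rep_const: "ac_rep I (\<lambda>x. c) (\<lambda>x. 0)"
  by (rule ac_repI) (simp_all add: set_integrable_def)

lemma set_integrable_cnj:
  "set_integrable M A f \<Longrightarrow> set_integrable M A (\<lambda>x. cnj (f x))"
  unfolding set_integrable_def by (drule integrable_cnj) simp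

lemma set_integral_cnj:
  "(LINT x:A|M. cnj (f x)) = cnj (LINT x:A|M. f x)"
  using Bochner_Integration.integral_cnj[of M "\<lambda>x. indicator A x *\<^sub>R f x"] by (simp add: set_lebesgue_integral_def)

lemma ac_rep_cnj:
  "ac_rep I f f' \<Longrightarrow> ac_rep I (\<lambda>x. cnj (f x)) (\<lambda>x. cnj (f' x))"
  by (rule ac_repI) (simp_all add: ac_repD set_integrable_cnj set_integral_cnj)

lemma ac_rep_cong:
  assumes "is_interval I" "\<And>x. x \<in> I \<Longrightarrow> f x = g x" "\<And>x. x \<in> I \<Longrightarrow> f' x = g' x"
  shows "ac_rep I f f' \<longleftrightarrow> ac_rep I g g'"
proof -
  have "set_integrable lborel {s..t} f' = set_integrable lborel {s..t} g'"
    "(LINT x:{s..t}|lborel. f' x) = (LINT x:{s..t}|lborel. g' x)" if "s \<in> I" "t \<in> I" for s t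
    using interval_subset_real[OF assms(1) that] assms(3)
    by (intro set_integrable_cong set_lebesgue_integral_cong; auto)+
  then show ?thesis unfolding ac_rep_def using assms(2) by auto
qed

lemma ac_rep_continuous_Icc:
  assumes "ac_rep I f f'" "is_interval I" "s \<in> I" "t \<in> I"
  shows "continuous_on {s..t} f"
proof (cases "s \<le> t")
  case True
  note st = interval_subset_real[OF assms(2-4)]
  have "set_integrable lborel {s..t} f'" using ac_repD assms True by blast
  then have "continuous_on {s..t} (\<lambda>x. f s + integral {s..x} f')"
    by (intro continuous_intros indefinite_integral_continuous_1 set_borel_integral_eq_integral)
  moreover have "f s + integral {s..x} f' = f x" if "x \<in> {s..t}" for x
  proof -
    have "x \<in> I" using that st by auto
    then show ?thesis using ac_repD[OF assms(1) assms(3), of x] that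
      by (simp add: set_borel_integral_eq_integral)
  qed
  ultimately show ?thesis using continuous_on_cong[of "{s..t}" "{s..t}" f "\<lambda>x. f s + integral {s..x} f'"] by simp
qed auto

lemma ac_rep_continuous:
  assumes "ac_rep I f f'" "is_interval I"
  shows "continuous_on I f"
  unfolding continuous_on_eq_continuous_within
proof
  fix x assume x: "x \<in> I"
  \<comment> \<open>\<open>s\<close> lies strictly below \<open>x\<close> if \<open>I\<close> has
    such a point; otherwise \<open>x\<close> is the left endpoint, \<open>s = x\<close>, and
    \<open>s'\<close> is some smaller number. With \<open>t\<close> and \<open>t'\<close> chosen
    alike, \<open>{s..t}\<close> and \<open>I\<close> agree near \<open>x\<close>, so open,
    half-open and closed intervals need no separate treatment.\<close>
  obtain s s' where s: "s \<in> I" "s \<le> x" "s' < x" "\<And>y. y \<in> I \<Longrightarrow> s' < y \<Longrightarrow> s \<le> y"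
  proof (cases "\<exists>y\<in>I. y < x")
    case True
    then obtain y where "y \<in> I" "y < x" by auto
    then show ?thesis by (intro that[of y y]) auto
  next
    case False
    then show ?thesis using x by (intro that[of x "x - 1"]) (auto simp: not_less)
  qed
  obtain t t' where t: "t \<in> I" "x \<le> t" "x < t'" "\<And>y. y \<in> I \<Longrightarrow> y < t' \<Longrightarrow> y \<le> t"
  proof (cases "\<exists>y\<in>I. x < y")
    case True
    then obtain y where "y \<in> I" "x < y" by auto
    then show ?thesis by (intro that[of y y]) auto
  next
    case False
    then show ?thesis using x by (intro that[of x "x + 1"]) (auto simp: not_less)
  qed
  have "continuous_on {s..t} f" by (rule ac_rep_continuous_Icc[OF assms s(1) t(1)])
  then have "continuous (at x within {s..t}) f"
    using s t by (auto simp: continuous_on_eq_continuous_within)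
  moreover have "at x within {s..t} = at x within I"
  proof (rule at_within_nhd[of x "{s'<..<t'}"])
    show "{s..t} \<inter> {s'<..<t'} - {x} = I \<inter> {s'<..<t'} - {x}"
      using s(4) t(4) interval_subset_real[OF assms(2) s(1) t(1)] by fastforce
  qed (use s t in auto)
  ultimately show "continuous (at x within I) f" by metis
qed

text \<open>Integration by parts from Fubini: integrate \<open>f' y * g' x\<close> over the triangle
  \<open>s \<le> x \<le> y \<le> t\<close> in both orders. Only the integral representations are
  used, never pointwise derivatives.\<close>

lemma ac_rep_mult:
  assumes f: "ac_rep I f f'" and g: "ac_rep I g g'" and I: "is_interval I"
  shows "ac_rep I (\<lambda>x. f x * g x) (\<lambda>x. f' x * g x + f x * g' x)"
  unfolding ac_rep_def
proof (intro ballI impI)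
  fix s t assume s: "s \<in> I" and t: "t \<in> I" and st: "s \<le> t"
  have sub: "{s..t} \<subseteq> I" by (rule interval_subset_real[OF I s t])
  have cf: "continuous_on {s..t} f" and cg: "continuous_on {s..t} g"
    using ac_rep_continuous_Icc f g I s t by blast+
  have if': "set_integrable lborel {s..t} f'" and ig': "set_integrable lborel {s..t} g'"
    using ac_repD f g s t st by blast+
  have i1: "set_integrable lborel {s..t} (\<lambda>x. f' x * g x)"
    by (rule set_integrable_mult_continuous[OF if' cg])
  have i2: "set_integrable lborel {s..t} (\<lambda>x. f x * g' x)"
    using set_integrable_mult_continuous[OF ig' cf] by (simp add: mult.commute)
  define F where "F = (\<lambda>x. indicator {s..t} x *\<^sub>R f' x)"
  define G where "G = (\<lambda>x. indicator {s..t} x *\<^sub>R g' x)"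
  have F: "integrable lborel F" and G: "integrable lborel G"
    using if' ig' unfolding F_def G_def set_integrable_def by auto
  have [measurable]: "F \<in> borel_measurable lborel" "G \<in> borel_measurable lborel"
    using F G by auto
  have [measurable]: "Measurable.pred (lborel \<Otimes>\<^sub>M lborel) (\<lambda>z::real\<times>real. fst z \<le> snd z)"
    by measurable
  define K where "K = (\<lambda>z::real\<times>real. if fst z \<le> snd z then F (snd z) * G (fst z) else 0)"
  have K0: "integrable (lborel \<Otimes>\<^sub>M lborel) (\<lambda>z::real\<times>real. F (snd z) * G (fst z))"
  proof (rule lborel_pair.Fubini_integrable)
    show "(\<lambda>z. F (snd z) * G (fst z)) \<in> borel_measurable (lborel \<Otimes>\<^sub>M lborel)" by measurable
    have "(\<lambda>x. \<integral> y. norm (F (snd (x, y)) * G (fst (x, y))) \<partial>lborel) =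
       (\<lambda>x. (\<integral> y. norm (F y) \<partial>lborel) * norm (G x))"
      by (simp add: norm_mult)
    then show "integrable lborel (\<lambda>x. \<integral> y. norm (F (snd (x, y)) * G (fst (x, y))) \<partial>lborel)"
      using G by simp
    show "AE x in lborel. integrable lborel (\<lambda>y. F (snd (x, y)) * G (fst (x, y)))"
      using F by simp
  qed
  have K: "integrable (lborel \<Otimes>\<^sub>M lborel) K"
    by (rule Bochner_Integration.integrable_bound[OF K0]) (auto simp: K_def)
  have K': "integrable (lborel \<Otimes>\<^sub>M lborel) (\<lambda>(x, y). K (x, y))" using K by simp
  have "(\<integral>y. (\<integral>x. K (x, y) \<partial>lborel) \<partial>lborel) = (\<integral>x. (\<integral>y. K (x, y) \<partial>lborel) \<partial>lborel)"
    by (rule lborel_pair.Fubini_integral[OF K'])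
  moreover have "(\<integral>x. K (x, y) \<partial>lborel) = indicator {s..t} y *\<^sub>R (f' y * (g y - g s))" for y
  proof (cases "y \<in> {s..t}")
    case True
    have "(\<integral>x. K (x, y) \<partial>lborel) = (\<integral>x. f' y * (indicator {s..y} x *\<^sub>R g' x) \<partial>lborel)"
      using True by (intro Bochner_Integration.integral_cong) (auto simp: K_def F_def G_def split: split_indicator)
    also have "\<dots> = f' y * (LINT x:{s..y}|lborel. g' x)"
      by (simp only: set_lebesgue_integral_def integral_mult_right_zero)
    also have "\<dots> = f' y * (g y - g s)"
      using ac_repD[OF g s, of y] True sub by auto
    finally show ?thesis using True by simp
  qed (auto simp: K_def F_def cong: if_cong)
  moreover have "(\<integral>y. K (x, y) \<partial>lborel) = indicator {s..t} x *\<^sub>R (g' x * (f t - f x))" for x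
  proof (cases "x \<in> {s..t}")
    case True
    have "(\<integral>y. K (x, y) \<partial>lborel) = (\<integral>y. g' x * (indicator {x..t} y *\<^sub>R f' y) \<partial>lborel)"
      using True by (intro Bochner_Integration.integral_cong) (auto simp: K_def F_def G_def split: split_indicator)
    also have "\<dots> = g' x * (LINT y:{x..t}|lborel. f' y)"
      by (simp only: set_lebesgue_integral_def integral_mult_right_zero)
    also have "\<dots> = g' x * (f t - f x)"
      using ac_repD[OF f _ t, of x] True sub by auto
    finally show ?thesis using True by simp
  qed (auto simp: K_def G_def cong: if_cong)
  ultimately have eq: "(LINT x:{s..t}|lborel. f' x * (g x - g s)) = (LINT x:{s..t}|lborel. g' x * (f t - f x))"
    unfolding set_lebesgue_integral_def by simp
  have e1: "(LINT x:{s..t}|lborel. f' x * (g x - g s)) = (LINT x:{s..t}|lborel. f' x * g x) - (f t - f s) * g s"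
    using i1 if' ac_repD(2)[OF f s t st] by (simp add: right_diff_distrib)
  have e2: "(LINT x:{s..t}|lborel. g' x * (f t - f x)) = (g t - g s) * f t - (LINT x:{s..t}|lborel. f x * g' x)"
    using i2 ig' unfolding ac_repD(2)[OF g s t st, symmetric]
    by (simp add: right_diff_distrib mult.commute[of "g' _"] mult.commute[of _ "f t"])
  have "(LINT x:{s..t}|lborel. f' x * g x) + (LINT x:{s..t}|lborel. f x * g' x) = f t * g t - f s * g s"
    using eq[unfolded e1 e2] by (simp add: algebra_simps)
  then show "set_integrable lborel {s..t} (\<lambda>x. f' x * g x + f x * g' x) \<and>
      f t * g t - f s * g s = (LINT x:{s..t}|lborel. f' x * g x + f x * g' x)"
    using i1 i2 by simp
qed

section \<open>Reflections, gluing, primitives and limits\<close>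

lemma set_integral_lborel_reflect:
  fixes f :: "real \<Rightarrow> 'a::{banach, second_countable_topology}"
  shows "(LINT x:{x. d - x \<in> A}|lborel. f (d - x)) = (LINT x:A|lborel. f x)"
proof -
  have eq: "(\<lambda>x. indicator {x. d - x \<in> A} x *\<^sub>R f (d - x)) = (\<lambda>x. indicator A (d + (- 1) * x) *\<^sub>R f (d + (- 1) * x))"
    by (simp add: fun_eq_iff split: split_indicator)
  have "(LINT x:A|lborel. f x) = \<bar>- 1\<bar> *\<^sub>R (\<integral>x. indicator A (d + (- 1) * x) *\<^sub>R f (d + (- 1) * x) \<partial>lborel)"
    unfolding set_lebesgue_integral_def
    by (rule lborel_integral_real_affine[of "- 1" "\<lambda>x. indicator A x *\<^sub>R f x" d]) simp
  then show ?thesis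
    unfolding set_lebesgue_integral_def eq by (simp only: abs_neg_one scaleR_one)
qed

lemma set_integrable_lborel_reflect:
  fixes f :: "real \<Rightarrow> 'a::{banach, second_countable_topology}"
  shows "set_integrable lborel {x. d - x \<in> A} (\<lambda>x. f (d - x)) \<longleftrightarrow> set_integrable lborel A f"
proof -
  have eq: "(\<lambda>x. indicator {x. d - x \<in> A} x *\<^sub>R f (d - x)) = (\<lambda>x. indicator A (d + (- 1) * x) *\<^sub>R f (d + (- 1) * x))"
    by (simp add: fun_eq_iff split: split_indicator)
  show ?thesis
    unfolding set_integrable_def eq
    by (rule lborel_integrable_real_affine_iff[of "-1" "\<lambda>x. indicator A x *\<^sub>R f x" d]) simp
qed

lemma AE_lborel_reflect:
  assumes "AE x in lborel. P (x::real)"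
  shows "AE x in lborel. P (d - x)"
proof -
  obtain N where N: "{x. \<not> P x} \<subseteq> N" "N \<in> null_sets lborel"
    using assms by (auto simp: eventually_ae_filter)
  have "AE x in lborel. d - x \<notin> N"
  proof -
    have [measurable]: "N \<in> sets borel" using N by auto
    have "emeasure lborel N = (\<integral>\<^sup>+x. indicator N x \<partial>lborel)" using N(2) by auto
    also have "\<dots> = (\<integral>\<^sup>+x. indicator N (d - x) \<partial>lborel)"
      by (subst nn_integral_real_affine[where c="-1" and t=d]) auto
    finally have "(\<integral>\<^sup>+x. indicator N (d - x) \<partial>lborel) = 0" using N(2) by auto
    then have "AE x in lborel. indicator N (d - x) = (0::ennreal)"
      by (subst (asm) nn_integral_0_iff_AE) auto
    then show ?thesis by eventually_elim (auto simp: indicator_def split: if_splits)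
  qed
  then show ?thesis by eventually_elim (use N in auto)
qed

lemma ac_rep_reflect:
  assumes "ac_rep I f f'"
  shows "ac_rep {x. d - x \<in> I} (\<lambda>x. f (d - x)) (\<lambda>x. - f' (d - x))"
  unfolding ac_rep_def
proof (intro ballI impI)
  fix s t assume st: "s \<in> {x. d - x \<in> I}" "t \<in> {x. d - x \<in> I}" "s \<le> t"
  have eq: "{x. d - x \<in> {d-t..d-s}} = {s..t}" by auto
  have "set_integrable lborel {d-t..d-s} f'" "(LINT x:{d-t..d-s}|lborel. f' x) = f (d-s) - f (d-t)"
    using ac_repD[OF assms, of "d-t" "d-s"] st by auto
  then have "set_integrable lborel {s..t} (\<lambda>x. f' (d - x))" "(LINT x:{s..t}|lborel. f' (d-x)) = f (d-s) - f (d-t)"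
    using set_integrable_lborel_reflect[of d "{d-t..d-s}" f'] set_integral_lborel_reflect[of d "{d-t..d-s}" f']
    by (simp_all only: eq)
  then show "set_integrable lborel {s..t} (\<lambda>x. - f' (d - x)) \<and>
     f (d-t) - f (d-s) = (LINT x:{s..t}|lborel. - f' (d - x))"
    using set_integrable_mult_right[of "-1" lborel "{s..t}" "\<lambda>x. f' (d - x)"]
    by (auto simp: set_integral_uminus)
qed

lemma ac_rep_Un:
  assumes I: "ac_rep I f f'" and J: "ac_rep J f f'" and m: "m \<in> I" "m \<in> J"
    and le: "\<And>x. x \<in> I \<Longrightarrow> x \<le> m" "\<And>x. x \<in> J \<Longrightarrow> m \<le> x"
  shows "ac_rep (I \<union> J) f f'"
  unfolding ac_rep_def
proof (intro ballI impI)
  fix s t assume st: "s \<in> I \<union> J" "t \<in> I \<union> J" "s \<le> t"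
  \<comment> \<open>The last case is \<open>s \<in> J\<close> and \<open>t \<in> I\<close>, where
    \<open>s \<le> t\<close> leaves only the common point.\<close>
  consider "s \<in> I" "t \<in> I" | "s \<in> J" "t \<in> J" | "s \<in> I" "t \<in> J" | "s = m" "t = m"
    using st le by (metis Un_iff order_antisym order_trans)
  then show "set_integrable lborel {s..t} f' \<and> f t - f s = (LINT x:{s..t}|lborel. f' x)"
  proof cases
    case 3
    have l: "s \<le> m" "m \<le> t" using 3 le by auto
    have i: "set_integrable lborel {s..m} f'" "set_integrable lborel {m..t} f'"
      using ac_repD[OF I, of s m] ac_repD[OF J, of m t] 3 l m by auto
    have "set_integrable lborel ({s..m} \<union> {m..t}) f'"
      using i by (intro set_integrable_Un) auto
    moreover have "{s..m} \<union> {m..t} = {s..t}" using l by auto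
    ultimately have i': "set_integrable lborel {s..t} f'" by simp
    then show ?thesis using set_integral_Icc_split[OF i' l] ac_repD[OF I, of s m] ac_repD[OF J, of m t] 3 l m
      by auto
  next
    case 4 then show ?thesis using ac_repD[OF I m(1) m(1)] by auto
  qed (use ac_repD[OF I, of s t] ac_repD[OF J, of s t] st in auto)
qed

lemma ac_rep_exists:
  fixes f' :: "real \<Rightarrow> complex"
  assumes "\<And>s t. s \<in> I \<Longrightarrow> t \<in> I \<Longrightarrow> s \<le> t \<Longrightarrow> set_integrable lborel {s..t} f'" and c: "c \<in> I"
  shows "\<exists>f. ac_rep I f f' \<and> f c = A"
proof -
  define f where "f x = (if c \<le> x then A + (LINT x:{c..x}|lborel. f' x) else A - (LINT x:{x..c}|lborel. f' x))" for x
  have "f t - f s = (LINT x:{s..t}|lborel. f' x)" if st: "s \<in> I" "t \<in> I" "s \<le> t" for s t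
  proof -
    consider "c \<le> s" | "s < c" "c \<le> t" | "t < c" using st  by linarith
    then show ?thesis
    proof cases
      case 1 then show ?thesis
        using set_integral_Icc_split[of c t f' s] assms(1)[OF c st(2)] st by (auto simp: f_def)
    next
      case 2 then show ?thesis
        using set_integral_Icc_split[of s t f' c] assms(1)[OF st] st by (auto simp: f_def)
    next
      case 3 then show ?thesis
        using set_integral_Icc_split[of s c f' t] assms(1)[OF st(1) c] st by (auto simp: f_def)
    qed
  qed
  moreover have "f c = A"
    unfolding f_def set_lebesgue_integral_def
    using AE_lborel_singleton[of c] by (auto intro!: integral_eq_zero_AE split: split_indicator)
  ultimately show ?thesis using assms unfolding ac_rep_def by blast
qed

text \<open>Dominated convergence. The majorant \<open>w s t\<close> may depend on the compact
  subinterval, because the Picard sums are bounded only locally.\<close>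

lemma ac_rep_limit:
  fixes fs fs' :: "nat \<Rightarrow> real \<Rightarrow> complex" and w :: "real \<Rightarrow> real \<Rightarrow> real \<Rightarrow> real"
  assumes I: "is_interval I" and ac: "\<And>n. ac_rep I (fs n) (fs' n)"
    and f: "\<And>x. x \<in> I \<Longrightarrow> (\<lambda>n. fs n x) \<longlonglongrightarrow> f x"
    and f': "\<And>x. x \<in> I \<Longrightarrow> (\<lambda>n. fs' n x) \<longlonglongrightarrow> f' x"
    and w: "\<And>s t. s \<in> I \<Longrightarrow> t \<in> I \<Longrightarrow> s \<le> t \<Longrightarrow> set_integrable lborel {s..t} (w s t)"
    and bd: "\<And>s t n x. s \<in> I \<Longrightarrow> t \<in> I \<Longrightarrow> x \<in> {s..t} \<Longrightarrow> cmod (fs' n x) \<le> w s t x"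
  shows "ac_rep I f f'"
  unfolding ac_rep_def
proof (intro ballI impI)
  fix s t assume st: "s \<in> I" "t \<in> I" "s \<le> t"
  have sub: "{s..t} \<subseteq> I" by (rule interval_subset_real[OF I st(1,2)])
  have m: "(\<lambda>x. indicator {s..t} x *\<^sub>R fs' n x) \<in> borel_measurable lborel" for n
    using ac_repD(1)[OF ac st] unfolding set_integrable_def by auto
  have lim: "(\<lambda>n. indicator {s..t} x *\<^sub>R fs' n x) \<longlonglongrightarrow> indicator {s..t} x *\<^sub>R f' x" for x
    using f'[of x] sub by (cases "x \<in> {s..t}") auto
  have m': "(\<lambda>x. indicator {s..t} x *\<^sub>R f' x) \<in> borel_measurable lborel"
    by (rule borel_measurable_LIMSEQ_metric[OF m]) (rule lim)
  have D: "integrable lborel (\<lambda>x. indicator {s..t} x *\<^sub>R f' x)"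
    "(\<lambda>n. \<integral>x. indicator {s..t} x *\<^sub>R fs' n x \<partial>lborel) \<longlonglongrightarrow> (\<integral>x. indicator {s..t} x *\<^sub>R f' x \<partial>lborel)"
  proof -
    have w': "integrable lborel (\<lambda>x. indicator {s..t} x *\<^sub>R w s t x)" using w[OF st] unfolding set_integrable_def .
    have b: "AE x in lborel. norm (indicator {s..t} x *\<^sub>R fs' n x) \<le> indicator {s..t} x *\<^sub>R w s t x" for n
      using bd[OF st(1,2), of _ n] by (intro always_eventually) (auto split: split_indicator)
    show "integrable lborel (\<lambda>x. indicator {s..t} x *\<^sub>R f' x)"
      by (rule integrable_dominated_convergence[OF m' m w' always_eventually[OF allI[OF lim]] b])
    show "(\<lambda>n. \<integral>x. indicator {s..t} x *\<^sub>R fs' n x \<partial>lborel) \<longlonglongrightarrow> (\<integral>x. indicator {s..t} x *\<^sub>R f' x \<partial>lborel)"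
      by (rule integral_dominated_convergence[OF m' m w' always_eventually[OF allI[OF lim]] b])
  qed
  have "(\<lambda>n. fs n t - fs n s) \<longlonglongrightarrow> f t - f s" using f st by (intro tendsto_diff) auto
  then have "(\<lambda>n. \<integral>x. indicator {s..t} x *\<^sub>R fs' n x \<partial>lborel) \<longlonglongrightarrow> f t - f s"
    using ac_repD(2)[OF ac st] unfolding set_lebesgue_integral_def by simp
  with D show "set_integrable lborel {s..t} f' \<and> f t - f s = (LINT x:{s..t}|lborel. f' x)"
    unfolding set_integrable_def set_lebesgue_integral_def using LIMSEQ_unique by blast
qed

text \<open>Extended by zero, \<open>F'\<close> is integrable on the whole line and has a continuous
  primitive there. Normalised to agree with \<open>F\<close> at the midpoint, this primitive
  supplies both one-sided limits.\<close>

lemma ac_rep_limits_Ioo: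
  assumes ac: "ac_rep {a<..<b} F F'" and ab: "a < b" and int: "set_integrable lborel {a<..<b} F'"
  obtains L R where "(F \<longlongrightarrow> L) (at_right a)" "(F \<longlongrightarrow> R) (at_left b)"
    "(LINT x:{a<..<b}|lborel. F' x) = R - L"
proof -
  let ?c = "(a+b)/2"
  define f where "f x = indicator {a<..<b} x *\<^sub>R F' x" for x
  have c: "?c \<in> {a<..<b}" using ab by auto
  have f: "integrable lborel f" using int unfolding f_def set_integrable_def .
  have fi: "set_integrable lborel {s..t} f" for s t
    unfolding set_integrable_def using f by (intro integrable_mult_indicator) auto
  obtain G where G: "ac_rep UNIV G f" "G ?c = F ?c"
    using ac_rep_exists[of UNIV f ?c "F ?c"] fi by auto
  have "continuous_on UNIV G" using ac_rep_continuous[OF G(1)] by simp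
  then have cont: "isCont G x" for x by (simp add: continuous_on_eq_continuous_at)
  have eq: "F x = G x" if x: "x \<in> {a<..<b}" for x
  proof -
    have e: "(LINT x:{s..t}|lborel. f x) = (LINT x:{s..t}|lborel. F' x)" if "s \<in> {a<..<b}" "t \<in> {a<..<b}" for s t
      using that by (intro set_lebesgue_integral_cong) (auto simp: f_def)
    show ?thesis
    proof (cases "x \<le> ?c")
      case True
      then show ?thesis using ac_repD(2)[OF G(1), of x ?c] ac_repD(2)[OF ac x c] e[OF x c] G(2) by simp
    next
      case False
      then show ?thesis using ac_repD(2)[OF G(1), of ?c x] ac_repD(2)[OF ac c x] e[OF c x] G(2) by simp
    qed
  qed
  show ?thesis
  proof (rule that)
    have "(G \<longlongrightarrow> G a) (at_right a)" using cont[of a] by (simp add: isCont_def filterlim_at_split)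
    moreover have "eventually (\<lambda>x. F x = G x) (at_right a)"
      by (rule eventually_at_rightI[OF eq ab])
    ultimately show "(F \<longlongrightarrow> G a) (at_right a)" by (simp add: tendsto_cong)
    have "(G \<longlongrightarrow> G b) (at_left b)" using cont[of b] by (simp add: isCont_def filterlim_at_split)
    moreover have "eventually (\<lambda>x. F x = G x) (at_left b)"
      by (rule eventually_at_leftI[OF eq ab])
    ultimately show "(F \<longlongrightarrow> G b) (at_left b)" by (simp add: tendsto_cong)
    have "(LINT x:{a..b}|lborel. f x) = (LINT x:{a<..<b}|lborel. F' x)"
      unfolding set_lebesgue_integral_def f_def
      by (intro Bochner_Integration.integral_cong) (auto split: split_indicator)
    then show "(LINT x:{a<..<b}|lborel. F' x) = G b - G a"
      using ac_repD(2)[OF G(1), of a b] ab by simp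
  qed
qed

section \<open>Linear first-order systems\<close>

lemma ac_rep_power:
  assumes "ac_rep I M m" "is_interval I"
  shows "ac_rep I (\<lambda>x. M x ^ Suc n) (\<lambda>x. of_nat (Suc n) * M x ^ n * m x)"
proof (induction n)
  case 0 show ?case using assms(1) by simp
next
  case (Suc n)
  have "ac_rep I (\<lambda>x. M x * M x ^ Suc n) (\<lambda>x. m x * M x ^ Suc n + M x * (of_nat (Suc n) * M x ^ n * m x))"
    by (rule ac_rep_mult[OF assms(1) Suc assms(2)])
  moreover have "(\<lambda>x. m x * M x ^ Suc n + M x * (of_nat (Suc n) * M x ^ n * m x)) =
      (\<lambda>x. of_nat (Suc (Suc n)) * M x ^ Suc n * m x)"
    by (simp add: fun_eq_iff algebra_simps)
  ultimately show ?case by simp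
qed

lemma set_integrable_complex_of_real:
  "set_integrable M A (\<lambda>x. complex_of_real (f x)) \<longleftrightarrow> set_integrable M A f"
proof -
  have "(\<lambda>x. indicator A x *\<^sub>R complex_of_real (f x)) = (\<lambda>x. complex_of_real (indicator A x *\<^sub>R f x))"
    by (simp add: scaleR_conv_of_real)
  then show ?thesis unfolding set_integrable_def by (simp only: complex_of_real_integrable_eq)
qed

lemma ac_rep_Re:
  assumes "ac_rep I f (\<lambda>x. complex_of_real (g x))"
  shows "ac_rep I (\<lambda>x. complex_of_real (Re (f x))) (\<lambda>x. complex_of_real (g x))"
proof (rule ac_repI)
  fix s t assume st: "s \<in> I" "t \<in> I" "s \<le> t"
  show "set_integrable lborel {s..t} (\<lambda>x. complex_of_real (g x))" by (rule ac_repD[OF assms st])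
  have "complex_of_real (LINT x:{s..t}|lborel. g x) = f t - f s"
    using ac_repD(2)[OF assms st] by (simp only: set_integral_complex_of_real)
  then show "(LINT x:{s..t}|lborel. complex_of_real (g x)) = complex_of_real (Re (f t)) - complex_of_real (Re (f s))"
    by (metis set_integral_complex_of_real Re_complex_of_real minus_complex.simps(1) of_real_diff)
qed

text \<open>A mean value inequality with majorant \<open>g\<close>. It drives both the Picard bounds
  and the limit circle estimate.\<close>

lemma ac_rep_norm_increment:
  assumes f: "ac_rep I f f'" and g: "ac_rep I (\<lambda>x. complex_of_real (G x)) (\<lambda>x. complex_of_real (g x))"
    and I: "is_interval I" "s \<in> I" "t \<in> I" "s \<le> t"
    and le: "\<And>x. x \<in> {s..t} \<Longrightarrow> cmod (f' x) \<le> g x"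
  shows "cmod (f t - f s) \<le> G t - G s"
proof -
  have i: "set_integrable lborel {s..t} f'" "set_integrable lborel {s..t} (\<lambda>x. complex_of_real (g x))"
    using ac_repD(1)[OF f I(2-4)] ac_repD(1)[OF g I(2-4)] by auto
  have ig: "set_integrable lborel {s..t} g"
    using i(2) by (simp only: set_integrable_complex_of_real)
  have "cmod (f t - f s) = cmod (LINT x:{s..t}|lborel. f' x)"
    using ac_repD(2)[OF f I(2-4)] by simp
  also have "\<dots> \<le> (LINT x:{s..t}|lborel. cmod (f' x))"
    by (rule set_integral_norm_bound[OF i(1)])
  also have "\<dots> \<le> (LINT x:{s..t}|lborel. g x)"
    using i(1) ig le by (intro set_integral_mono) (auto intro: set_integrable_norm)
  also have "complex_of_real \<dots> = complex_of_real (G t - G s)"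
    using ac_repD(2)[OF g I(2-4)] by (simp add: set_integral_complex_of_real)
  then have "(LINT x:{s..t}|lborel. g x) = G t - G s" by (simp only: of_real_eq_iff)
  finally show ?thesis .
qed

text \<open>Picard iteration; the \<open>n\<close>-th increment is bounded by \<open>C * \<bar>M x\<bar> ^ n / fact n\<close>,
  where \<open>M\<close> is the primitive of \<open>\<bar>w\<bar> + \<bar>v\<bar>\<close> vanishing at \<open>c\<close>.\<close>

lemma linear_system_exists:
  fixes w v :: "real \<Rightarrow> complex"
  assumes I: "is_interval I" and c: "c \<in> I"
    and w: "\<And>s t. s \<in> I \<Longrightarrow> t \<in> I \<Longrightarrow> s \<le> t \<Longrightarrow> set_integrable lborel {s..t} w"
    and v: "\<And>s t. s \<in> I \<Longrightarrow> t \<in> I \<Longrightarrow> s \<le> t \<Longrightarrow> set_integrable lborel {s..t} v"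
  shows "\<exists>g g1. ac_rep I g (\<lambda>x. w x * g1 x) \<and> ac_rep I g1 (\<lambda>x. v x * g x) \<and> g c = A \<and> g1 c = B"
proof -
  define m where "m x = cmod (w x) + cmod (v x)" for x
  have m: "set_integrable lborel {s..t} m" if "s \<in> I" "t \<in> I" "s \<le> t" for s t
    unfolding m_def using w[OF that] v[OF that] by (intro set_integral_add set_integrable_norm)
  have mc: "set_integrable lborel {s..t} (\<lambda>x. complex_of_real (m x))" if "s \<in> I" "t \<in> I" "s \<le> t" for s t
    using m[OF that] by (simp only: set_integrable_complex_of_real)
  obtain M0 where M0: "ac_rep I M0 (\<lambda>x. complex_of_real (m x))" "M0 c = 0"
    using ac_rep_exists[of I "\<lambda>x. complex_of_real (m x)" c 0] mc c by blast
  define M where "M x = Re (M0 x)" for x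
  have M: "ac_rep I (\<lambda>x. complex_of_real (M x)) (\<lambda>x. complex_of_real (m x))"
    unfolding M_def by (rule ac_rep_Re[OF M0(1)])
  have Mc: "M c = 0" using M0(2) by (simp add: M_def)
  have m0: "0 \<le> m x" for x by (simp add: m_def)
  have mono: "M s \<le> M t" if "s \<in> I" "t \<in> I" "s \<le> t" for s t
  proof -
    have "cmod (0 - 0) \<le> M t - M s"
      by (rule ac_rep_norm_increment[OF ac_rep_const M I that]) (simp add: m0)
    then show ?thesis by simp
  qed
  \<comment> \<open>\<open>e\<close> is a sign. Left of \<open>c\<close> the primitive
    \<open>M\<close> is nonpositive, so \<open>e = -1\<close> produces the powers of
    \<open>\<bar>M x\<bar>\<close> there.\<close>
  have Mpow: "ac_rep I (\<lambda>x. complex_of_real (C * (e * M x) ^ Suc n / fact (Suc n)))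
     (\<lambda>x. complex_of_real (e * (m x * (C * (e * M x) ^ n / fact n))))" for C e n
  proof -
    have ac: "ac_rep I (\<lambda>x. complex_of_real (C * e ^ Suc n / fact (Suc n)) * complex_of_real (M x) ^ Suc n)
      (\<lambda>x. complex_of_real (C * e ^ Suc n / fact (Suc n)) *
          (of_nat (Suc n) * complex_of_real (M x) ^ n * complex_of_real (m x)))"
      by (intro ac_rep_cmult ac_rep_power M I)
    have e1: "complex_of_real (C * e ^ Suc n / fact (Suc n)) * complex_of_real (M x) ^ Suc n =
       complex_of_real (C * (e * M x) ^ Suc n / fact (Suc n))" for x
      by (simp add: power_mult_distrib)
    have e2: "complex_of_real (C * e ^ Suc n / fact (Suc n)) *
          (of_nat (Suc n) * complex_of_real (M x) ^ n * complex_of_real (m x)) =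
       complex_of_real (e * (m x * (C * (e * M x) ^ n / fact n)))" for x
    proof -
      have "C * e ^ Suc n / fact (Suc n) * (real (Suc n) * M x ^ n * m x) = e * (m x * (C * (e * M x) ^ n / fact n))"
      proof -
        have "C * (e * k) / (S * F) * (S * l * m x) = e * (m x * (C * (k * l) / F))" if "S \<noteq> 0" for S F k l :: real
          using that by simp
        from this[of "real (Suc n)" "e ^ n" "fact n" "M x ^ n"] show ?thesis
          by (simp only: fact_Suc power_Suc power_mult_distrib of_nat_eq_0_iff nat.simps simp_thms)
      qed
      from arg_cong[OF this, of complex_of_real] show ?thesis
        by (simp only: of_real_mult of_real_power of_real_of_nat_eq of_real_divide)
    qed
    show ?thesis by (rule ac_rep_cong[OF I e1 e2, THEN iffD1, OF ac])
  qed
  have cont_int: "set_integrable lborel {s..t} (\<lambda>x. u x * f x)"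
    if "continuous_on I f" "\<And>s t. s \<in> I \<Longrightarrow> t \<in> I \<Longrightarrow> s \<le> t \<Longrightarrow> set_integrable lborel {s..t} u"
      "s \<in> I" "t \<in> I" "s \<le> t" for u f :: "real \<Rightarrow> complex" and s t
    by (rule set_integrable_mult_continuous[OF that(2)[OF that(3-5)]
          continuous_on_subset[OF that(1) interval_subset_real[OF I that(3,4)]]])
  \<comment> \<open>The chosen primitive vanishes at \<open>c\<close>; hence all increments after
    the first do, and the initial values stay \<open>A\<close> and \<open>B\<close>.\<close>
  define J where "J u f = (SOME F. ac_rep I F (\<lambda>x. u x * f x) \<and> F c = 0)" for u f :: "real \<Rightarrow> complex"
  have J: "ac_rep I (J u f) (\<lambda>x. u x * f x)" "J u f c = 0"
    if "continuous_on I f" "\<And>s t. s \<in> I \<Longrightarrow> t \<in> I \<Longrightarrow> s \<le> t \<Longrightarrow> set_integrable lborel {s..t} u" for u f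
  proof -
    have "\<exists>F. ac_rep I F (\<lambda>x. u x * f x) \<and> F c = 0"
      by (rule ac_rep_exists[OF _ c]) (rule cont_int[OF that])
    then have "ac_rep I (J u f) (\<lambda>x. u x * f x) \<and> J u f c = 0"
      unfolding J_def by (rule someI_ex)
    then show "ac_rep I (J u f) (\<lambda>x. u x * f x)" "J u f c = 0" by auto
  qed
  \<comment> \<open>The components of \<open>P n\<close> are the \<open>n\<close>-th increments of
    the two unknowns, not the approximants. By linearity each increment comes from the preceding one
    of the other unknown.\<close>
  define P where "P = rec_nat (\<lambda>x::real. A, \<lambda>x::real. B) (\<lambda>n fg. (J w (snd fg), J v (fst fg)))"
  define f where "f n = fst (P n)" for n
  define g where "g n = snd (P n)" for n
  have f0: "f 0 = (\<lambda>x. A)" and g0: "g 0 = (\<lambda>x. B)" and fS: "f (Suc n) = J w (g n)" and gS: "g (Suc n) = J v (f n)" for n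
    by (simp_all add: f_def g_def P_def)
  have cont: "continuous_on I (f n) \<and> continuous_on I (g n)" for n
  proof (induction n)
    case 0 show ?case by (simp add: f0 g0)
  next
    case (Suc n)
    then show ?case using J(1)[of "g n" w] J(1)[of "f n" v] w v ac_rep_continuous I
      unfolding fS gS by blast
  qed
  have facS: "ac_rep I (f (Suc n)) (\<lambda>x. w x * g n x)" "f (Suc n) c = 0"
    and gacS: "ac_rep I (g (Suc n)) (\<lambda>x. v x * f n x)" "g (Suc n) c = 0" for n
    using J[of "g n" w] J[of "f n" v] w v cont[of n] unfolding fS gS by auto
  define C where "C = cmod A + cmod B"
  have bound: "cmod (f n x) \<le> C * \<bar>M x\<bar> ^ n / fact n \<and> cmod (g n x) \<le> C * \<bar>M x\<bar> ^ n / fact n" if "x \<in> I" for n x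
    using that
  proof (induction n arbitrary: x)
    case 0 then show ?case by (simp add: f0 g0 C_def)
  next
    case (Suc n)
    have wm: "cmod (w y) \<le> m y" "cmod (v y) \<le> m y" for y by (auto simp: m_def)
    have dom: "cmod (w y * g n y) \<le> m y * (C * \<bar>M y\<bar> ^ n / fact n)"
      "cmod (v y * f n y) \<le> m y * (C * \<bar>M y\<bar> ^ n / fact n)" if "y \<in> I" for y
      unfolding norm_mult using Suc.IH[OF that] m0[of y] wm[of y] by (intro mult_mono; simp)+
    show ?case
    proof (cases "c \<le> x")
      case True
      have sub: "{c..x} \<subseteq> I" by (rule interval_subset_real[OF I c Suc.prems])
      have abs: "\<bar>M y\<bar> = M y" if "y \<in> {c..x}" for y
        using mono[OF c, of y] that sub Mc by auto
      have d: "cmod (w y * g n y) \<le> 1 * (m y * (C * (1 * M y) ^ n / fact n))"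
        "cmod (v y * f n y) \<le> 1 * (m y * (C * (1 * M y) ^ n / fact n))" if "y \<in> {c..x}" for y
        using dom[of y] abs[OF that] that sub by auto
      show ?thesis
        using ac_rep_norm_increment[OF facS(1) Mpow[of C 1] I c Suc.prems True d(1)]
          ac_rep_norm_increment[OF gacS(1) Mpow[of C 1] I c Suc.prems True d(2)]
          abs[of x] True Mc facS(2)[of n] gacS(2)[of n] by simp
    next
      case False
      then have xc: "x \<le> c" by simp
      have sub: "{x..c} \<subseteq> I" by (rule interval_subset_real[OF I Suc.prems c])
      have abs: "\<bar>M y\<bar> = - M y" if "y \<in> {x..c}" for y
        using mono[OF _ c, of y] that sub Mc by auto
      have d: "cmod (w y * g n y) \<le> - (-1 * (m y * (C * (-1 * M y) ^ n / fact n)))"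
        "cmod (v y * f n y) \<le> - (-1 * (m y * (C * (-1 * M y) ^ n / fact n)))" if "y \<in> {x..c}" for y
        using dom[of y] abs[OF that] that sub by auto
      have Mp: "ac_rep I (\<lambda>x. complex_of_real (- (C * (-1 * M x) ^ Suc n / fact (Suc n))))
          (\<lambda>x. complex_of_real (- (-1 * (m x * (C * (-1 * M x) ^ n / fact n)))))"
        using ac_rep_cmult[OF Mpow[of C "-1" n], of "-1"] by simp
      show ?thesis
        using ac_rep_norm_increment[OF facS(1) Mp I Suc.prems c xc d(1)]
          ac_rep_norm_increment[OF gacS(1) Mp I Suc.prems c xc d(2)]
          abs[of x] xc Mc facS(2)[of n] gacS(2)[of n] by simp
    qed
  qed
  have C0: "0 \<le> C" by (simp add: C_def)
  have sum_exp: "summable (\<lambda>n. C * K ^ n / fact n)" for K :: real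
    using summable_mult[OF summable_exp[of K], of C] by (simp add: field_simps)
  have summ: "summable (\<lambda>n. f n x)" "summable (\<lambda>n. g n x)" if "x \<in> I" for x
    by (rule summable_comparison_test'[OF sum_exp[of "\<bar>M x\<bar>"], of 0]; use bound[OF that] in auto)+
  define F where "F x = (\<Sum>n. f n x)" for x
  define G where "G x = (\<Sum>n. g n x)" for x
  \<comment> \<open>Since \<open>M\<close> is monotone, \<open>K s t\<close> bounds
    \<open>\<bar>M\<bar>\<close> on \<open>{s..t}\<close>; the exponential series
    \<open>E s t\<close> then bounds all partial sums on this interval at once.\<close>
  define K where "K s t = \<bar>M s\<bar> + \<bar>M t\<bar>" for s t
  define E where "E s t = (\<Sum>n. C * K s t ^ n / fact n)" for s t
  have MK: "\<bar>M x\<bar> \<le> K s t" if "s \<in> I" "t \<in> I" "x \<in> {s..t}" for s t x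
    using mono[of s x] mono[of x t] that interval_subset_real[OF I that(1,2)] unfolding K_def by auto
  have part: "(\<Sum>n<N. cmod (h n x)) \<le> E s t"
    if h: "\<And>n. cmod (h n x) \<le> C * \<bar>M x\<bar> ^ n / fact n" and st: "s \<in> I" "t \<in> I" "x \<in> {s..t}"
    for h :: "nat \<Rightarrow> real \<Rightarrow> complex" and N s t x
  proof -
    have "(\<Sum>n<N. cmod (h n x)) \<le> (\<Sum>n<N. C * K s t ^ n / fact n)"
    proof (rule sum_mono)
      fix n
      have "C * \<bar>M x\<bar> ^ n / fact n \<le> C * K s t ^ n / fact n"
        using MK[OF st] C0 by (intro divide_right_mono mult_left_mono power_mono) auto
      then show "cmod (h n x) \<le> C * K s t ^ n / fact n" using h[of n] by linarith
    qed
    also have "\<dots> \<le> E s t"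
      unfolding E_def using C0 by (intro sum_le_suminf sum_exp) (auto simp: K_def)
    finally show ?thesis .
  qed
  \<comment> \<open>One term more than in the derivative: the constant increment has derivative 0,
    and the other \<open>N\<close> increments bring in the first \<open>N\<close> increments of the
    other unknown.\<close>
  define fs where "fs N x = (\<Sum>n<Suc N. f n x)" for N x
  define gs where "gs N x = (\<Sum>n<Suc N. g n x)" for N x
  have fsac: "ac_rep I (fs N) (\<lambda>x. w x * (\<Sum>n<N. g n x))" for N
  proof (induction N)
    case 0 show ?case using ac_rep_const[of I A] by (simp add: fs_def f0)
  next
    case (Suc N)
    show ?case using ac_rep_add[OF Suc facS(1)[of N]] by (simp add: fs_def algebra_simps)
  qed
  have gsac: "ac_rep I (gs N) (\<lambda>x. v x * (\<Sum>n<N. f n x))" for N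
  proof (induction N)
    case 0 show ?case using ac_rep_const[of I B] by (simp add: gs_def g0)
  next
    case (Suc N)
    show ?case using ac_rep_add[OF Suc gacS(1)[of N]] by (simp add: gs_def algebra_simps)
  qed
  have lim: "(\<lambda>N. \<Sum>n<N. f n x) \<longlonglongrightarrow> F x" "(\<lambda>N. \<Sum>n<N. g n x) \<longlonglongrightarrow> G x"
    "(\<lambda>N. fs N x) \<longlonglongrightarrow> F x" "(\<lambda>N. gs N x) \<longlonglongrightarrow> G x" if "x \<in> I" for x
    using summable_LIMSEQ[OF summ(1)[OF that]] summable_LIMSEQ[OF summ(2)[OF that]]
      LIMSEQ_Suc[OF summable_LIMSEQ[OF summ(1)[OF that]]] LIMSEQ_Suc[OF summable_LIMSEQ[OF summ(2)[OF that]]]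
    unfolding F_def G_def fs_def gs_def by simp_all
  have "ac_rep I F (\<lambda>x. w x * G x)"
  proof (rule ac_rep_limit[OF I fsac])
    show "(\<lambda>n. fs n x) \<longlonglongrightarrow> F x" "(\<lambda>n. w x * (\<Sum>n<n. g n x)) \<longlonglongrightarrow> w x * G x" if "x \<in> I" for x
      using lim[OF that] by (auto intro: tendsto_mult_left)
    show "set_integrable lborel {s..t} (\<lambda>x. cmod (w x) * E s t)" if "s \<in> I" "t \<in> I" "s \<le> t" for s t
      using w[OF that] by (intro set_integrable_mult_left) (auto intro: set_integrable_norm)
    show "cmod (w x * (\<Sum>n<N. g n x)) \<le> cmod (w x) * E s t" if "s \<in> I" "t \<in> I" "x \<in> {s..t}" for s t N x
      unfolding norm_mult using part[of g x s t N] bound[of x] that interval_subset_real[OF I that(1,2)]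
      by (intro mult_left_mono order_trans[OF norm_sum]) auto
  qed
  moreover have "ac_rep I G (\<lambda>x. v x * F x)"
  proof (rule ac_rep_limit[OF I gsac])
    show "(\<lambda>n. gs n x) \<longlonglongrightarrow> G x" "(\<lambda>n. v x * (\<Sum>n<n. f n x)) \<longlonglongrightarrow> v x * F x" if "x \<in> I" for x
      using lim[OF that] by (auto intro: tendsto_mult_left)
    show "set_integrable lborel {s..t} (\<lambda>x. cmod (v x) * E s t)" if "s \<in> I" "t \<in> I" "s \<le> t" for s t
      using v[OF that] by (intro set_integrable_mult_left) (auto intro: set_integrable_norm)
    show "cmod (v x * (\<Sum>n<N. f n x)) \<le> cmod (v x) * E s t" if "s \<in> I" "t \<in> I" "x \<in> {s..t}" for s t N x
      unfolding norm_mult using part[of f x s t N] bound[of x] that interval_subset_real[OF I that(1,2)]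
      by (intro mult_left_mono order_trans[OF norm_sum]) auto
  qed
  moreover have "F c = A"
  proof -
    have "(\<lambda>n. f n c) = (\<lambda>n. if n = 0 then A else 0)"
      using f0 facS(2) by (auto simp: fun_eq_iff gr0_conv_Suc)
    then show ?thesis unfolding F_def using sums_single[of 0 "\<lambda>_. A"] by (auto simp: sums_iff)
  qed
  moreover have "G c = B"
  proof -
    have "(\<lambda>n. g n c) = (\<lambda>n. if n = 0 then B else 0)"
      using g0 gacS(2) by (auto simp: fun_eq_iff gr0_conv_Suc)
    then show ?thesis unfolding G_def using sums_single[of 0 "\<lambda>_. B"] by (auto simp: sums_iff)
  qed
  ultimately show ?thesis by blast
qed

section \<open>Quasi-derivative systems\<close>

lemma qd_sys_mono: "qd_sys p q r I g g1 h \<Longrightarrow> J \<subseteq> I \<Longrightarrow> qd_sys p q r J g g1 h"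
  unfolding qd_sys_def by (auto intro: ac_rep_mono)

lemma qd_sys_cong:
  assumes "is_interval I" "\<And>x. x \<in> I \<Longrightarrow> f x = g x" "\<And>x. x \<in> I \<Longrightarrow> f1 x = g1 x" "\<And>x. x \<in> I \<Longrightarrow> h x = k x"
  shows "qd_sys p q r I f f1 h \<longleftrightarrow> qd_sys p q r I g g1 k"
  unfolding qd_sys_def using assms by (intro arg_cong2[where f="(\<and>)"] ac_rep_cong) auto

lemma qd_sys_combine:
  assumes "qd_sys p q r I f f1 h" "qd_sys p q r I g g1 k"
  shows "qd_sys p q r I (\<lambda>x. c * f x + d * g x) (\<lambda>x. c * f1 x + d * g1 x) (\<lambda>x. c * h x + d * k x)"
proof -
  have "ac_rep I (\<lambda>x. c * f x + d * g x) (\<lambda>x. c * (f1 x / p x) + d * (g1 x / p x))"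
    "ac_rep I (\<lambda>x. c * f1 x + d * g1 x) (\<lambda>x. c * (q x * f x - r x * h x) + d * (q x * g x - r x * k x))"
    using assms unfolding qd_sys_def by (intro ac_rep_add ac_rep_cmult; simp)+
  then show ?thesis unfolding qd_sys_def by (simp add: algebra_simps add_divide_distrib)
qed

lemma qd_sys_cnj:
  assumes "qd_sys p q r I f f1 h"
  shows "qd_sys p q r I (\<lambda>x. cnj (f x)) (\<lambda>x. cnj (f1 x)) (\<lambda>x. cnj (h x))"
proof -
  have "ac_rep I (\<lambda>x. cnj (f x)) (\<lambda>x. cnj (f1 x / p x))"
    "ac_rep I (\<lambda>x. cnj (f1 x)) (\<lambda>x. cnj (q x * f x - r x * h x))"
    using assms ac_rep_cnj unfolding qd_sys_def by blast+
  then show ?thesis unfolding qd_sys_def by simp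
qed

lemma qd_sys_continuous:
  assumes "qd_sys p q r I g g1 h" "is_interval I"
  shows "continuous_on I g" "continuous_on I g1"
  using assms ac_rep_continuous unfolding qd_sys_def by blast+

text \<open>The terms with \<open>1 / p\<close> and with \<open>q\<close> cancel. The form is
  bilinear, as Wronskians of solutions require; Green's formula gets its conjugation from
  \<open>qd_sys_cnj\<close>.\<close>

lemma lagrange_identity:
  assumes "qd_sys p q r I g g1 h" "qd_sys p q r I k k1 l" "is_interval I"
  shows "ac_rep I (\<lambda>x. g x * k1 x - g1 x * k x) (\<lambda>x. complex_of_real (r x) * (h x * k x - g x * l x))"
proof -
  have "ac_rep I (\<lambda>x. g x * k1 x - g1 x * k x)
    (\<lambda>x. (g1 x / p x * k1 x + g x * (q x * k x - r x * l x)) - ((q x * g x - r x * h x) * k x + g1 x * (k1 x / p x)))"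
    using assms unfolding qd_sys_def by (intro ac_rep_diff ac_rep_mult) auto
  then show ?thesis by (simp add: algebra_simps)
qed

lemma qd_sys_reflect:
  assumes "qd_sys p q r I g g1 h" "is_interval I"
    and "\<And>x. d - x \<in> I \<Longrightarrow> p (d - x) = p x \<and> q (d - x) = q x \<and> r (d - x) = r x"
  shows "qd_sys p q r {x. d - x \<in> I} (\<lambda>x. g (d - x)) (\<lambda>x. - g1 (d - x)) (\<lambda>x. h (d - x))"
proof -
  have int: "is_interval {x. d - x \<in> I}"
    using assms(2) unfolding is_interval_1 by (smt (verit) mem_Collect_eq)
  have "ac_rep {x. d - x \<in> I} (\<lambda>x. g (d - x)) (\<lambda>x. - (g1 (d - x) / p (d - x)))"
    "ac_rep {x. d - x \<in> I} (\<lambda>x. (-1) * g1 (d - x)) (\<lambda>x. (-1) * - (q (d - x) * g (d - x) - r (d - x) * h (d - x)))"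
    using assms(1) ac_rep_reflect ac_rep_cmult unfolding qd_sys_def by blast+
  then show ?thesis
    unfolding qd_sys_def using assms(3)
    by (subst (1 2) ac_rep_cong[OF int]) (auto intro: ac_rep_cong[THEN iffD1, OF int, rotated -1])
qed

section \<open>Weighted square-integrable functions\<close>

lemma borel_measurable_cnj [measurable (raw)]:
  "f \<in> borel_measurable M \<Longrightarrow> (\<lambda>x. cnj (f x)) \<in> borel_measurable M"
  by (rule measurable_compose[OF _ borel_measurable_continuous_onI[OF continuous_on_cnj[OF continuous_on_id]]])

locale weighted_L2 =
  fixes r :: "real \<Rightarrow> real" and S :: "real set"
  assumes r_meas [measurable]: "r \<in> borel_measurable borel"
    and S_meas [measurable]: "S \<in> sets borel"
    and r_pos: "AE x in lborel. x \<in> S \<longrightarrow> 0 < r x"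
begin

lemma L2w_measurable: "L2w r S f \<Longrightarrow> f \<in> borel_measurable borel"
  by (simp add: L2w_def)

lemma L2w_integrable: "L2w r S f \<Longrightarrow> set_integrable lborel S (\<lambda>x. r x * (cmod (f x))^2)"
  by (simp add: L2w_def)

lemma L2w_bound:
  assumes "L2w r S f" "L2w r S g" and [measurable]: "h \<in> borel_measurable borel"
    and le: "\<And>x. x \<in> S \<Longrightarrow> (cmod (h x))^2 \<le> A * (cmod (f x))^2 + B * (cmod (g x))^2"
  shows "L2w r S h"
  unfolding L2w_def
proof
  show "set_integrable lborel S (\<lambda>x. r x * (cmod (h x))^2)"
  proof (rule set_integrable_bound)
    show "set_integrable lborel S (\<lambda>x. A * (r x * (cmod (f x))^2) + B * (r x * (cmod (g x))^2))"
      using assms(1,2)[THEN L2w_integrable] by (intro set_integral_add set_integrable_mult_right)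
    show "set_borel_measurable lborel S (\<lambda>x. r x * (cmod (h x))^2)"
      unfolding set_borel_measurable_def by measurable
    show "AE x in lborel. x \<in> S \<longrightarrow> norm (r x * (cmod (h x))^2) \<le>
        norm (A * (r x * (cmod (f x))^2) + B * (r x * (cmod (g x))^2))"
      using r_pos
    proof eventually_elim
      case (elim x)
      show ?case
      proof
        assume x: "x \<in> S"
        have "r x * (cmod (h x))^2 \<le> r x * (A * (cmod (f x))^2 + B * (cmod (g x))^2)"
          using elim x le[OF x] by (intro mult_left_mono) auto
        then have "r x * (cmod (h x))^2 \<le> A * (r x * (cmod (f x))^2) + B * (r x * (cmod (g x))^2)"
          by (simp add: algebra_simps)
        moreover have "0 \<le> r x * (cmod (h x))^2" using elim x by simp
        ultimately show "norm (r x * (cmod (h x))^2) \<le>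
          norm (A * (r x * (cmod (f x))^2) + B * (r x * (cmod (g x))^2))" by simp
      qed
    qed
  qed
qed simp

lemma cmod_add_sq_le: "(cmod (x + y))^2 \<le> 2 * (cmod x)^2 + 2 * (cmod y)^2"
proof -
  have "(cmod (x + y))^2 \<le> (cmod x + cmod y)^2"
    by (intro power_mono norm_triangle_ineq) auto
  also have "\<dots> \<le> 2 * (cmod x)^2 + 2 * (cmod y)^2"
    using sum_squares_bound[of "cmod x" "cmod y"] by (simp add: power2_sum)
  finally show ?thesis .
qed

lemma L2w_combine:
  assumes "L2w r S f" "L2w r S g"
  shows "L2w r S (\<lambda>x. c * f x + d * g x)"
proof (rule L2w_bound[OF assms])
  have [measurable]: "f \<in> borel_measurable borel" "g \<in> borel_measurable borel"
    using assms by (auto intro: L2w_measurable)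
  show "(\<lambda>x. c * f x + d * g x) \<in> borel_measurable borel" by measurable
  show "(cmod (c * f x + d * g x))^2 \<le> 2 * (cmod c)^2 * (cmod (f x))^2 + 2 * (cmod d)^2 * (cmod (g x))^2" for x
    using cmod_add_sq_le[of "c * f x" "d * g x"] by (simp add: norm_mult power_mult_distrib)
qed

lemma L2w_add: "L2w r S f \<Longrightarrow> L2w r S g \<Longrightarrow> L2w r S (\<lambda>x. f x + g x)"
  using L2w_combine[of f g 1 1] by simp

lemma L2w_diff: "L2w r S f \<Longrightarrow> L2w r S g \<Longrightarrow> L2w r S (\<lambda>x. f x - g x)"
  using L2w_combine[of f g 1 "-1"] by simp

lemma L2w_cong_AE:
  assumes f: "L2w r S f" and [measurable]: "g \<in> borel_measurable borel" and "aeq S f g"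
  shows "L2w r S g"
  unfolding L2w_def
proof
  have [measurable]: "f \<in> borel_measurable borel" by (rule L2w_measurable[OF f])
  have "set_integrable lborel S (\<lambda>x. r x * (cmod (f x))^2) \<longleftrightarrow> set_integrable lborel S (\<lambda>x. r x * (cmod (g x))^2)"
  proof (rule set_integrable_cong_AE)
    show "AE x\<in>S in lborel. r x * (cmod (f x))\<^sup>2 = r x * (cmod (g x))\<^sup>2"
      using assms(3) unfolding aeq_def by eventually_elim auto
  qed simp_all
  then show "set_integrable lborel S (\<lambda>x. r x * (cmod (g x))^2)" using L2w_integrable[OF f] by simp
qed simp

lemma L2w_integrable_mult:
  assumes "L2w r S f" "L2w r S g"
  shows "set_integrable lborel S (\<lambda>x. complex_of_real (r x) * f x * g x)"
proof (rule set_integrable_bound)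
  have [measurable]: "f \<in> borel_measurable borel" "g \<in> borel_measurable borel"
    using assms by (auto intro: L2w_measurable)
  show "set_integrable lborel S (\<lambda>x. r x * (cmod (f x))^2 + r x * (cmod (g x))^2)"
    using assms by (intro set_integral_add L2w_integrable)
  show "set_borel_measurable lborel S (\<lambda>x. complex_of_real (r x) * f x * g x)"
    unfolding set_borel_measurable_def by measurable
  show "AE x in lborel. x \<in> S \<longrightarrow> cmod (complex_of_real (r x) * f x * g x)
     \<le> norm (r x * (cmod (f x))^2 + r x * (cmod (g x))^2)"
    using r_pos
  proof eventually_elim
    case (elim x)
    show ?case
    proof
      assume "x \<in> S"
      then have r: "0 < r x" using elim by auto
      have "cmod (f x) * cmod (g x) \<le> (cmod (f x))^2 + (cmod (g x))^2"
        using sum_squares_bound[of "cmod (f x)" "cmod (g x)"]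
          mult_nonneg_nonneg[OF norm_ge_zero[of "f x"] norm_ge_zero[of "g x"]] by linarith
      then have "r x * (cmod (f x) * cmod (g x)) \<le> r x * ((cmod (f x))^2 + (cmod (g x))^2)"
        using r by (intro mult_left_mono) auto
      then show "cmod (complex_of_real (r x) * f x * g x) \<le> norm (r x * (cmod (f x))^2 + r x * (cmod (g x))^2)"
        using r by (simp add: norm_mult algebra_simps)
    qed
  qed
qed

lemma L2w_cnj: "L2w r S f \<Longrightarrow> L2w r S (\<lambda>x. cnj (f x))"
  by (rule L2w_bound[of f f _ 1 0]) (auto dest: L2w_measurable intro: borel_measurable_cnj)

lemma ipw_integrable:
  assumes "L2w r S f" "L2w r S g"
  shows "set_integrable lborel S (\<lambda>x. complex_of_real (r x) * f x * cnj (g x))"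
  by (rule L2w_integrable_mult[OF assms(1) L2w_cnj[OF assms(2)]])

lemma ipw_combine_left:
  assumes "L2w r S f" "L2w r S g" "L2w r S k"
  shows "ipw r S (\<lambda>x. c * f x + d * g x) k = c * ipw r S f k + d * ipw r S g k"
proof -
  have "ipw r S (\<lambda>x. c * f x + d * g x) k =
    (LINT x:S|lborel. c * (complex_of_real (r x) * f x * cnj (k x)) + d * (complex_of_real (r x) * g x * cnj (k x)))"
    unfolding ipw_def by (intro set_lebesgue_integral_cong) (auto simp: algebra_simps)
  also have "\<dots> = c * ipw r S f k + d * ipw r S g k"
    using ipw_integrable[OF assms(1,3)] ipw_integrable[OF assms(2,3)]
    by (simp add: ipw_def)
  finally show ?thesis .
qed

lemma ipw_cnj: "ipw r S g f = cnj (ipw r S f g)"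
  unfolding ipw_def set_integral_cnj[symmetric] by (simp add: algebra_simps)

lemma ipw_combine_right:
  assumes "L2w r S f" "L2w r S g" "L2w r S k"
  shows "ipw r S k (\<lambda>x. c * f x + d * g x) = cnj c * ipw r S k f + cnj d * ipw r S k g"
proof -
  have "ipw r S k (\<lambda>x. c * f x + d * g x) = cnj (c * ipw r S f k + d * ipw r S g k)"
    unfolding ipw_combine_left[OF assms, symmetric] by (rule ipw_cnj)
  also have "\<dots> = cnj c * cnj (ipw r S f k) + cnj d * cnj (ipw r S g k)" by simp
  finally show ?thesis unfolding ipw_cnj[of k f] ipw_cnj[of k g] .
qed

lemma ipw_cong_AE:
  assumes [measurable]: "f \<in> borel_measurable borel" "f' \<in> borel_measurable borel"
      "g \<in> borel_measurable borel" "g' \<in> borel_measurable borel"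
    and "aeq S f f'" "aeq S g g'"
  shows "ipw r S f g = ipw r S f' g'"
  unfolding ipw_def
proof (rule set_lebesgue_integral_cong_AE)
  show "AE x\<in>S in lborel. complex_of_real (r x) * f x * cnj (g x) = complex_of_real (r x) * f' x * cnj (g' x)"
    using assms(5,6) unfolding aeq_def by eventually_elim auto
  show "(\<lambda>x. complex_of_real (r x) * f x * cnj (g x)) \<in> borel_measurable lborel" by measurable
  show "(\<lambda>x. complex_of_real (r x) * f' x * cnj (g' x)) \<in> borel_measurable lborel" by measurable
qed simp

lemma normw_sq: "(normw r S f)^2 = (LINT x:S|lborel. r x * (cmod (f x))^2)"
proof -
  have "0 \<le> (LINT x:S|lborel. r x * (cmod (f x))^2)"
    unfolding set_lebesgue_integral_def
  proof (rule integral_nonneg_AE)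
    show "AE x in lborel. 0 \<le> indicat_real S x *\<^sub>R (r x * (cmod (f x))\<^sup>2)"
      using r_pos by eventually_elim (auto split: split_indicator)
  qed
  then show ?thesis by (simp add: normw_def)
qed

lemma normw_nonneg: "0 \<le> normw r S f"
proof -
  have "0 \<le> (LINT x:S|lborel. r x * (cmod (f x))^2)" using normw_sq[of f] by (metis zero_le_power2)
  then show ?thesis by (simp add: normw_def)
qed

lemma ipw_self_eq: "ipw r S f f = complex_of_real ((normw r S f)^2)"
proof -
  have "complex_of_real (r x) * f x * cnj (f x) = complex_of_real (r x * (cmod (f x))^2)" for x
    by (simp add: complex_norm_square mult.assoc del: of_real_power)
  then have "ipw r S f f = (LINT x:S|lborel. complex_of_real (r x * (cmod (f x))^2))"
    unfolding ipw_def by (simp only:)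
  then show ?thesis by (simp only: normw_sq set_integral_complex_of_real)
qed

lemma ipw_norm_le:
  assumes f: "L2w r S f" and g: "L2w r S g"
  shows "cmod (ipw r S f g) \<le> normw r S f * normw r S g"
proof -
  have [measurable]: "f \<in> borel_measurable borel" "g \<in> borel_measurable borel"
    using assms by (auto intro: L2w_measurable)
  define X where "X = (LINT x:S|lborel. cmod (complex_of_real (r x) * f x * cnj (g x)))"
  define F where "F = (normw r S f)^2"
  define G where "G = (normw r S g)^2"
  have int: "set_integrable lborel S (\<lambda>x. cmod (complex_of_real (r x) * f x * cnj (g x)))"
    by (intro set_integrable_norm ipw_integrable assms)
  \<comment> \<open>This is the integral of \<open>r * (cmod f - l * cmod g)^2\<close> as a
    polynomial in the real parameter \<open>l\<close>. Cauchy-Schwarz is its discriminant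
    condition.\<close>
  have quad: "0 \<le> F + (-2 * l) * X + l^2 * G" for l
  proof -
    have "0 \<le> (LINT x:S|lborel. r x * (cmod (f x))^2 + (-2 * l) * cmod (complex_of_real (r x) * f x * cnj (g x)) + l^2 * (r x * (cmod (g x))^2))"
      unfolding set_lebesgue_integral_def
    proof (rule integral_nonneg_AE)
      show "AE x in lborel. 0 \<le> indicat_real S x *\<^sub>R (r x * (cmod (f x))^2 + (-2 * l) * cmod (complex_of_real (r x) * f x * cnj (g x)) + l^2 * (r x * (cmod (g x))^2))"
        using r_pos
      proof eventually_elim
        case (elim x)
        have "0 \<le> r x * (cmod (f x) - l * cmod (g x))^2" if "x \<in> S" using elim that by simp
        then show ?case using elim
          by (auto split: split_indicator simp: norm_mult power2_diff algebra_simps power2_eq_square)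
      qed
    qed
    also have "\<dots> = F + (-2 * l) * X + l^2 * G"
      unfolding F_def G_def X_def normw_sq
      using L2w_integrable[OF f] L2w_integrable[OF g] int by simp
    finally show ?thesis .
  qed
  have X0: "0 \<le> X" unfolding X_def set_lebesgue_integral_def by (intro integral_nonneg_AE) auto
  have "X^2 \<le> F * G"
  proof (cases "G = 0")
    case True
    have "X = 0"
    proof (rule ccontr)
      assume "X \<noteq> 0"
      \<comment> \<open>For \<open>G = 0\<close> the polynomial is affine with slope
        \<open>- 2 * X\<close>, and this \<open>l\<close> gives it the value -1.\<close>
      then show False using quad[of "(F + 1) / (2 * X)"] True by (simp add: field_simps)
    qed
    then show ?thesis using True by simp
  next
    case False
    then have "0 < G" unfolding G_def by simp
    then show ?thesis using quad[of "X / G"] by (simp add: field_simps power2_eq_square)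
  qed
  then have "X \<le> normw r S f * normw r S g"
    using X0 normw_nonneg[of f] normw_nonneg[of g] unfolding F_def G_def
    by (metis mult_nonneg_nonneg power2_le_imp_le power_mult_distrib)
  moreover have "cmod (ipw r S f g) \<le> X"
    unfolding ipw_def X_def by (intro set_integral_norm_bound ipw_integrable assms)
  ultimately show ?thesis by linarith
qed

lemma ipw_tendsto:
  assumes "\<And>n. L2w r S (F n)" "L2w r S f" "L2w r S g" and lim: "(\<lambda>n. normw r S (\<lambda>x. F n x - f x)) \<longlonglongrightarrow> 0"
  shows "(\<lambda>n. ipw r S g (F n)) \<longlonglongrightarrow> ipw r S g f"
proof -
  have eq: "ipw r S g (F n) - ipw r S g f = ipw r S g (\<lambda>x. F n x - f x)" for n
    using ipw_combine_right[OF assms(1)[of n] assms(2,3), of 1 "-1"] by simp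
  have "(\<lambda>n. ipw r S g (F n) - ipw r S g f) \<longlonglongrightarrow> 0"
  proof (rule tendsto_0_le[where K = "normw r S g"])
    show "(\<lambda>n. normw r S (\<lambda>x. F n x - f x)) \<longlonglongrightarrow> 0" by (rule lim)
    show "eventually (\<lambda>n. norm (ipw r S g (F n) - ipw r S g f) \<le> norm (normw r S (\<lambda>x. F n x - f x)) * normw r S g) sequentially"
      unfolding eq using ipw_norm_le[OF assms(3) L2w_diff[OF assms(1,2)]] normw_nonneg
      by (intro always_eventually) (simp add: mult.commute)
  qed
  then show ?thesis by (rule LIM_zero_cancel)
qed

lemma ipw_self_zero_imp:
  assumes f: "L2w r S f" and "ipw r S f f = 0"
  shows "aeq S f (\<lambda>x. 0)"
proof -
  have "(LINT x:S|lborel. r x * (cmod (f x))^2) = 0"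
    using assms(2) unfolding ipw_self_eq normw_sq of_real_eq_0_iff .
  then have "AE x in lborel. indicat_real S x *\<^sub>R (r x * (cmod (f x))^2) = 0"
    unfolding set_lebesgue_integral_def using L2w_integrable[OF f] r_pos
    by (subst (asm) integral_nonneg_eq_0_iff_AE) (auto simp: set_integrable_def elim!: eventually_mono split: split_indicator)
  with r_pos show ?thesis unfolding aeq_def
    by eventually_elim (auto split: split_indicator_asm)
qed

end

lemma L2w_mono: "L2w r S f \<Longrightarrow> T \<subseteq> S \<Longrightarrow> T \<in> sets borel \<Longrightarrow> L2w r T f"
  unfolding L2w_def by (auto intro: set_integrable_subset)

section \<open>Limit circle is independent of the spectral parameter\<close>

lemma ac_rep_zero_const:
  assumes "ac_rep I f (\<lambda>x. 0)" "x \<in> I" "y \<in> I"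
  shows "f x = f y"
  using ac_repD(2)[OF assms(1,2,3)] ac_repD(2)[OF assms(1,3,2)] by (cases "x \<le> y") auto

lemma set_borel_measurable_continuous:
  fixes f :: "real \<Rightarrow> complex"
  assumes "continuous_on S f" "S \<in> sets borel"
  shows "set_borel_measurable lborel S f"
  using borel_measurable_continuous_on_indicator[OF assms(2,1)] by (simp add: set_borel_measurable_def)

text \<open>The primitive of an integrable function converges at \<open>a\<close>, so its increments
  near \<open>a\<close> become as small as desired. This provides the small constant in the limit
  circle estimate.\<close>

lemma small_tail:
  assumes "set_integrable lborel {a<..<d} (\<lambda>x. complex_of_real (g x))" "a < d" "0 < e" "\<And>x. 0 \<le> g x"
  obtains G d' where "ac_rep {a<..<d} (\<lambda>x. complex_of_real (G x)) (\<lambda>x. complex_of_real (g x))"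
    "a < d'" "d' < d" "\<And>x. x \<in> {a<..d'} \<Longrightarrow> G d' - G x \<le> e"
proof -
  let ?c = "(a + d) / 2"
  have c: "?c \<in> {a<..<d}" using assms(2) by auto
  obtain F where F: "ac_rep {a<..<d} F (\<lambda>x. complex_of_real (g x))"
  proof -
    have "\<exists>F. ac_rep {a<..<d} F (\<lambda>x. complex_of_real (g x)) \<and> F ?c = 0"
      by (intro ac_rep_exists c set_integrable_subset[OF assms(1)]) auto
    then show ?thesis using that by blast
  qed
  define G where "G x = Re (F x)" for x
  have G: "ac_rep {a<..<d} (\<lambda>x. complex_of_real (G x)) (\<lambda>x. complex_of_real (g x))"
    unfolding G_def by (rule ac_rep_Re[OF F])
  obtain L where "((\<lambda>x. complex_of_real (G x)) \<longlongrightarrow> L) (at_right a)"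
    using ac_rep_limits_Ioo[OF G assms(2,1)] by blast
  then have "(G \<longlongrightarrow> Re L) (at_right a)" by (drule_tac tendsto_Re) simp
  then have "eventually (\<lambda>x. dist (G x) (Re L) < e / 2) (at_right a)"
    using assms(3) by (intro tendstoD) auto
  moreover have "eventually (\<lambda>x. x < d) (at_right a)"
    using assms(2) by (intro eventually_at_rightI[of a d]) auto
  ultimately have "eventually (\<lambda>x. dist (G x) (Re L) < e / 2 \<and> x < d) (at_right a)"
    by (rule eventually_conj)
  then obtain d0 where d0: "a < d0" "\<And>y. a < y \<Longrightarrow> y < d0 \<Longrightarrow> dist (G y) (Re L) < e / 2 \<and> y < d"
    unfolding eventually_at_right_field by blast
  define d' where "d' = (a + d0) / 2"
  have d': "a < d'" "d' < d0" using d0(1) by (auto simp: d'_def)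
  show ?thesis
  proof (rule that[OF G d'(1)])
    show "d' < d" using d0(2)[OF d'] by simp
    fix x assume x: "x \<in> {a<..d'}"
    show "G d' - G x \<le> e"
      using d0(2)[OF d'] d0(2)[of x] x d' by (auto simp: dist_real_def abs_if split: if_splits)
  qed
qed

lemma sol_exists:
  assumes "is_interval I" "c \<in> I"
    and "\<And>s t. s \<in> I \<Longrightarrow> t \<in> I \<Longrightarrow> s \<le> t \<Longrightarrow> set_integrable lborel {s..t} (\<lambda>x. 1 / p x) \<and>
        set_integrable lborel {s..t} q \<and> set_integrable lborel {s..t} r"
  obtains g g1 where "sol p q r I lam g g1" "g c = A" "g1 c = B"
proof -
  have "\<exists>g g1. ac_rep I g (\<lambda>x. complex_of_real (1 / p x) * g1 x) \<and>
      ac_rep I g1 (\<lambda>x. (complex_of_real (q x) - lam * complex_of_real (r x)) * g x) \<and> g c = A \<and> g1 c = B"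
    using assms(3) by (intro linear_system_exists assms(1,2) set_integral_diff set_integrable_mult_right)
      (simp_all only: set_integrable_complex_of_real)
  then obtain g g1 where g: "ac_rep I g (\<lambda>x. complex_of_real (1 / p x) * g1 x)"
      "ac_rep I g1 (\<lambda>x. (complex_of_real (q x) - lam * complex_of_real (r x)) * g x)" "g c = A" "g1 c = B"
    by blast
  have "sol p q r I lam g g1"
    using g(1,2) unfolding sol_def qd_sys_def by (simp add: algebra_simps)
  with g show ?thesis using that by blast
qed

text \<open>Write a solution for \<open>mu\<close> as \<open>A f + B g\<close> with \<open>f, g\<close> square integrable solutions for the
  limit circle parameter: close enough to \<open>a\<close> the sup \<open>M\<close> of \<open>\<bar>A\<bar> + \<bar>B\<bar>\<close> satisfies \<open>M \<le> C + M / 2\<close>.\<close>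

lemma LC_left_all:
  fixes w w1 :: "real \<Rightarrow> complex"
  assumes ab: "a < b" and rm [measurable]: "r \<in> borel_measurable borel"
    and loc: "\<And>s t. a < s \<Longrightarrow> s \<le> t \<Longrightarrow> t < b \<Longrightarrow> set_integrable lborel {s..t} (\<lambda>x. 1 / p x) \<and>
        set_integrable lborel {s..t} q \<and> set_integrable lborel {s..t} r"
    and LC: "LC_left p q r a b" and w: "sol p q r {a<..<b} mu w w1"
  shows "\<exists>d. a < d \<and> d < b \<and> set_integrable lborel {a<..<d} (\<lambda>x. r x * (cmod (w x))^2)"
proof -
  let ?I = "{a<..<b}" and ?c = "(a + b) / 2"
  have I: "is_interval ?I" by (simp add: is_interval_1)
  have c: "?c \<in> ?I" using ab by auto
  obtain lam where lam: "\<And>u u1. sol p q r ?I lam u u1 \<Longrightarrow>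
      \<exists>d. a < d \<and> d < b \<and> set_integrable lborel {a<..<d} (\<lambda>x. r x * (cmod (u x))^2)"
    using LC unfolding LC_left_def by blast
  have loc': "\<And>s t. s \<in> ?I \<Longrightarrow> t \<in> ?I \<Longrightarrow> s \<le> t \<Longrightarrow> set_integrable lborel {s..t} (\<lambda>x. 1 / p x) \<and>
        set_integrable lborel {s..t} q \<and> set_integrable lborel {s..t} r"
    using loc by auto
  obtain f f1 where f: "sol p q r ?I lam f f1" "f ?c = 1" "f1 ?c = 0"
    using sol_exists[OF I c loc'] by blast
  obtain g g1 where g: "sol p q r ?I lam g g1" "g ?c = 0" "g1 ?c = 1"
    using sol_exists[OF I c loc'] by blast
  note cont = qd_sys_continuous[OF f(1)[unfolded sol_def] I] qd_sys_continuous[OF g(1)[unfolded sol_def] I]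
    qd_sys_continuous[OF w[unfolded sol_def] I]
  have "ac_rep ?I (\<lambda>x. f x * g1 x - f1 x * g x) (\<lambda>x. 0)"
    using lagrange_identity[OF f(1)[unfolded sol_def] g(1)[unfolded sol_def] I] by (simp add: algebra_simps)
  then have W: "f x * g1 x - f1 x * g x = 1" if "x \<in> ?I" for x
    using ac_rep_zero_const[of ?I "\<lambda>x. f x * g1 x - f1 x * g x" x ?c] that c f g by simp
  \<comment> \<open>Cramer's rule, the Wronskian of \<open>f\<close> and \<open>g\<close> being 1.
    The derivatives of \<open>A\<close> and \<open>B\<close> carry the factor
    \<open>mu - lam\<close> up to sign and involve \<open>w\<close> only through its products with
    \<open>g\<close> and \<open>f\<close>.\<close>
  define A where "A x = w x * g1 x - w1 x * g x" for x
  define B where "B x = f x * w1 x - f1 x * w x" for x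
  have acA: "ac_rep ?I A (\<lambda>x. complex_of_real (r x) * ((mu - lam) * w x * g x))"
    using lagrange_identity[OF w[unfolded sol_def] g(1)[unfolded sol_def] I]
    unfolding A_def by (simp add: algebra_simps)
  have acB: "ac_rep ?I B (\<lambda>x. complex_of_real (r x) * ((lam - mu) * w x * f x))"
    using lagrange_identity[OF f(1)[unfolded sol_def] w[unfolded sol_def] I]
    unfolding B_def by (simp add: algebra_simps)
  have w_eq: "w x = A x * f x + B x * g x" if "x \<in> ?I" for x
  proof -
    have "A x * f x + B x * g x = w x * (f x * g1 x - f1 x * g x)" by (simp add: A_def B_def algebra_simps)
    then show ?thesis using W[OF that] by simp
  qed
  define K where "K = cmod (mu - lam)"
  \<comment> \<open>The absolute value appears because no sign of \<open>r\<close> is assumed here,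
    while \<open>small_tail\<close> wants a function that is nonnegative everywhere.\<close>
  define h where "h x = \<bar>r x\<bar> * ((cmod (f x))^2 + (cmod (g x))^2)" for x
  obtain d1 where d1: "a < d1" "d1 < b" "set_integrable lborel {a<..<d1} (\<lambda>x. r x * (cmod (f x))^2)"
    using lam[OF f(1)] by blast
  obtain d2 where d2: "a < d2" "d2 < b" "set_integrable lborel {a<..<d2} (\<lambda>x. r x * (cmod (g x))^2)"
    using lam[OF g(1)] by blast
  define d0 where "d0 = min d1 d2"
  have d0: "a < d0" "d0 < b" using d1 d2 by (auto simp: d0_def)
  have h_int: "set_integrable lborel {a<..<d0} h"
  proof -
    have "set_integrable lborel {a<..<d0} (\<lambda>x. r x * (cmod (f x))^2)"
      by (rule set_integrable_subset[OF d1(3)]) (auto simp: d0_def)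
    moreover have "set_integrable lborel {a<..<d0} (\<lambda>x. r x * (cmod (g x))^2)"
      by (rule set_integrable_subset[OF d2(3)]) (auto simp: d0_def)
    ultimately have "set_integrable lborel {a<..<d0} (\<lambda>x. \<bar>r x * (cmod (f x))^2\<bar> + \<bar>r x * (cmod (g x))^2\<bar>)"
      by (intro set_integral_add set_integrable_abs)
    then show ?thesis unfolding h_def by (simp add: abs_mult algebra_simps)
  qed
  \<comment> \<open>With this tail bound \<open>2 * K * M * (G d - G y) \<le> M / 4\<close>, once
    for \<open>A\<close> and once for \<open>B\<close>, hence the \<open>M / 2\<close> in the
    estimate. The \<open>K + 1\<close> keeps the bound meaningful when
    \<open>mu = lam\<close>.\<close>
  obtain G d where G: "ac_rep {a<..<d0} (\<lambda>x. complex_of_real (G x)) (\<lambda>x. complex_of_real (h x))"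
    and d: "a < d" "d < d0" "\<And>x. x \<in> {a<..d} \<Longrightarrow> G d - G x \<le> 1 / (8 * (K + 1))"
  proof (rule small_tail[of a d0 h "1 / (8 * (K + 1))"])
    show "set_integrable lborel {a<..<d0} (\<lambda>x. complex_of_real (h x))"
      using h_int by (simp only: set_integrable_complex_of_real)
    show "0 < 1 / (8 * (K + 1))" by (simp add: K_def add_nonneg_pos)
  qed (use d0 in \<open>auto simp: h_def\<close>)
  define C where "C = cmod (A d) + cmod (B d)"
  have contAB: "continuous_on ?I (\<lambda>x. cmod (A x) + cmod (B x))"
    unfolding A_def B_def by (intro continuous_intros cont)
  have bound: "cmod (A x) + cmod (B x) \<le> 2 * C" if x: "x \<in> {a<..d}" for x
  proof -
    have sub: "{x..d} \<subseteq> ?I" using x d d0 by auto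
    \<comment> \<open>On the compact \<open>{x..d}\<close> a maximum exists although nothing is
      known near \<open>a\<close> yet. The conclusion \<open>M \<le> 2 * C\<close> refers only to
      values at \<open>d\<close>, so it is uniform in \<open>x\<close>.\<close>
    obtain y where y: "y \<in> {x..d}" "\<And>z. z \<in> {x..d} \<Longrightarrow> cmod (A z) + cmod (B z) \<le> cmod (A y) + cmod (B y)"
    proof -
      have "\<exists>y\<in>{x..d}. \<forall>z\<in>{x..d}. cmod (A z) + cmod (B z) \<le> cmod (A y) + cmod (B y)"
        by (rule continuous_attains_sup) (use x continuous_on_subset[OF contAB sub] in auto)
      then show ?thesis using that by blast
    qed
    define M where "M = cmod (A y) + cmod (B y)"
    have M0: "0 \<le> M" by (simp add: M_def)
    have wM: "cmod (w z) \<le> M * (cmod (f z) + cmod (g z))" if z: "z \<in> {y..d}" for z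
    proof -
      have zx: "z \<in> {x..d}" using y(1) z by auto
      have "cmod (w z) \<le> cmod (A z) * cmod (f z) + cmod (B z) * cmod (g z)"
        using w_eq[of z] sub zx norm_triangle_ineq[of "A z * f z" "B z * g z"] by (auto simp: norm_mult)
      also have "\<dots> \<le> M * cmod (f z) + M * cmod (g z)"
      proof -
        have "cmod (A z) \<le> M" "cmod (B z) \<le> M"
          using y(2)[OF zx] norm_ge_zero[of "A z"] norm_ge_zero[of "B z"] unfolding M_def by linarith+
        then show ?thesis by (intro add_mono mult_right_mono) auto
      qed
      finally show ?thesis by (simp add: algebra_simps)
    qed
    have prod: "(s + t) * s \<le> 2 * (s\<^sup>2 + t\<^sup>2)" "(s + t) * t \<le> 2 * (s\<^sup>2 + t\<^sup>2)" for s t :: real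
    proof -
      have e: "(s + t) * s = s\<^sup>2 + s * t" "(s + t) * t = s * t + t\<^sup>2" by (simp_all add: power2_eq_square algebra_simps)
      have st: "2 * (s * t) \<le> s\<^sup>2 + t\<^sup>2" using sum_squares_bound[of s t] by simp
      have lin: "x + z \<le> 2 * (x + y)" "z + y \<le> 2 * (x + y)" if "2 * z \<le> x + y" "0 \<le> x" "0 \<le> y" for x y z :: real
        using that by (simp_all add: algebra_simps)
      have h1: "s\<^sup>2 + s * t \<le> 2 * (s\<^sup>2 + t\<^sup>2)" and h2: "s * t + t\<^sup>2 \<le> 2 * (s\<^sup>2 + t\<^sup>2)"
        by (rule lin[OF st zero_le_power2 zero_le_power2])+
      from h1 h2 show "(s + t) * s \<le> 2 * (s\<^sup>2 + t\<^sup>2)" "(s + t) * t \<le> 2 * (s\<^sup>2 + t\<^sup>2)"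
        by (simp_all only: e)
    qed
    have est: "cmod (complex_of_real (r z) * (D * w z * k)) \<le> 2 * K * M * h z"
      if z: "z \<in> {y..d}" and D: "cmod D = K" and k: "k = f z \<or> k = g z" for z D k
    proof -
      have "cmod (w z) * cmod k \<le> M * (cmod (f z) + cmod (g z)) * cmod k"
        using wM[OF z] by (intro mult_right_mono) auto
      also have "\<dots> \<le> M * (2 * ((cmod (f z))^2 + (cmod (g z))^2))"
        using prod[of "cmod (f z)" "cmod (g z)"] M0 k
        by (auto simp: mult.assoc intro!: mult_left_mono)
      finally have "\<bar>r z\<bar> * (K * (cmod (w z) * cmod k)) \<le> \<bar>r z\<bar> * (K * (M * (2 * ((cmod (f z))^2 + (cmod (g z))^2))))"
        by (intro mult_left_mono) (auto simp: K_def)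
      then show ?thesis using D by (simp add: norm_mult h_def algebra_simps)
    qed
    have Gac: "ac_rep {a<..<d0} (\<lambda>x. complex_of_real (2 * K * M * G x)) (\<lambda>x. complex_of_real (2 * K * M * h x))"
      using ac_rep_cmult[OF G, of "complex_of_real (2 * K * M)"] by simp
    have I0: "is_interval {a<..<d0}" by (simp add: is_interval_1)
    have yd: "y \<in> {a<..<d0}" "d \<in> {a<..<d0}" "y \<le> d" using y(1) x d by auto
    have sub0: "{a<..<d0} \<subseteq> ?I" using d0 by auto
    have "cmod (A d - A y) \<le> 2 * K * M * G d - 2 * K * M * G y"
      by (rule ac_rep_norm_increment[OF ac_rep_mono[OF acA sub0] Gac I0 yd est]) (auto simp: K_def)
    moreover have "cmod (B d - B y) \<le> 2 * K * M * G d - 2 * K * M * G y"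
      by (rule ac_rep_norm_increment[OF ac_rep_mono[OF acB sub0] Gac I0 yd est]) (auto simp: K_def norm_minus_commute)
    moreover have "2 * K * M * G d - 2 * K * M * G y \<le> M / 4"
    proof -
      have Kp: "0 < K + 1" "0 \<le> K" by (auto simp: K_def add_nonneg_pos)
      have "2 * K * M * (G d - G y) \<le> 2 * K * M * (1 / (8 * (K + 1)))"
        using d(3)[of y] y(1) x Kp M0 by (intro mult_left_mono) auto
      also have "\<dots> \<le> M / 4" using Kp M0 by (simp add: field_simps)
      finally show ?thesis by (simp add: algebra_simps)
    qed
    moreover have "cmod (A y) \<le> cmod (A d) + cmod (A d - A y)" "cmod (B y) \<le> cmod (B d) + cmod (B d - B y)"
      by (metis norm_triangle_sub norm_minus_commute)+
    ultimately have "M \<le> C + M / 2" unfolding M_def C_def by linarith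
    then have "M \<le> 2 * C" by simp
    then show ?thesis using y(2)[of x] x unfolding M_def by auto
  qed
  have C0: "0 \<le> C" by (simp add: C_def)
  have "set_integrable lborel {a<..<d} (\<lambda>x. r x * (cmod (w x))^2)"
  proof (rule set_integrable_bound)
    show "set_integrable lborel {a<..<d} (\<lambda>x. 2 * (2 * C)^2 * h x)"
      using d by (intro set_integrable_mult_right set_integrable_subset[OF h_int]) auto
    have "set_borel_measurable lborel {a<..<d} w"
      using cont(5) d d0 by (intro set_borel_measurable_continuous) (auto intro: continuous_on_subset)
    then have [measurable]: "(\<lambda>x. indicator {a<..<d} x *\<^sub>R w x) \<in> borel_measurable borel"
      by (simp add: set_borel_measurable_def)
    have eq: "(\<lambda>x. indicator {a<..<d} x *\<^sub>R (r x * (cmod (w x))^2)) =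
       (\<lambda>x. r x * (cmod (indicator {a<..<d} x *\<^sub>R w x))^2)"
      by (auto simp: fun_eq_iff split: split_indicator)
    show "set_borel_measurable lborel {a<..<d} (\<lambda>x. r x * (cmod (w x))^2)"
      unfolding set_borel_measurable_def eq by measurable
    show "AE x in lborel. x \<in> {a<..<d} \<longrightarrow> norm (r x * (cmod (w x))^2) \<le> norm (2 * (2 * C)^2 * h x)"
    proof (intro always_eventually allI impI)
      fix x assume x: "x \<in> {a<..<d}"
      have "cmod (A x) + cmod (B x) \<le> 2 * C" using bound[of x] x by auto
      with norm_ge_zero[of "A x"] norm_ge_zero[of "B x"]
      have AB: "cmod (A x) \<le> 2 * C" "cmod (B x) \<le> 2 * C" by linarith+
      have "cmod (w x) \<le> cmod (A x) * cmod (f x) + cmod (B x) * cmod (g x)"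
        using w_eq[of x] x d d0 norm_triangle_ineq[of "A x * f x" "B x * g x"] by (auto simp: norm_mult)
      also have "\<dots> \<le> 2 * C * cmod (f x) + 2 * C * cmod (g x)"
        using AB by (intro add_mono mult_right_mono) auto
      finally have "cmod (w x) \<le> 2 * C * (cmod (f x) + cmod (g x))" by (simp add: algebra_simps)
      then have "(cmod (w x))^2 \<le> (2 * C * (cmod (f x) + cmod (g x)))^2"
        by (intro power_mono) auto
      also have "\<dots> \<le> (2 * C)^2 * (2 * ((cmod (f x))^2 + (cmod (g x))^2))"
        using sum_squares_bound[of "cmod (f x)" "cmod (g x)"]
        by (subst power_mult_distrib, intro mult_left_mono) (auto simp: power2_sum)
      finally have "\<bar>r x\<bar> * (cmod (w x))^2 \<le> \<bar>r x\<bar> * ((2 * C)^2 * (2 * ((cmod (f x))^2 + (cmod (g x))^2)))"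
        by (intro mult_left_mono) auto
      then show "norm (r x * (cmod (w x))^2) \<le> norm (2 * (2 * C)^2 * h x)"
        by (simp add: h_def abs_mult algebra_simps)
    qed
  qed
  then show ?thesis using d d0 by (intro exI[of _ d]) auto
qed

section \<open>Generalized boundary values\<close>

text \<open>\<open>L2w\<close> asks for Borel measurability on the whole line, whereas a
  representative \<open>g\<close> is controlled only on its interval. Truncation turns it into a
  legitimate L2 element.\<close>

definition trunc :: "real set \<Rightarrow> (real \<Rightarrow> complex) \<Rightarrow> real \<Rightarrow> complex" where
  "trunc S g = (\<lambda>x. if x \<in> S then g x else 0)"

lemma trunc_simp [simp]: "x \<in> S \<Longrightarrow> trunc S g x = g x"
  by (simp add: trunc_def)

lemma aeq_trunc: "aeq S (trunc S g) g" "aeq S g (trunc S g)"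
  by (simp_all add: aeq_def)

lemma aeq_refl: "aeq S f f"
  by (simp add: aeq_def)

lemma aeq_sym: "aeq S f g \<Longrightarrow> aeq S g f"
  unfolding aeq_def by (auto elim!: eventually_mono)

lemma aeq_trans:
  assumes "aeq S f g" "aeq S g h"
  shows "aeq S f h"
  using assms unfolding aeq_def by eventually_elim auto

lemma aeq_mono: "aeq S f g \<Longrightarrow> T \<subseteq> S \<Longrightarrow> aeq T f g"
  unfolding aeq_def by (auto elim!: eventually_mono)

lemma aeq_combine:
  assumes "aeq S f f'" "aeq S g g'"
  shows "aeq S (\<lambda>x. c * f x + d * g x) (\<lambda>x. c * f' x + d * g' x)"
  using assms unfolding aeq_def by eventually_elim auto

lemma aeq_eqI: "(\<And>x. x \<in> S \<Longrightarrow> f x = g x) \<Longrightarrow> aeq S f g"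
  by (simp add: aeq_def)

lemma measurable_trunc_continuous:
  assumes "continuous_on S g" "S \<in> sets borel"
  shows "trunc S g \<in> borel_measurable borel"
proof -
  have "(\<lambda>x. indicator S x *\<^sub>R g x) = trunc S g"
    by (auto simp: trunc_def fun_eq_iff)
  then show ?thesis using borel_measurable_continuous_on_indicator[OF assms(2,1)] by simp
qed

lemma L2w_trunc:
  assumes "weighted_L2 r S" "L2w r S f" "aeq S f g" "continuous_on S g"
  shows "L2w r S (trunc S g)"
proof -
  interpret weighted_L2 r S by fact
  show ?thesis
    by (rule L2w_cong_AE[OF assms(2) measurable_trunc_continuous[OF assms(4) S_meas]
        aeq_trans[OF assms(3) aeq_trunc(2)]])
qed

lemma L2w_trunc_iff:
  assumes "weighted_L2 r S" "f \<in> borel_measurable borel"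
  shows "L2w r S (trunc S f) \<longleftrightarrow> L2w r S f"
proof -
  interpret weighted_L2 r S by fact
  have "trunc S f \<in> borel_measurable borel" unfolding trunc_def using assms(2) by measurable
  then show ?thesis using L2w_cong_AE aeq_trunc assms(2) by blast
qed

lemma L2w_trunc_mono:
  assumes "L2w r S (trunc S g)" "T \<subseteq> S" "T \<in> sets borel"
  shows "L2w r T (trunc T g)"
  unfolding L2w_def
proof
  have "(\<lambda>x. indicator T x *\<^sub>R trunc S g x) = trunc T g"
    using assms(2) by (auto simp: trunc_def fun_eq_iff)
  then show "trunc T g \<in> borel_measurable lborel"
    using assms unfolding L2w_def by (metis borel_measurable_indicator borel_measurable_scaleR sets_lborel)
  have "set_integrable lborel T (\<lambda>x. r x * (cmod (trunc S g x))^2)"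
    using assms unfolding L2w_def by (auto intro: set_integrable_subset)
  also have "?this \<longleftrightarrow> set_integrable lborel T (\<lambda>x. r x * (cmod (trunc T g x))^2)"
    using assms(2) by (intro set_integrable_cong) auto
  finally show "set_integrable lborel T (\<lambda>x. r x * (cmod (trunc T g x))^2)" .
qed

lemma L2w_trunc_combine:
  assumes "weighted_L2 r S" "L2w r S (trunc S f)" "L2w r S (trunc S g)"
  shows "L2w r S (trunc S (\<lambda>x. c * f x + d * g x))"
proof -
  interpret weighted_L2 r S by fact
  have "trunc S (\<lambda>x. c * f x + d * g x) = (\<lambda>x. c * trunc S f x + d * trunc S g x)"
    by (auto simp: trunc_def)
  then show ?thesis using L2w_combine[OF assms(2,3)] by simp
qed

lemma at_left_eq_filtermap_reflect:
  "at_left (b::real) = filtermap (\<lambda>x. a + b - x) (at_right a)"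
proof -
  have "at_left b = filtermap uminus (at_right (- b))" by (rule at_left_minus)
  also have "at_right (- b) = filtermap (\<lambda>x. x - (a + b)) (at_right a)"
    by (simp add: filtermap_at_right_shift)
  finally show ?thesis by (simp add: filtermap_filtermap algebra_simps)
qed

lemma tendsto_at_left_reflect:
  fixes f :: "real \<Rightarrow> 'a::topological_space"
  shows "(f \<longlongrightarrow> l) (at_left b) \<longleftrightarrow> ((\<lambda>x. f (a + b - x)) \<longlongrightarrow> l) (at_right a)"
  unfolding at_left_eq_filtermap_reflect[of b a] filterlim_filtermap ..

lemma Lim_at_left_reflect:
  fixes f :: "real \<Rightarrow> 'a::t2_space"
  shows "Lim (at_left b) f = Lim (at_right a) (\<lambda>x. f (a + b - x))"
  by (simp add: Topological_Spaces.Lim_def tendsto_at_left_reflect[of f _ b a])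

definition sform :: "complex \<Rightarrow> complex \<Rightarrow> complex \<Rightarrow> complex \<Rightarrow> complex" where
  "sform x y x' y' = x * cnj y' - y * cnj x'"

text \<open>\<open>u\<close> and \<open>v\<close> stand for \<open>ua\<close> and
  \<open>hua\<close>. The boundary theory is developed at \<open>a\<close>; the symmetry of the
  coefficients carries it over to \<open>b\<close>.\<close>

locale sl_problem =
  fixes a b lam0 :: real and p q r u u1 v v1 :: "real \<Rightarrow> real"
  assumes ab: "a < b"
    and r_meas: "r \<in> borel_measurable borel"
    and p_pos: "AE x in lborel. x \<in> {a<..<b} \<longrightarrow> 0 < p x"
    and r_pos: "AE x in lborel. x \<in> {a<..<b} \<longrightarrow> 0 < r x"
    and loc: "\<And>s t. a < s \<Longrightarrow> s \<le> t \<Longrightarrow> t < b \<Longrightarrow>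
        set_integrable lborel {s..t} (\<lambda>x. 1 / p x) \<and> set_integrable lborel {s..t} q \<and>
        set_integrable lborel {s..t} r"
    and sym: "\<And>x. x \<in> {a<..<b} \<Longrightarrow> p x = p (a + b - x) \<and> q x = q (a + b - x) \<and> r x = r (a + b - x)"
    and LC: "LC_left p q r a b"
    and u_sol: "rsol p q r {a<..<b} lam0 u u1"
    and v_sol: "rsol p q r {a<..<b} lam0 v v1"
    and wr: "\<And>x. x \<in> {a<..<b} \<Longrightarrow> v x * u1 x - v1 x * u x = 1"
begin

abbreviation "I \<equiv> {a<..<b}"
abbreviation "U x \<equiv> complex_of_real (u x)"
abbreviation "U1 x \<equiv> complex_of_real (u1 x)"
abbreviation "V x \<equiv> complex_of_real (v x)"
abbreviation "V1 x \<equiv> complex_of_real (v1 x)"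
abbreviation "qd \<equiv> qd_sys p q r"
abbreviation "X \<equiv> bv_a a u u1"
abbreviation "Y \<equiv> bv'_a a v v1"
abbreviation "rc x \<equiv> complex_of_real (r x)"
abbreviation "\<Lambda> \<equiv> complex_of_real lam0"

definition mirror :: "(real \<Rightarrow> complex) \<Rightarrow> real \<Rightarrow> complex" where
  "mirror f = (\<lambda>x. f (a + b - x))"

lemma weighted: "S \<subseteq> I \<Longrightarrow> S \<in> sets borel \<Longrightarrow> weighted_L2 r S"
  using r_meas r_pos unfolding weighted_L2_def by (auto elim!: eventually_mono)

sublocale WI: weighted_L2 r I
  by (rule weighted) auto

lemma interval_Ioo: "is_interval {s<..<t::real}"
  by (simp add: is_interval_1)

lemma wr': "x \<in> I \<Longrightarrow> V x * U1 x - V1 x * U x = 1"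
  using wr[of x] by (metis of_real_1 of_real_diff of_real_mult)

lemma U_qd: "qd I U U1 (\<lambda>x. \<Lambda> * U x)"
  and V_qd: "qd I V V1 (\<lambda>x. \<Lambda> * V x)"
  using u_sol v_sol by (simp_all add: rsol_def sol_def)

text \<open>Membership in the maximal domain only near \<open>a\<close>: exactly what makes boundary
  values at \<open>a\<close> exist. It covers solutions, which are known to be square integrable
  only there, as well as functions on the half interval.\<close>

definition adm :: "(real \<Rightarrow> complex) \<Rightarrow> (real \<Rightarrow> complex) \<Rightarrow> (real \<Rightarrow> complex) \<Rightarrow> bool" where
  "adm g g1 h \<longleftrightarrow> (\<exists>e. a < e \<and> e \<le> b \<and> qd {a<..<e} g g1 h \<and>
     L2w r {a<..<e} (trunc {a<..<e} g) \<and> L2w r {a<..<e} (trunc {a<..<e} h))"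

lemma adm_common:
  assumes "adm g g1 h" "adm k k1 l"
  obtains e where "a < e" "e \<le> b" "qd {a<..<e} g g1 h" "qd {a<..<e} k k1 l"
    "L2w r {a<..<e} (trunc {a<..<e} g)" "L2w r {a<..<e} (trunc {a<..<e} h)"
    "L2w r {a<..<e} (trunc {a<..<e} k)" "L2w r {a<..<e} (trunc {a<..<e} l)"
proof -
  obtain e1 where e1: "a < e1" "e1 \<le> b" "qd {a<..<e1} g g1 h"
    "L2w r {a<..<e1} (trunc {a<..<e1} g)" "L2w r {a<..<e1} (trunc {a<..<e1} h)"
    using assms(1) unfolding adm_def by blast
  obtain e2 where e2: "a < e2" "e2 \<le> b" "qd {a<..<e2} k k1 l"
    "L2w r {a<..<e2} (trunc {a<..<e2} k)" "L2w r {a<..<e2} (trunc {a<..<e2} l)"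
    using assms(2) unfolding adm_def by blast
  have sub: "{a<..<min e1 e2} \<subseteq> {a<..<e1}" "{a<..<min e1 e2} \<subseteq> {a<..<e2}" "{a<..<min e1 e2} \<in> sets borel"
    by auto
  show ?thesis
  proof (rule that[of "min e1 e2"])
    show "qd {a<..<min e1 e2} g g1 h" "qd {a<..<min e1 e2} k k1 l"
      using e1(3) e2(3) sub qd_sys_mono by blast+
    show "L2w r {a<..<min e1 e2} (trunc {a<..<min e1 e2} g)" "L2w r {a<..<min e1 e2} (trunc {a<..<min e1 e2} h)"
      "L2w r {a<..<min e1 e2} (trunc {a<..<min e1 e2} k)" "L2w r {a<..<min e1 e2} (trunc {a<..<min e1 e2} l)"
      using e1(4,5) e2(4,5) sub L2w_trunc_mono by blast+
  qed (use e1 e2 in auto)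
qed

lemma L2w_cmult_on: "S \<subseteq> I \<Longrightarrow> S \<in> sets borel \<Longrightarrow> L2w r S (trunc S g) \<Longrightarrow> L2w r S (trunc S (\<lambda>x. c * g x))"
  using L2w_trunc_combine[of r S g g c 0] weighted by simp

lemma sol_adm:
  assumes "sol p q r I mu w w1"
  shows "adm w w1 (\<lambda>x. mu * w x)"
proof -
  have rm: "r \<in> borel_measurable borel" by (rule r_meas)
  obtain d where d: "a < d" "d < b" "set_integrable lborel {a<..<d} (\<lambda>x. r x * (cmod (w x))^2)"
    using LC_left_all[OF ab rm loc LC assms] by blast
  have sub: "{a<..<d} \<subseteq> I" using d by auto
  have q: "qd {a<..<d} w w1 (\<lambda>x. mu * w x)"
    using assms sub unfolding sol_def by (rule qd_sys_mono)
  have "L2w r {a<..<d} (trunc {a<..<d} w)"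
    unfolding L2w_def
  proof
    show "trunc {a<..<d} w \<in> borel_measurable lborel"
      using measurable_trunc_continuous[OF qd_sys_continuous(1)[OF q interval_Ioo]] by simp
    have "set_integrable lborel {a<..<d} (\<lambda>x. r x * (cmod (trunc {a<..<d} w x))^2) \<longleftrightarrow>
       set_integrable lborel {a<..<d} (\<lambda>x. r x * (cmod (w x))^2)"
      by (intro set_integrable_cong) auto
    with d show "set_integrable lborel {a<..<d} (\<lambda>x. r x * (cmod (trunc {a<..<d} w x))^2)" by blast
  qed
  with d q sub show ?thesis unfolding adm_def
    by (intro exI[of _ d]) (auto intro: L2w_cmult_on)
qed

lemma adm_U: "adm U U1 (\<lambda>x. \<Lambda> * U x)"
  and adm_V: "adm V V1 (\<lambda>x. \<Lambda> * V x)"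
  using u_sol v_sol unfolding rsol_def by (auto intro: sol_adm)

lemma adm_cnj:
  assumes "adm g g1 h"
  shows "adm (\<lambda>x. cnj (g x)) (\<lambda>x. cnj (g1 x)) (\<lambda>x. cnj (h x))"
proof -
  obtain e where e: "a < e" "e \<le> b" "qd {a<..<e} g g1 h"
    "L2w r {a<..<e} (trunc {a<..<e} g)" "L2w r {a<..<e} (trunc {a<..<e} h)"
    using assms unfolding adm_def by blast
  interpret W: weighted_L2 r "{a<..<e}" using e by (intro weighted) auto
  have "trunc {a<..<e} (\<lambda>x. cnj (k x)) = (\<lambda>x. cnj (trunc {a<..<e} k x))" for k
    by (auto simp: trunc_def)
  then show ?thesis unfolding adm_def
    using e qd_sys_cnj[OF e(3)] W.L2w_cnj by (intro exI[of _ e]) simp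
qed

lemma integrable_wronskian:
  assumes "S \<subseteq> I" "S \<in> sets borel" "L2w r S (trunc S g)" "L2w r S (trunc S h)" "L2w r S (trunc S k)" "L2w r S (trunc S l)"
  shows "set_integrable lborel S (\<lambda>x. rc x * (h x * k x - g x * l x))"
proof -
  interpret W: weighted_L2 r S using assms by (intro weighted)
  have "set_integrable lborel S (\<lambda>x. rc x * trunc S h x * trunc S k x - rc x * trunc S g x * trunc S l x)"
    using assms by (intro set_integral_diff W.L2w_integrable_mult)
  also have "?this \<longleftrightarrow> ?thesis"
    by (intro set_integrable_cong) (auto simp: algebra_simps)
  finally show ?thesis .
qed

text \<open>By the Lagrange identity the derivative is a combination of products of square
  integrable functions, hence integrable up to \<open>a\<close>. This existence is what gives the
  \<open>Lim\<close> in the boundary values its meaning.\<close>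

lemma adm_wronskian_limit:
  assumes "adm g g1 h" "adm k k1 l"
  obtains L where "((\<lambda>x. g x * k1 x - g1 x * k x) \<longlongrightarrow> L) (at_right a)"
proof -
  obtain e where e: "a < e" "e \<le> b" "qd {a<..<e} g g1 h" "qd {a<..<e} k k1 l"
    "L2w r {a<..<e} (trunc {a<..<e} g)" "L2w r {a<..<e} (trunc {a<..<e} h)"
    "L2w r {a<..<e} (trunc {a<..<e} k)" "L2w r {a<..<e} (trunc {a<..<e} l)"
    by (rule adm_common[OF assms])
  have "set_integrable lborel {a<..<e} (\<lambda>x. rc x * (h x * k x - g x * l x))"
    using e by (intro integrable_wronskian) auto
  with lagrange_identity[OF e(3,4) interval_Ioo] show ?thesis
    using ac_rep_limits_Ioo e(1) that by blast
qed

lemma X_tendsto: "adm g g1 h \<Longrightarrow> ((\<lambda>x. U x * g1 x - U1 x * g x) \<longlongrightarrow> - X g g1) (at_right a)"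
  and Y_tendsto: "adm g g1 h \<Longrightarrow> ((\<lambda>x. V x * g1 x - V1 x * g x) \<longlongrightarrow> Y g g1) (at_right a)"
proof -
  assume g: "adm g g1 h"
  obtain L where L: "((\<lambda>x. U x * g1 x - U1 x * g x) \<longlongrightarrow> L) (at_right a)"
    by (rule adm_wronskian_limit[OF adm_U g])
  then show "((\<lambda>x. U x * g1 x - U1 x * g x) \<longlongrightarrow> - X g g1) (at_right a)"
    unfolding bv_a_def wlim_def by (subst tendsto_Lim[OF _ L]) auto
  obtain L where L: "((\<lambda>x. V x * g1 x - V1 x * g x) \<longlongrightarrow> L) (at_right a)"
    by (rule adm_wronskian_limit[OF adm_V g])
  then show "((\<lambda>x. V x * g1 x - V1 x * g x) \<longlongrightarrow> Y g g1) (at_right a)"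
    unfolding bv'_a_def wlim_def by (subst tendsto_Lim[OF _ L]) auto
qed

lemma X_eqI: "((\<lambda>x. U x * g1 x - U1 x * g x) \<longlongrightarrow> - z) (at_right a) \<Longrightarrow> X g g1 = z"
  unfolding bv_a_def wlim_def by (simp add: tendsto_Lim)

lemma Y_eqI: "((\<lambda>x. V x * g1 x - V1 x * g x) \<longlongrightarrow> z) (at_right a) \<Longrightarrow> Y g g1 = z"
  unfolding bv'_a_def wlim_def by (simp add: tendsto_Lim)

text \<open>Boundary values depend on the germ at \<open>a\<close> alone. This evaluates functions
  that are combinations of \<open>U\<close> and \<open>V\<close>, or zero, near an endpoint.\<close>

lemma XY_cong:
  assumes "a < e" "\<And>x. x \<in> {a<..<e} \<Longrightarrow> g x = k x" "\<And>x. x \<in> {a<..<e} \<Longrightarrow> g1 x = k1 x"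
  shows "X g g1 = X k k1" "Y g g1 = Y k k1"
proof -
  have ev: "eventually (\<lambda>x. g x = k x \<and> g1 x = k1 x) (at_right a)"
    using assms by (intro eventually_at_rightI[of a e]) auto
  have L: "Lim (at_right a) f = Lim (at_right a) f'" if "eventually (\<lambda>x. f x = f' x) (at_right a)"
    for f f' :: "real \<Rightarrow> complex"
    by (simp add: Topological_Spaces.Lim_def tendsto_cong[OF that])
  show "X g g1 = X k k1" "Y g g1 = Y k k1"
    unfolding bv_a_def bv'_a_def wlim_def
    using L ev by (auto intro!: L elim!: eventually_mono)
qed

lemma XY_combine:
  assumes "adm g g1 h" "adm k k1 l"
  shows "X (\<lambda>x. c * g x + d * k x) (\<lambda>x. c * g1 x + d * k1 x) = c * X g g1 + d * X k k1"
    "Y (\<lambda>x. c * g x + d * k x) (\<lambda>x. c * g1 x + d * k1 x) = c * Y g g1 + d * Y k k1"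
proof -
  have "((\<lambda>x. c * (U x * g1 x - U1 x * g x) + d * (U x * k1 x - U1 x * k x)) \<longlongrightarrow> c * (- X g g1) + d * (- X k k1)) (at_right a)"
    by (intro tendsto_add tendsto_mult_left X_tendsto[OF assms(1)] X_tendsto[OF assms(2)])
  then show "X (\<lambda>x. c * g x + d * k x) (\<lambda>x. c * g1 x + d * k1 x) = c * X g g1 + d * X k k1"
    by (intro X_eqI) (simp add: algebra_simps)
  have "((\<lambda>x. c * (V x * g1 x - V1 x * g x) + d * (V x * k1 x - V1 x * k x)) \<longlongrightarrow> c * Y g g1 + d * Y k k1) (at_right a)"
    by (intro tendsto_add tendsto_mult_left Y_tendsto[OF assms(1)] Y_tendsto[OF assms(2)])
  then show "Y (\<lambda>x. c * g x + d * k x) (\<lambda>x. c * g1 x + d * k1 x) = c * Y g g1 + d * Y k k1"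
    by (intro Y_eqI) (simp add: algebra_simps)
qed

lemma XY_cnj:
  assumes "adm g g1 h"
  shows "X (\<lambda>x. cnj (g x)) (\<lambda>x. cnj (g1 x)) = cnj (X g g1)" "Y (\<lambda>x. cnj (g x)) (\<lambda>x. cnj (g1 x)) = cnj (Y g g1)"
  by (rule X_eqI, use tendsto_cnj[OF X_tendsto[OF assms]] in simp)
    (rule Y_eqI, use tendsto_cnj[OF Y_tendsto[OF assms]] in simp)

lemma tendsto_at_a_const:
  assumes "\<And>x. x \<in> I \<Longrightarrow> f x = (c::complex)"
  shows "(f \<longlongrightarrow> c) (at_right a)"
proof -
  have "eventually (\<lambda>x. f x = c) (at_right a)" using assms ab by (intro eventually_at_rightI[of a b]) auto
  then show ?thesis by (rule tendsto_eventually)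
qed

text \<open>\<open>U\<close> and \<open>V\<close> realise the two coordinate directions, so
  \<open>y * U + x * V\<close> near \<open>a\<close> has boundary values \<open>x\<close> and
  \<open>y\<close>.\<close>

lemma XY_UV: "X U U1 = 0" "Y U U1 = 1" "X V V1 = 1" "Y V V1 = 0"
proof -
  show "X U U1 = 0" by (rule X_eqI, rule tendsto_at_a_const) (simp add: mult.commute)
  show "Y V V1 = 0" by (rule Y_eqI, rule tendsto_at_a_const) (simp add: mult.commute)
  show "Y U U1 = 1" by (rule Y_eqI, rule tendsto_at_a_const) (rule wr')
  show "X V V1 = 1"
  proof (rule X_eqI, rule tendsto_at_a_const)
    fix x assume "x \<in> I"
    from wr'[OF this] show "U x * V1 x - U1 x * V x = - 1"
      by (metis minus_diff_eq mult.commute)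
  qed
qed

text \<open>The Pluecker identity for the Wronskians with \<open>U\<close> and \<open>V\<close>.\<close>

lemma wronskian_tendsto:
  assumes "adm g g1 h" "adm k k1 l"
  shows "((\<lambda>x. g x * k1 x - g1 x * k x) \<longlongrightarrow> X g g1 * Y k k1 - Y g g1 * X k k1) (at_right a)"
proof -
  have "((\<lambda>x. - (U x * g1 x - U1 x * g x) * (V x * k1 x - V1 x * k x) + (V x * g1 x - V1 x * g x) * (U x * k1 x - U1 x * k x))
     \<longlongrightarrow> - (- X g g1) * Y k k1 + Y g g1 * (- X k k1)) (at_right a)"
    by (intro tendsto_add tendsto_mult tendsto_minus X_tendsto[OF assms(1)] X_tendsto[OF assms(2)]
      Y_tendsto[OF assms(1)] Y_tendsto[OF assms(2)])
  moreover have "eventually (\<lambda>x. - (U x * g1 x - U1 x * g x) * (V x * k1 x - V1 x * k x) + (V x * g1 x - V1 x * g x) * (U x * k1 x - U1 x * k x)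
     = g x * k1 x - g1 x * k x) (at_right a)"
  proof (rule eventually_at_rightI[OF _ ab])
    fix x assume x: "x \<in> I"
    have "- (U x * g1 x - U1 x * g x) * (V x * k1 x - V1 x * k x) + (V x * g1 x - V1 x * g x) * (U x * k1 x - U1 x * k x)
      = (g x * k1 x - g1 x * k x) * (V x * U1 x - V1 x * U x)" by (simp add: algebra_simps)
    then show "- (U x * g1 x - U1 x * g x) * (V x * k1 x - V1 x * k x) + (V x * g1 x - V1 x * g x) * (U x * k1 x - U1 x * k x)
      = g x * k1 x - g1 x * k x" using wr'[OF x] by simp
  qed
  ultimately show ?thesis by (simp add: tendsto_cong)
qed

section \<open>Reflection and Green's formula\<close>

lemma reflect_I: "{x. a + b - x \<in> I} = I"
  by auto

lemma mirror_mirror: "mirror (mirror f) = f"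
  by (simp add: mirror_def)

lemma mirror_combine: "mirror (\<lambda>x. c * f x + d * g x) = (\<lambda>x. c * mirror f x + d * mirror g x)"
  by (simp add: mirror_def)

lemma sym_mirror:
  assumes "a + b - x \<in> I"
  shows "p (a + b - x) = p x \<and> q (a + b - x) = q x \<and> r (a + b - x) = r x"
  using sym[OF assms] by simp

lemma qd_mirror:
  assumes "qd I g g1 h"
  shows "qd I (mirror g) (\<lambda>x. - mirror g1 x) (mirror h)"
  using qd_sys_reflect[OF assms interval_Ioo sym_mirror] unfolding reflect_I mirror_def .

lemma L2w_mirror: "L2w r I f \<Longrightarrow> L2w r I (mirror f)"
  unfolding L2w_def
proof
  assume f: "f \<in> borel_measurable lborel \<and> set_integrable lborel I (\<lambda>x. r x * (cmod (f x))\<^sup>2)"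
  then have "f \<in> borel_measurable borel" by simp
  then have "mirror f \<in> borel_measurable borel"
    unfolding mirror_def by (rule measurable_compose[rotated]) measurable
  then show "mirror f \<in> borel_measurable lborel" by simp
  have "set_integrable lborel {x. (a + b) - x \<in> I} (\<lambda>x. r (a + b - x) * (cmod (f (a + b - x)))\<^sup>2)"
    using f by (subst set_integrable_lborel_reflect) auto
  then have "set_integrable lborel I (\<lambda>x. r (a + b - x) * (cmod (f (a + b - x)))\<^sup>2)"
    by (simp only: reflect_I)
  also have "?this \<longleftrightarrow> set_integrable lborel I (\<lambda>x. r x * (cmod (mirror f x))\<^sup>2)"
    by (intro set_integrable_cong) (simp_all add: mirror_def sym_mirror)
  finally show "set_integrable lborel I (\<lambda>x. r x * (cmod (mirror f x))\<^sup>2)" .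
qed

lemma aeq_mirror:
  assumes "aeq I f g"
  shows "aeq I (mirror f) (mirror g)"
proof -
  have "AE x in lborel. a + b - x \<in> I \<longrightarrow> f (a + b - x) = g (a + b - x)"
    using assms unfolding aeq_def by (rule AE_lborel_reflect)
  then show ?thesis unfolding aeq_def mirror_def by eventually_elim auto
qed

lemma trunc_mirror: "trunc I (mirror f) = mirror (trunc I f)"
  by (auto simp: trunc_def mirror_def)

definition tpair :: "(real \<Rightarrow> complex) \<Rightarrow> (real \<Rightarrow> complex) \<Rightarrow> (real \<Rightarrow> complex) \<Rightarrow> bool" where
  "tpair g g1 h \<longleftrightarrow> qd I g g1 h \<and> L2w r I (trunc I g) \<and> L2w r I (trunc I h)"

lemma tpair_adm: "tpair g g1 h \<Longrightarrow> adm g g1 h"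
  unfolding tpair_def adm_def using ab by (intro exI[of _ b]) auto

lemma tpair_combine:
  "tpair g g1 h \<Longrightarrow> tpair k k1 l \<Longrightarrow>
   tpair (\<lambda>x. c * g x + d * k x) (\<lambda>x. c * g1 x + d * k1 x) (\<lambda>x. c * h x + d * l x)"
  unfolding tpair_def using qd_sys_combine L2w_trunc_combine WI.weighted_L2_axioms by blast

lemma tpair_mirror: "tpair g g1 h \<Longrightarrow> tpair (mirror g) (\<lambda>x. - mirror g1 x) (mirror h)"
  unfolding tpair_def trunc_mirror using qd_mirror L2w_mirror by blast

lemma bv_b_eq: "bv_b a b u u1 g g1 = X (mirror g) (\<lambda>x. - mirror g1 x)"
  unfolding bv_b_def bv_a_def wlim_def Lim_at_left_reflect[of b _ a] mirror_def by (simp add: algebra_simps)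


text \<open>In contrast to \<open>bv_b_eq\<close>, a sign has to be moved out of \<open>Lim\<close>,
  which is only legitimate once the limit exists. This sign also accounts for the opposite signs in
  the separated conditions at the two ends.\<close>

lemma bv'_b_eq:
  assumes "tpair g g1 h"
  shows "bv'_b a b v v1 g g1 = - Y (mirror g) (\<lambda>x. - mirror g1 x)"
proof -
  have "((\<lambda>x. V x * - mirror g1 x - V1 x * mirror g x) \<longlongrightarrow> Y (mirror g) (\<lambda>x. - mirror g1 x)) (at_right a)"
    by (rule Y_tendsto[OF tpair_adm[OF tpair_mirror[OF assms]]])
  from tendsto_minus[OF this]
  have "((\<lambda>x. V x * mirror g1 x + V1 x * mirror g x) \<longlongrightarrow> - Y (mirror g) (\<lambda>x. - mirror g1 x)) (at_right a)"
    by (simp add: algebra_simps)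
  then show ?thesis
    unfolding bv'_b_def wlim_def Lim_at_left_reflect[of b _ a] mirror_def by (simp add: tendsto_Lim)
qed

lemma Tmax_iff: "(f, h) \<in> Tmax p q r a b \<longleftrightarrow>
    L2w r I f \<and> L2w r I h \<and> (\<exists>g g1. aeq I f g \<and> tpair g g1 h)"
  unfolding Tmax_def tpair_def
  using L2w_trunc[OF WI.weighted_L2_axioms] qd_sys_continuous(1)[OF _ interval_Ioo]
    L2w_trunc_iff[OF WI.weighted_L2_axioms] WI.L2w_measurable by blast

abbreviation "Xm g g1 \<equiv> X (mirror g) (\<lambda>x. - mirror g1 x)"
abbreviation "Ym g g1 \<equiv> Y (mirror g) (\<lambda>x. - mirror g1 x)"

text \<open>The integral is the Wronskian limit at \<open>b\<close> minus the one at
  \<open>a\<close>. Reflection reverses the sign of a Wronskian, so the limit at \<open>b\<close> is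
  minus the form of the mirror images at \<open>a\<close>, and both terms enter with the same
  sign.\<close>

lemma green:
  assumes g: "tpair g g1 h" and k: "tpair k k1 l"
  shows "(LINT x:I|lborel. rc x * (h x * cnj (k x) - g x * cnj (l x))) =
    - (sform (X g g1) (Y g g1) (X k k1) (Y k k1) +
       sform (Xm g g1) (Ym g g1)
             (Xm k k1) (Ym k k1))"
proof -
  note kc = adm_cnj[OF tpair_adm[OF k]]
  have kcq: "qd I (\<lambda>x. cnj (k x)) (\<lambda>x. cnj (k1 x)) (\<lambda>x. cnj (l x))"
    using k qd_sys_cnj unfolding tpair_def by blast
  have gq: "qd I g g1 h" using g unfolding tpair_def by blast
  let ?W = "\<lambda>x. g x * cnj (k1 x) - g1 x * cnj (k x)"
  have ac: "ac_rep I ?W (\<lambda>x. rc x * (h x * cnj (k x) - g x * cnj (l x)))"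
    by (rule lagrange_identity[OF gq kcq interval_Ioo])
  have tc: "trunc I (\<lambda>x. cnj (f x)) = (\<lambda>x. cnj (trunc I f x))" for f by (auto simp: trunc_def)
  have int: "set_integrable lborel I (\<lambda>x. rc x * (h x * cnj (k x) - g x * cnj (l x)))"
    by (rule integrable_wronskian[of I g h "\<lambda>x. cnj (k x)" "\<lambda>x. cnj (l x)"])
      (use g k in \<open>auto simp: tpair_def tc intro: WI.L2w_cnj\<close>)
  obtain L R where LR: "(?W \<longlongrightarrow> L) (at_right a)" "(?W \<longlongrightarrow> R) (at_left b)"
    "(LINT x:I|lborel. rc x * (h x * cnj (k x) - g x * cnj (l x))) = R - L"
    by (rule ac_rep_limits_Ioo[OF ac ab int])
  have "(?W \<longlongrightarrow> X g g1 * cnj (Y k k1) - Y g g1 * cnj (X k k1)) (at_right a)"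
    using wronskian_tendsto[OF tpair_adm[OF g] kc] XY_cnj[OF tpair_adm[OF k]] by simp
  then have L: "L = sform (X g g1) (Y g g1) (X k k1) (Y k k1)"
    using LR(1) tendsto_unique[OF trivial_limit_at_right_real] unfolding sform_def by blast
  note gr = tpair_adm[OF tpair_mirror[OF g]] and kr = tpair_adm[OF tpair_mirror[OF k]]
  have "((\<lambda>x. mirror g x * cnj (- mirror k1 x) - (- mirror g1 x) * cnj (mirror k x)) \<longlongrightarrow>
     Xm g g1 * cnj (Ym k k1) - Ym g g1 * cnj (Xm k k1)) (at_right a)"
    using wronskian_tendsto[OF gr adm_cnj[OF kr]] unfolding XY_cnj[OF kr] .
  moreover have "((\<lambda>x. mirror g x * cnj (- mirror k1 x) - (- mirror g1 x) * cnj (mirror k x)) \<longlongrightarrow> - R) (at_right a)"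
    using tendsto_minus[OF LR(2)[unfolded tendsto_at_left_reflect[of _ _ b a]]]
    by (simp add: mirror_def algebra_simps)
  ultimately have R: "- R = sform (Xm g g1) (Ym g g1)
             (Xm k k1) (Ym k k1)"
    using tendsto_unique[OF trivial_limit_at_right_real] unfolding sform_def by blast
  show ?thesis unfolding LR(3) L R[symmetric] by simp
qed

end

section \<open>Variation of constants\<close>

lemma AE_exists_Ioo:
  assumes "AE x in lborel. P (x::real)" "s < t"
  obtains x where "s < x" "x < t" "P x"
proof -
  have "\<exists>x\<in>{s<..<t}. P x"
  proof (rule ccontr)
    assume n: "\<not> (\<exists>x\<in>{s<..<t}. P x)"
    have "AE x in lborel. x \<notin> {s<..<t}" using assms(1) by eventually_elim (use n in auto)
    then have "{s<..<t} \<in> null_sets lborel" by (subst (asm) AE_iff_null_sets[symmetric]) auto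
    then show False using assms(2) by (auto simp: null_sets_def)
  qed
  then show ?thesis using that by auto
qed

lemma set_integral_restrict:
  fixes F :: "real \<Rightarrow> 'a::{banach, second_countable_topology}"
  assumes "T \<subseteq> S" "\<And>x. x \<in> S - T \<Longrightarrow> F x = 0"
  shows "(LINT x:S|lborel. F x) = (LINT x:T|lborel. F x)"
  unfolding set_lebesgue_integral_def
  using assms by (intro Bochner_Integration.integral_cong) (auto split: split_indicator)

lemma set_integral_zero_AE:
  fixes f :: "real \<Rightarrow> real"
  assumes "set_integrable lborel S f" "AE x in lborel. x \<in> S \<longrightarrow> 0 \<le> f x" "(LINT x:S|lborel. f x) = 0"
  shows "AE x in lborel. x \<in> S \<longrightarrow> f x = 0"
proof -
  have "AE x in lborel. 0 \<le> indicat_real S x *\<^sub>R f x"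
    using assms(2) by eventually_elim (auto split: split_indicator)
  then have "AE x in lborel. indicat_real S x *\<^sub>R f x = 0"
    using assms(1,3) unfolding set_integrable_def set_lebesgue_integral_def
    by (subst (asm) integral_nonneg_eq_0_iff_AE) auto
  then show ?thesis by eventually_elim (auto split: split_indicator_asm)
qed

context sl_problem
begin

text \<open>The derivatives of \<open>A\<close> and \<open>B\<close> are chosen so that
  \<open>A' * U + B' * V = 0\<close>, which makes \<open>A * U1 + B * V1\<close> the
  quasi-derivative. The Wronskian 1 then turns the remaining terms into the source
  \<open>k\<close>.\<close>

lemma variation_of_constants:
  assumes J: "is_interval J" "J \<subseteq> I"
    and A: "ac_rep J A (\<lambda>x. - (rc x * k x * V x))"
    and B: "ac_rep J B (\<lambda>x. rc x * k x * U x)"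
  shows "qd J (\<lambda>x. A x * U x + B x * V x) (\<lambda>x. A x * U1 x + B x * V1 x)
    (\<lambda>x. k x + \<Lambda> * (A x * U x + B x * V x))"
proof -
  note Uac = qd_sys_mono[OF U_qd J(2), unfolded qd_sys_def] and Vac = qd_sys_mono[OF V_qd J(2), unfolded qd_sys_def]
  have ac1: "ac_rep J (\<lambda>x. A x * U x + B x * V x)
    (\<lambda>x. (- (rc x * k x * V x) * U x + A x * (U1 x / p x)) + (rc x * k x * U x * V x + B x * (V1 x / p x)))"
    using Uac Vac by (intro ac_rep_add ac_rep_mult A B J) auto
  have ac2: "ac_rep J (\<lambda>x. A x * U1 x + B x * V1 x)
    (\<lambda>x. (- (rc x * k x * V x) * U1 x + A x * (q x * U x - r x * (\<Lambda> * U x)))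
       + (rc x * k x * U x * V1 x + B x * (q x * V x - r x * (\<Lambda> * V x))))"
    using Uac Vac by (intro ac_rep_add ac_rep_mult A B J) auto
  have eq: "(- (rc x * k x * V x) * U1 x + A x * (q x * U x - r x * (\<Lambda> * U x)))
       + (rc x * k x * U x * V1 x + B x * (q x * V x - r x * (\<Lambda> * V x)))
     = complex_of_real (q x) * (A x * U x + B x * V x) - rc x * (k x + \<Lambda> * (A x * U x + B x * V x))"
    if "x \<in> J" for x
  proof -
    have "V x * U1 x - V1 x * U x = 1" using wr' that J(2) by blast
    then have "rc x * k x * (V x * U1 x - V1 x * U x) = rc x * k x" by simp
    then show ?thesis by (simp add: algebra_simps)
  qed
  have "ac_rep J (\<lambda>x. A x * U x + B x * V x) (\<lambda>x. (A x * U1 x + B x * V1 x) / complex_of_real (p x))"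
    using ac1 by (simp add: algebra_simps add_divide_distrib)
  then show ?thesis
    unfolding qd_sys_def using ac_rep_cong[OF J(1) HOL.refl eq, THEN iffD1, OF _ ac2] by blast
qed

lemma continuous_UV:
  "continuous_on I U" "continuous_on I U1" "continuous_on I V" "continuous_on I V1"
  using qd_sys_continuous[OF U_qd interval_Ioo] qd_sys_continuous[OF V_qd interval_Ioo] by auto

lemma L2w_continuous_Icc:
  assumes st: "a < s" "t < b" and g: "continuous_on {s..t} g"
  shows "L2w r {s..t} (trunc {s..t} g)"
proof (cases "s \<le> t")
  case True
  show ?thesis
    unfolding L2w_def
  proof
    show "trunc {s..t} g \<in> borel_measurable lborel"
      using measurable_trunc_continuous[OF g] by simp
    have "set_integrable lborel {s..t} (\<lambda>x. rc x * complex_of_real ((cmod (g x))^2))"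
      using loc[OF st(1) True st(2)] g
      by (intro set_integrable_mult_continuous continuous_intros) (simp_all only: set_integrable_complex_of_real)
    then have "set_integrable lborel {s..t} (\<lambda>x. complex_of_real (r x * (cmod (g x))^2))" by (simp only: of_real_mult)
    then have "set_integrable lborel {s..t} (\<lambda>x. r x * (cmod (g x))^2)" by (simp only: set_integrable_complex_of_real)
    also have "?this \<longleftrightarrow> set_integrable lborel {s..t} (\<lambda>x. r x * (cmod (trunc {s..t} g x))^2)"
      by (intro set_integrable_cong) auto
    finally show "set_integrable lborel {s..t} (\<lambda>x. r x * (cmod (trunc {s..t} g x))^2)" .
  qed
next
  case False
  then have "{s..t} = {}" by auto
  then show ?thesis by (simp add: L2w_def trunc_def)
qed

lemma integrable_mult_local:
  assumes st: "a < s" "t < b" and k: "L2w r I (trunc I k)" and g: "continuous_on {s..t} g"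
  shows "set_integrable lborel {s..t} (\<lambda>x. rc x * k x * g x)"
proof -
  have sub: "{s..t} \<subseteq> I" using st by auto
  interpret W: weighted_L2 r "{s..t}" by (rule weighted[OF sub]) auto
  have "set_integrable lborel {s..t} (\<lambda>x. rc x * trunc {s..t} k x * trunc {s..t} g x)"
    by (intro W.L2w_integrable_mult L2w_trunc_mono[OF k sub] L2w_continuous_Icc[OF st g]) auto
  also have "?this \<longleftrightarrow> ?thesis" by (intro set_integrable_cong) auto
  finally show ?thesis .
qed

text \<open>Solving with a source in \<open>{s..t}\<close>, the solution is a combination of
  \<open>U\<close> and \<open>V\<close> on either side, and crossing the support changes its
  coefficients by two moments of \<open>k\<close>. Prescribing the moments prescribes the behaviour
  at both ends.\<close>

lemma patching:
  assumes st: "a < s" "s \<le> t" "t < b" and k: "L2w r I (trunc I k)" and k0: "\<And>x. x \<in> I - {s..t} \<Longrightarrow> k x = 0"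
  obtains f f1 where "qd I f f1 (\<lambda>x. k x + \<Lambda> * f x)"
    "\<And>x. a < x \<Longrightarrow> x \<le> s \<Longrightarrow> f x = A0 * U x + B0 * V x"
    "\<And>x. a < x \<Longrightarrow> x \<le> s \<Longrightarrow> f1 x = A0 * U1 x + B0 * V1 x"
    "\<And>x. t \<le> x \<Longrightarrow> x < b \<Longrightarrow> f x = (A0 - (LINT x:{s..t}|lborel. rc x * k x * V x)) * U x
        + (B0 + (LINT x:{s..t}|lborel. rc x * k x * U x)) * V x"
    "\<And>x. t \<le> x \<Longrightarrow> x < b \<Longrightarrow> f1 x = (A0 - (LINT x:{s..t}|lborel. rc x * k x * V x)) * U1 x
        + (B0 + (LINT x:{s..t}|lborel. rc x * k x * U x)) * V1 x"
proof -
  have sI: "s \<in> I" "t \<in> I" using st by auto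
  have int: "set_integrable lborel {l..m} (\<lambda>x. rc x * k x * g x)"
    if "l \<in> I" "m \<in> I" "continuous_on I g" for l m g
    using that by (intro integrable_mult_local k continuous_on_subset[OF that(3)]) auto
  have "\<exists>A. ac_rep I A (\<lambda>x. - 1 * (rc x * k x * V x)) \<and> A s = A0"
    by (intro ac_rep_exists sI set_integrable_mult_right int continuous_UV)
  then obtain A where A': "ac_rep I A (\<lambda>x. - 1 * (rc x * k x * V x))" "A s = A0" by blast
  have A: "ac_rep I A (\<lambda>x. - (rc x * k x * V x))" using A'(1) by simp
  have "\<exists>B. ac_rep I B (\<lambda>x. rc x * k x * U x) \<and> B s = B0"
    by (intro ac_rep_exists sI int continuous_UV)
  then obtain B where B: "ac_rep I B (\<lambda>x. rc x * k x * U x)" "B s = B0" by blast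
  \<comment> \<open>\<open>k\<close> may be nonzero at \<open>s\<close> and \<open>t\<close>
    themselves, so the integrands are known to vanish only on open intervals.\<close>
  have zero: "(LINT x:{l..m}|lborel. G x) = 0" if "\<And>x. x \<in> {l<..<m} \<Longrightarrow> G x = 0" for l m and G :: "real \<Rightarrow> complex"
  proof -
    have "AE x in lborel. indicator {l..m} x *\<^sub>R G x = 0"
      using AE_lborel_singleton[of l] AE_lborel_singleton[of m]
      by eventually_elim (use that in \<open>auto split: split_indicator\<close>)
    then show ?thesis unfolding set_lebesgue_integral_def by (rule integral_eq_zero_AE)
  qed
  have left: "A x = A0 \<and> B x = B0" if "a < x" "x \<le> s" for x
  proof -
    have xI: "x \<in> I" using that st by auto
    have k0': "k y = 0" if "y \<in> {x<..<s}" for y using that k0[of y] xI sI by auto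
    have "A s - A x = 0" using ac_repD(2)[OF A xI sI(1) that(2)] zero[of x s "\<lambda>x. - (rc x * k x * V x)"] k0' by simp
    moreover have "B s - B x = 0" using ac_repD(2)[OF B(1) xI sI(1) that(2)] zero[of x s "\<lambda>x. rc x * k x * U x"] k0' by simp
    ultimately show ?thesis using A'(2) B(2) by simp
  qed
  have right: "A x = A0 - (LINT x:{s..t}|lborel. rc x * k x * V x) \<and>
      B x = B0 + (LINT x:{s..t}|lborel. rc x * k x * U x)" if "t \<le> x" "x < b" for x
  proof -
    have xI: "x \<in> I" using that st by auto
    have k0': "k y = 0" if "y \<in> {t<..<x}" for y using that k0[of y] xI sI by auto
    have "A x - A t = 0" using ac_repD(2)[OF A sI(2) xI that(1)] zero[of t x "\<lambda>x. - (rc x * k x * V x)"] k0' by simp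
    moreover have "B x - B t = 0" using ac_repD(2)[OF B(1) sI(2) xI that(1)] zero[of t x "\<lambda>x. rc x * k x * U x"] k0' by simp
    moreover have "A t - A s = - (LINT x:{s..t}|lborel. rc x * k x * V x)"
      unfolding ac_repD(2)[OF A'(1) sI st(2), symmetric] set_integral_mult_right by simp
    moreover have "B t - B s = (LINT x:{s..t}|lborel. rc x * k x * U x)"
      using ac_repD(2)[OF B(1) sI st(2)] by simp
    ultimately show ?thesis using A'(2) B(2) by (simp add: algebra_simps)
  qed
  show ?thesis
    by (rule that[OF variation_of_constants[OF interval_Ioo subset_refl A B(1)]]) (use left right in auto)
qed

section \<open>The Gram matrix of the two solutions\<close>

lemma comb_zero_imp:
  assumes x: "x \<in> I" and z: "\<alpha> * u x + \<beta> * v x = 0" "\<alpha> * u1 x + \<beta> * v1 x = 0"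
  shows "\<alpha> = 0 \<and> \<beta> = 0"
proof -
  have "\<alpha> * (v x * u1 x - v1 x * u x) = v x * (\<alpha> * u1 x + \<beta> * v1 x) - v1 x * (\<alpha> * u x + \<beta> * v x)"
    by (simp add: algebra_simps)
  moreover have "\<beta> * (v x * u1 x - v1 x * u x) = u1 x * (\<alpha> * u x + \<beta> * v x) - u x * (\<alpha> * u1 x + \<beta> * v1 x)"
    by (simp add: algebra_simps)
  ultimately show ?thesis unfolding z wr[OF x] by simp
qed

text \<open>If \<open>\<sigma> = \<alpha> u + \<beta> v\<close> vanishes almost everywhere, then \<open>\<sigma> \<sigma>1\<close> has derivative \<open>\<sigma>1\<^sup>2 / p\<close>
  almost everywhere and vanishes at two points, so \<open>\<sigma>1\<close> vanishes almost everywhere as well.\<close>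

lemma comb_AE_zero_imp:
  assumes st: "a < s" "s < t" "t < b" and ae: "AE x in lborel. x \<in> {s..t} \<longrightarrow> \<alpha> * u x + \<beta> * v x = 0"
  shows "\<alpha> = 0 \<and> \<beta> = 0"
proof -
  define w where "w x = \<alpha> * u x + \<beta> * v x" for x
  define w1 where "w1 x = \<alpha> * u1 x + \<beta> * v1 x" for x
  define G where "G x = w1 x * w1 x / p x + (q x - lam0 * r x) * w x * w x" for x
  have "qd I (\<lambda>x. complex_of_real \<alpha> * U x + complex_of_real \<beta> * V x) (\<lambda>x. complex_of_real \<alpha> * U1 x + complex_of_real \<beta> * V1 x)
    (\<lambda>x. complex_of_real \<alpha> * (\<Lambda> * U x) + complex_of_real \<beta> * (\<Lambda> * V x))"
    by (rule qd_sys_combine[OF U_qd V_qd])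
  then have qw: "qd I (\<lambda>x. complex_of_real (w x)) (\<lambda>x. complex_of_real (w1 x)) (\<lambda>x. \<Lambda> * complex_of_real (w x))"
    by (simp add: w_def w1_def algebra_simps)
  have "ac_rep I (\<lambda>x. complex_of_real (w x) * complex_of_real (w1 x))
    (\<lambda>x. complex_of_real (w1 x) / complex_of_real (p x) * complex_of_real (w1 x) +
      complex_of_real (w x) * (complex_of_real (q x) * complex_of_real (w x) - rc x * (\<Lambda> * complex_of_real (w x))))"
    using qw unfolding qd_sys_def by (intro ac_rep_mult interval_Ioo) auto
  then have ac: "ac_rep I (\<lambda>x. complex_of_real (w x) * complex_of_real (w1 x)) (\<lambda>x. complex_of_real (G x))"
    by (simp add: G_def algebra_simps)
  have ae': "AE x in lborel. x \<in> {s..t} \<longrightarrow> w x = 0" using ae by (simp add: w_def)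
  obtain x where x: "s < x" "x < (s + t) / 2" "x \<in> {s..t} \<longrightarrow> w x = 0"
    using AE_exists_Ioo[OF ae', of s "(s + t) / 2"] st by auto
  obtain y where y: "(s + t) / 2 < y" "y < t" "y \<in> {s..t} \<longrightarrow> w y = 0"
    using AE_exists_Ioo[OF ae', of "(s + t) / 2" t] st by auto
  have xy: "x \<in> I" "y \<in> I" "x \<le> y" "x < y" using x y st by auto
  have "(LINT x:{x..y}|lborel. complex_of_real (G x)) = 0"
    using ac_repD(2)[OF ac xy(1-3)] x y by auto
  then have "(LINT x:{x..y}|lborel. G x) = 0" by (simp add: set_integral_complex_of_real)
  moreover have "set_integrable lborel {x..y} G"
    using ac_repD(1)[OF ac xy(1-3)] by (simp only: set_integrable_complex_of_real)
  moreover have "AE z in lborel. z \<in> {x..y} \<longrightarrow> 0 \<le> G z"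
    using ae' p_pos by eventually_elim (use x y st in \<open>auto simp: G_def\<close>)
  ultimately have "AE z in lborel. z \<in> {x..y} \<longrightarrow> G z = 0" by (intro set_integral_zero_AE)
  then have "AE z in lborel. z \<in> {x..y} \<longrightarrow> w z = 0 \<and> w1 z = 0"
    using ae' p_pos by eventually_elim (use x y st in \<open>auto simp: G_def\<close>)
  then obtain z where z: "x < z" "z < y" "z \<in> {x..y} \<longrightarrow> w z = 0 \<and> w1 z = 0"
    using AE_exists_Ioo xy(4) by blast
  then have "z \<in> I" "w z = 0" "w1 z = 0" using xy by auto
  then show ?thesis using comb_zero_imp unfolding w_def w1_def by blast
qed

text \<open>\<open>u\<close> and \<open>v\<close> are real, so real and imaginary parts of the
  coefficients are handled separately by the real case.\<close>

lemma comb_AE_unique: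
  assumes st: "a < s" "s < t" "t < b"
    and ae: "AE x in lborel. x \<in> {s..t} \<longrightarrow> c1 * U x + c2 * V x = d1 * U x + d2 * V x"
  shows "c1 = d1 \<and> c2 = d2"
proof -
  have "AE x in lborel. x \<in> {s..t} \<longrightarrow> Re (c1 - d1) * u x + Re (c2 - d2) * v x = 0"
    using ae
  proof eventually_elim
    case (elim x)
    show ?case
    proof
      assume "x \<in> {s..t}"
      then have "Re (c1 * U x + c2 * V x) = Re (d1 * U x + d2 * V x)" using elim by simp
      then show "Re (c1 - d1) * u x + Re (c2 - d2) * v x = 0" by (simp add: algebra_simps)
    qed
  qed
  moreover have "AE x in lborel. x \<in> {s..t} \<longrightarrow> Im (c1 - d1) * u x + Im (c2 - d2) * v x = 0"
    using ae
  proof eventually_elim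
    case (elim x)
    show ?case
    proof
      assume "x \<in> {s..t}"
      then have "Im (c1 * U x + c2 * V x) = Im (d1 * U x + d2 * V x)" using elim by simp
      then show "Im (c1 - d1) * u x + Im (c2 - d2) * v x = 0" by (simp add: algebra_simps)
    qed
  qed
  ultimately have "Re (c1 - d1) = 0 \<and> Re (c2 - d2) = 0" "Im (c1 - d1) = 0 \<and> Im (c2 - d2) = 0"
    using comb_AE_zero_imp[OF st] by blast+
  then show ?thesis by (simp add: complex_eq_iff)
qed

text \<open>Arbitrary moments are attained already by a combination of \<open>U\<close> and
  \<open>V\<close>: their Gram matrix on \<open>{s..t}\<close> is positive definite, since no
  nontrivial real combination vanishes almost everywhere there.\<close>

lemma gram_solve:
  assumes st: "a < s" "s < t" "t < b"
  obtains c1 c2 where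
    "(LINT x:{s..t}|lborel. rc x * (c1 * U x + c2 * V x) * U x) = m1"
    "(LINT x:{s..t}|lborel. rc x * (c1 * U x + c2 * V x) * V x) = m2"
proof -
  have sub: "{s..t} \<subseteq> I" using st by auto
  note cU = continuous_on_subset[OF continuous_UV(1) sub] and cV = continuous_on_subset[OF continuous_UV(3) sub]
  have rint: "set_integrable lborel {s..t} (\<lambda>x. rc x)"
    using loc[of s t] st by (simp only: set_integrable_complex_of_real less_imp_le)
  define D where "D = (LINT x:{s..t}|lborel. r x * u x * u x)"
  define E where "E = (LINT x:{s..t}|lborel. r x * u x * v x)"
  define F where "F = (LINT x:{s..t}|lborel. r x * v x * v x)"
  have ic: "set_integrable lborel {s..t} (\<lambda>x. rc x * U x * U x)"
    "set_integrable lborel {s..t} (\<lambda>x. rc x * U x * V x)"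
    "set_integrable lborel {s..t} (\<lambda>x. rc x * V x * V x)"
    by (intro set_integrable_mult_continuous rint cU cV)+
  have ir: "set_integrable lborel {s..t} (\<lambda>x. r x * u x * u x)"
    "set_integrable lborel {s..t} (\<lambda>x. r x * u x * v x)"
    "set_integrable lborel {s..t} (\<lambda>x. r x * v x * v x)"
    using ic by (simp_all only: of_real_mult[symmetric] set_integrable_complex_of_real)
  have I: "(LINT x:{s..t}|lborel. rc x * U x * U x) = complex_of_real D"
    "(LINT x:{s..t}|lborel. rc x * U x * V x) = complex_of_real E"
    "(LINT x:{s..t}|lborel. rc x * V x * V x) = complex_of_real F"
    unfolding D_def E_def F_def by (simp_all only: of_real_mult[symmetric] set_integral_complex_of_real)
  have pd: "0 < \<alpha>^2 * D + 2 * \<alpha> * \<beta> * E + \<beta>^2 * F" if "\<alpha> \<noteq> 0 \<or> \<beta> \<noteq> 0" for \<alpha> \<beta>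
  proof -
    let ?G = "\<lambda>x. \<alpha>^2 * (r x * u x * u x) + 2 * \<alpha> * \<beta> * (r x * u x * v x) + \<beta>^2 * (r x * v x * v x)"
    have int: "set_integrable lborel {s..t} ?G" using ir by (intro set_integral_add set_integrable_mult_right)
    have val: "(LINT x:{s..t}|lborel. ?G x) = \<alpha>^2 * D + 2 * \<alpha> * \<beta> * E + \<beta>^2 * F"
      using ir unfolding D_def E_def F_def by simp
    have sq: "?G x = r x * (\<alpha> * u x + \<beta> * v x)^2" for x by (simp add: algebra_simps power2_eq_square)
    have nn: "AE x in lborel. x \<in> {s..t} \<longrightarrow> 0 \<le> ?G x"
      using r_pos unfolding sq by eventually_elim (use sub in auto)
    have "0 \<le> (LINT x:{s..t}|lborel. ?G x)"
      unfolding set_lebesgue_integral_def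
      by (rule integral_nonneg_AE) (use nn in eventually_elim, auto split: split_indicator)
    moreover have "(LINT x:{s..t}|lborel. ?G x) \<noteq> 0"
    proof
      assume "(LINT x:{s..t}|lborel. ?G x) = 0"
      from set_integral_zero_AE[OF int nn this]
      have "AE x in lborel. x \<in> {s..t} \<longrightarrow> \<alpha> * u x + \<beta> * v x = 0"
        using r_pos unfolding sq by eventually_elim (use sub in auto)
      then show False using comb_AE_zero_imp[OF st] that by blast
    qed
    ultimately show ?thesis unfolding val by simp
  qed
  have D: "0 < D" using pd[of 1 0] by simp
  \<comment> \<open>The vector \<open>(- E, D)\<close> turns the quadratic form into
    \<open>D\<close> times the determinant.\<close>
  have "0 < D * (D * F - E * E)"
    using pd[of "- E" D] D by (simp add: power2_eq_square algebra_simps)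
  then have det: "D * F - E * E \<noteq> 0" using D by auto
  then have det': "complex_of_real D * complex_of_real F - complex_of_real E * complex_of_real E \<noteq> 0"
    by (metis of_real_diff of_real_eq_0_iff of_real_mult)
  let ?\<Delta> = "complex_of_real D * complex_of_real F - complex_of_real E * complex_of_real E"
  define c1 where "c1 = (m1 * complex_of_real F - m2 * complex_of_real E) / ?\<Delta>"
  define c2 where "c2 = (m2 * complex_of_real D - m1 * complex_of_real E) / ?\<Delta>"
  have frac: "x / ?\<Delta> * d + y / ?\<Delta> * e = m" if "x * d + y * e = m * ?\<Delta>" for x y d e m
  proof -
    have "x / ?\<Delta> * d + y / ?\<Delta> * e = (x * d + y * e) / ?\<Delta>" by (simp add: add_divide_distrib)
    then show ?thesis unfolding that using det' by simp
  qed
  have "(LINT x:{s..t}|lborel. rc x * (c1 * U x + c2 * V x) * U x) =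
     (LINT x:{s..t}|lborel. c1 * (rc x * U x * U x) + c2 * (rc x * U x * V x))"
    by (simp add: algebra_simps)
  also have "\<dots> = c1 * complex_of_real D + c2 * complex_of_real E" using ic I by simp
  also have "\<dots> = m1" unfolding c1_def c2_def by (rule frac) (simp add: algebra_simps)
  finally have e1: "(LINT x:{s..t}|lborel. rc x * (c1 * U x + c2 * V x) * U x) = m1" .
  have "(LINT x:{s..t}|lborel. rc x * (c1 * U x + c2 * V x) * V x) =
     (LINT x:{s..t}|lborel. c1 * (rc x * U x * V x) + c2 * (rc x * V x * V x))"
    by (simp add: algebra_simps)
  also have "\<dots> = c1 * complex_of_real E + c2 * complex_of_real F" using ic I by simp
  also have "\<dots> = m2" unfolding c1_def c2_def by (rule frac) (simp add: algebra_simps)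
  finally show ?thesis using that e1 by blast
qed

lemma L2w_compact_support:
  assumes st: "a < s" "t < b" and g: "L2w r {s..t} (trunc {s..t} g)"
  shows "L2w r I (trunc {s..t} g)"
  unfolding L2w_def
proof
  show "trunc {s..t} g \<in> borel_measurable lborel" using g by (simp add: L2w_def)
  have "set_integrable lborel {s..t} (\<lambda>x. r x * (cmod (trunc {s..t} g x))^2)"
    using g by (simp add: L2w_def)
  also have "(\<lambda>x. indicat_real {s..t} x *\<^sub>R (r x * (cmod (trunc {s..t} g x))^2)) =
     (\<lambda>x. indicat_real I x *\<^sub>R (r x * (cmod (trunc {s..t} g x))^2))"
    using st by (auto simp: fun_eq_iff trunc_def split: split_indicator)
  then have "set_integrable lborel {s..t} (\<lambda>x. r x * (cmod (trunc {s..t} g x))^2) \<longleftrightarrow>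
    set_integrable lborel I (\<lambda>x. r x * (cmod (trunc {s..t} g x))^2)"
    unfolding set_integrable_def by (simp only:)
  finally show "set_integrable lborel I (\<lambda>x. r x * (cmod (trunc {s..t} g x))^2)" .
qed

lemma trunc_I_trunc: "a < s \<Longrightarrow> t < b \<Longrightarrow> trunc I (trunc {s..t} g) = trunc {s..t} g"
  by (auto simp: trunc_def fun_eq_iff)

text \<open>Start from \<open>y * U + x * V\<close> near \<open>a\<close>, which has the desired
  boundary values, and use a source with moments \<open>y\<close> against \<open>V\<close> and
  \<open>- x\<close> against \<open>U\<close>; by \<open>patching\<close> both coefficients drop to
  0 beyond the support.\<close>

lemma bv_surj:
  obtains g g1 h where "tpair g g1 h" "X g g1 = x" "Y g g1 = y"
    "X (mirror g) (\<lambda>x. - mirror g1 x) = 0" "Y (mirror g) (\<lambda>x. - mirror g1 x) = 0"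
proof -
  obtain e where e: "a < e" "e \<le> b" "L2w r {a<..<e} (trunc {a<..<e} U)" "L2w r {a<..<e} (trunc {a<..<e} V)"
    by (rule adm_common[OF adm_U adm_V])
  \<comment> \<open>The middle third of \<open>{a<..<e}\<close>, so that the part left of
    \<open>s\<close> stays where \<open>U\<close> and \<open>V\<close> are known to be square
    integrable.\<close>
  define s where "s = (2 * a + e) / 3"
  define t where "t = (a + 2 * e) / 3"
  have st: "a < s" "s < t" "t < e" "t < b" using e(1,2) by (simp_all add: s_def t_def field_simps)
  obtain c1 c2 where c: "(LINT x:{s..t}|lborel. rc x * (c1 * U x + c2 * V x) * U x) = - x"
    "(LINT x:{s..t}|lborel. rc x * (c1 * U x + c2 * V x) * V x) = y"
    using gram_solve[OF st(1,2,4)] by blast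
  define k where "k = trunc {s..t} (\<lambda>x. c1 * U x + c2 * V x)"
  have sub: "{s..t} \<subseteq> I" using st by auto
  have k: "L2w r I k"
    unfolding k_def by (intro L2w_compact_support L2w_continuous_Icc st continuous_intros
        continuous_on_subset[OF continuous_UV(1) sub] continuous_on_subset[OF continuous_UV(3) sub])
  have tk: "trunc I k = k" unfolding k_def using st by (intro trunc_I_trunc) auto
  have ik: "(LINT x:{s..t}|lborel. rc x * k x * V x) = y"
    "(LINT x:{s..t}|lborel. rc x * k x * U x) = - x"
    unfolding c[symmetric] by (intro set_lebesgue_integral_cong; simp add: k_def)+
  obtain g g1 where g: "qd I g g1 (\<lambda>x. k x + \<Lambda> * g x)"
    "\<And>z. a < z \<Longrightarrow> z \<le> s \<Longrightarrow> g z = y * U z + x * V z"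
    "\<And>z. a < z \<Longrightarrow> z \<le> s \<Longrightarrow> g1 z = y * U1 z + x * V1 z"
    "\<And>z. t \<le> z \<Longrightarrow> z < b \<Longrightarrow> g z = 0" "\<And>z. t \<le> z \<Longrightarrow> z < b \<Longrightarrow> g1 z = 0"
  proof (rule patching[of s t k y x])
    show "L2w r I (trunc I k)" using k tk by simp
    show "k z = 0" if "z \<in> I - {s..t}" for z using that by (auto simp: k_def trunc_def)
  qed (use st ik in auto)
  have gc: "continuous_on I g" using qd_sys_continuous[OF g(1) interval_Ioo] by simp
  have "L2w r I (trunc I g)"
    unfolding L2w_def
  proof
    show "trunc I g \<in> borel_measurable lborel" using measurable_trunc_continuous[OF gc] by simp
    have W: "weighted_L2 r {a<..s}" by (rule weighted) (use st in auto)
    have "L2w r {a<..s} (trunc {a<..s} (\<lambda>z. y * U z + x * V z))"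
      by (rule L2w_trunc_combine[OF W L2w_trunc_mono[OF e(3)] L2w_trunc_mono[OF e(4)]]) (use st in auto)
    then have "set_integrable lborel {a<..s} (\<lambda>z. r z * (cmod (trunc {a<..s} (\<lambda>z. y * U z + x * V z) z))^2)"
      by (simp add: L2w_def)
    also have "?this \<longleftrightarrow> set_integrable lborel {a<..s} (\<lambda>z. r z * (cmod (trunc I g z))^2)"
      using g(2) st by (intro set_integrable_cong) auto
    finally have i1: "set_integrable lborel {a<..s} (\<lambda>z. r z * (cmod (trunc I g z))^2)" .
    have "L2w r {s..t} (trunc {s..t} g)"
      by (rule L2w_continuous_Icc[OF st(1,4) continuous_on_subset[OF gc sub]])
    then have "set_integrable lborel {s..t} (\<lambda>z. r z * (cmod (trunc {s..t} g z))^2)" by (simp add: L2w_def)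
    also have "?this \<longleftrightarrow> set_integrable lborel {s..t} (\<lambda>z. r z * (cmod (trunc I g z))^2)"
      using sub by (intro set_integrable_cong) auto
    finally have i2: "set_integrable lborel {s..t} (\<lambda>z. r z * (cmod (trunc I g z))^2)" .
    have "set_integrable lborel {t..<b} (\<lambda>z. r z * (cmod (trunc I g z))^2) \<longleftrightarrow> set_integrable lborel {t..<b} (\<lambda>z. 0::real)"
      using g(4) st by (intro set_integrable_cong) auto
    then have i3: "set_integrable lborel {t..<b} (\<lambda>z. r z * (cmod (trunc I g z))^2)" by (simp add: set_integrable_def)
    have "set_integrable lborel ({a<..s} \<union> {s..t} \<union> {t..<b}) (\<lambda>z. r z * (cmod (trunc I g z))^2)"
      using i1 i2 i3 by (intro set_integrable_Un) auto
    moreover have "{a<..s} \<union> {s..t} \<union> {t..<b} = I" using st by auto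
    ultimately show "set_integrable lborel I (\<lambda>z. r z * (cmod (trunc I g z))^2)" by simp
  qed
  then have tp: "tpair g g1 (\<lambda>x. k x + \<Lambda> * g x)"
    using g(1) L2w_trunc_combine[OF WI.weighted_L2_axioms, of k g 1 "\<Lambda>"] k tk
    unfolding tpair_def by simp
  have near: "X g g1 = X (\<lambda>z. y * U z + x * V z) (\<lambda>z. y * U1 z + x * V1 z)" "Y g g1 = Y (\<lambda>z. y * U z + x * V z) (\<lambda>z. y * U1 z + x * V1 z)"
    by (rule XY_cong[of s]; use st g(2,3) in auto)+
  have zero: "X (\<lambda>z. 0) (\<lambda>z. 0) = 0" "Y (\<lambda>z. 0) (\<lambda>z. 0) = 0"
    by (rule X_eqI, simp) (rule Y_eqI, simp)
  have far: "X (mirror g) (\<lambda>x. - mirror g1 x) = 0" "Y (mirror g) (\<lambda>x. - mirror g1 x) = 0"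
    by (rule trans[OF XY_cong(1)[of "a + b - t"] zero(1)], use st g(4,5) in \<open>auto simp: mirror_def\<close>)
      (rule trans[OF XY_cong(2)[of "a + b - t"] zero(2)], use st g(4,5) in \<open>auto simp: mirror_def\<close>)
  show ?thesis
    by (rule that[OF tp _ _ far]) (simp_all add: near XY_combine[OF adm_U adm_V] XY_UV)
qed

section \<open>The adjoint of the preminimal operator\<close>

text \<open>The equation determines \<open>h\<close> only almost everywhere. Changing
  \<open>h\<close> on a null set adds a null integrand to the derivative of \<open>g1\<close>; the
  measurability conditions make that integrand integrable, as Borel measurability is not inherited
  under almost everywhere equality.\<close>

lemma qd_cong_AE:
  assumes J: "is_interval J" and g: "qd J g g1 h" and ae: "aeq J h h'"
    and [measurable]: "h' \<in> borel_measurable borel" "trunc J h \<in> borel_measurable borel"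
  shows "qd J g g1 h'"
proof -
  have [measurable]: "r \<in> borel_measurable borel" by (rule r_meas)
  have d: "ac_rep J (\<lambda>x. 0) (\<lambda>x. rc x * (h x - h' x))"
  proof (rule ac_repI)
    fix s t assume st: "s \<in> J" "t \<in> J" "s \<le> t"
    have sub: "{s..t} \<subseteq> J" by (rule interval_subset_real[OF J st(1,2)])
    have eq: "(\<lambda>x. indicator {s..t} x *\<^sub>R (rc x * (h x - h' x))) =
      (\<lambda>x. indicator {s..t} x *\<^sub>R (rc x * (trunc J h x - h' x)))"
      using sub by (auto simp: fun_eq_iff split: split_indicator)
    have z: "AE x in lborel. indicator {s..t} x *\<^sub>R (rc x * (trunc J h x - h' x)) = 0"
      using ae unfolding aeq_def by eventually_elim (use sub in \<open>auto split: split_indicator\<close>)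
    have m: "(\<lambda>x. indicator {s..t} x *\<^sub>R (rc x * (trunc J h x - h' x))) \<in> borel_measurable lborel"
      by measurable
    show "set_integrable lborel {s..t} (\<lambda>x. rc x * (h x - h' x))"
      unfolding set_integrable_def eq
      using integrable_cong_AE[OF m _ z] by simp
    show "(LINT x:{s..t}|lborel. rc x * (h x - h' x)) = 0 - 0"
      unfolding set_lebesgue_integral_def eq using integral_eq_zero_AE[OF z] by simp
  qed
  have "ac_rep J (\<lambda>x. g1 x + 0) (\<lambda>x. (complex_of_real (q x) * g x - rc x * h x) + rc x * (h x - h' x))"
    using g unfolding qd_sys_def by (intro ac_rep_add d) auto
  then have "ac_rep J g1 (\<lambda>x. complex_of_real (q x) * g x - rc x * h' x)"
    by (simp add: algebra_simps)
  then show ?thesis using g unfolding qd_sys_def by simp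
qed

text \<open>\<open>y\<close> solves the equation that \<open>w\<close> should satisfy, so
  \<open>w - y\<close> is formally orthogonal to the range of \<open>T0\<close> minus
  \<open>lam0\<close>. Sources on \<open>{s..t}\<close> orthogonal to \<open>U\<close> and
  \<open>V\<close> lie in that range, which leaves \<open>w - y\<close> in the span of
  \<open>U\<close> and \<open>V\<close> on \<open>{s..t}\<close>.\<close>

lemma orthogonal_range:
  assumes wz: "(w, z) \<in> adjw r I (T0 p q r a b)" and st: "a < s" "s < t" "t < b"
    and yq: "qd I y y1 (\<lambda>x. z x - \<Lambda> * w x + \<Lambda> * y x)"
  obtains c1 c2 where "AE x in lborel. x \<in> {s..t} \<longrightarrow> w x - y x = c1 * U x + c2 * V x"
proof -
  have w: "L2w r I w" and z: "L2w r I z" using wz unfolding adjw_def by auto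
  have orth: "ipw r I h w = ipw r I f z" if "(f, h) \<in> T0 p q r a b" for f h
    using wz that unfolding adjw_def by auto
  define \<kappa> where "\<kappa> x = z x - \<Lambda> * w x" for x
  have \<kappa>: "L2w r I \<kappa>" using WI.L2w_combine[OF z w, of 1 "- \<Lambda>"] by (simp add: \<kappa>_def[abs_def])
  have sub: "{s..t} \<subseteq> I" using st by auto
  interpret W: weighted_L2 r "{s..t}" by (rule weighted[OF sub]) auto
  have yc: "continuous_on I y" using qd_sys_continuous[OF yq interval_Ioo] by simp
  note cc = continuous_on_subset[OF continuous_UV(1) sub] continuous_on_subset[OF continuous_UV(3) sub] continuous_on_subset[OF yc sub]
  have lw: "L2w r {s..t} (trunc {s..t} w)"
    using L2w_mono[OF w sub] L2w_trunc_iff[OF W.weighted_L2_axioms WI.L2w_measurable[OF w]] by simp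
  define \<zeta> where "\<zeta> x = w x - y x" for x
  have l\<zeta>: "L2w r {s..t} (trunc {s..t} \<zeta>)"
    using L2w_trunc_combine[OF W.weighted_L2_axioms lw L2w_continuous_Icc[OF st(1,3) cc(3)], of 1 "-1"]
    by (simp add: \<zeta>_def[abs_def])
  have cUV: "continuous_on {s..t} (\<lambda>x. c1 * U x + c2 * V x)" for c1 c2 by (intro continuous_intros cc)
  have i\<zeta>: "set_integrable lborel {s..t} (\<lambda>x. rc x * \<zeta> x * g x)" if "continuous_on {s..t} g" for g
  proof -
    have "set_integrable lborel {s..t} (\<lambda>x. rc x * trunc {s..t} \<zeta> x * trunc {s..t} g x)"
      by (intro W.L2w_integrable_mult l\<zeta> L2w_continuous_Icc st that)
    also have "?this \<longleftrightarrow> ?thesis" by (intro set_integrable_cong) auto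
    finally show ?thesis .
  qed
  have rint: "set_integrable lborel {s..t} (\<lambda>x. rc x)"
    using loc[of s t] st by (simp only: set_integrable_complex_of_real less_imp_le)
  \<comment> \<open>Subtract from \<open>\<zeta> = w - y\<close> its projection to the span of
    \<open>U\<close> and \<open>V\<close>. The remainder \<open>k\<close> has zero moments, so
    \<open>patching\<close> from zero data gives a compactly supported \<open>f\<close>, and
    \<open>k\<close> serves as its own test source.\<close>
  obtain c1 c2 where c:
    "(LINT x:{s..t}|lborel. rc x * (c1 * U x + c2 * V x) * U x) = (LINT x:{s..t}|lborel. rc x * \<zeta> x * U x)"
    "(LINT x:{s..t}|lborel. rc x * (c1 * U x + c2 * V x) * V x) = (LINT x:{s..t}|lborel. rc x * \<zeta> x * V x)"
    using gram_solve[OF st] by blast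
  define k where "k = trunc {s..t} (\<lambda>x. \<zeta> x - (c1 * U x + c2 * V x))"
  have kst: "L2w r {s..t} k"
  proof -
    have eq: "(\<lambda>x. 1 * \<zeta> x + (- 1) * (c1 * U x + c2 * V x)) = (\<lambda>x. \<zeta> x - (c1 * U x + c2 * V x))"
      by (simp add: fun_eq_iff)
    show ?thesis unfolding k_def eq[symmetric]
      by (rule L2w_trunc_combine[OF W.weighted_L2_axioms l\<zeta> L2w_continuous_Icc[OF st(1,3) cUV]])
  qed
  have kI: "L2w r I k" unfolding k_def by (rule L2w_compact_support[OF st(1,3)]) (use kst in \<open>simp add: k_def\<close>)
  have tk: "trunc I k = k" unfolding k_def by (rule trunc_I_trunc[OF st(1,3)])
  have k0: "k x = 0" if "x \<in> I - {s..t}" for x using that by (auto simp: k_def trunc_def)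
  have kdef': "k x = \<zeta> x - (c1 * U x + c2 * V x)" if "x \<in> {s..t}" for x using that by (simp add: k_def)
  have ik: "(LINT x:{s..t}|lborel. rc x * k x * g x) = 0"
    if "g = (\<lambda>x. U x) \<or> g = (\<lambda>x. V x)" for g
  proof -
    have gc: "continuous_on {s..t} g" using that cc by auto
    have int: "set_integrable lborel {s..t} (\<lambda>x. rc x * (c1 * U x + c2 * V x) * g x)"
      by (intro set_integrable_mult_continuous rint cUV gc)
    have "(LINT x:{s..t}|lborel. rc x * k x * g x) =
      (LINT x:{s..t}|lborel. rc x * \<zeta> x * g x - rc x * (c1 * U x + c2 * V x) * g x)"
      by (intro set_lebesgue_integral_cong) (auto simp: kdef' algebra_simps)
    also have "\<dots> = (LINT x:{s..t}|lborel. rc x * \<zeta> x * g x) - (LINT x:{s..t}|lborel. rc x * (c1 * U x + c2 * V x) * g x)"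
      by (rule set_integral_diff(2)[OF i\<zeta>[OF gc] int])
    also have "\<dots> = 0" using that c by auto
    finally show ?thesis .
  qed
  obtain f f1 where f: "qd I f f1 (\<lambda>x. k x + \<Lambda> * f x)"
    "\<And>x. a < x \<Longrightarrow> x \<le> s \<Longrightarrow> f x = 0" "\<And>x. a < x \<Longrightarrow> x \<le> s \<Longrightarrow> f1 x = 0"
    "\<And>x. t \<le> x \<Longrightarrow> x < b \<Longrightarrow> f x = 0" "\<And>x. t \<le> x \<Longrightarrow> x < b \<Longrightarrow> f1 x = 0"
  proof (rule patching[of s t k 0 0])
    show "L2w r I (trunc I k)" using kI tk by simp
    show "k x = 0" if "x \<in> I - {s..t}" for x by (rule k0[OF that])
  qed (use st ik in auto)
  have f0: "f x = 0" if "x \<in> I - {s..t}" for x using that f(2)[of x] f(4)[of x] by (cases "x \<le> s") auto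
  have fc: "continuous_on {s..t} f" using qd_sys_continuous(1)[OF f(1) interval_Ioo] sub by (rule continuous_on_subset)
  define F where "F = trunc {s..t} f"
  have FL: "L2w r I F" unfolding F_def by (intro L2w_compact_support L2w_continuous_Icc st fc)
  define H where "H x = k x + \<Lambda> * F x" for x
  have HL: "L2w r I H" using WI.L2w_combine[OF kI FL, of 1 "\<Lambda>"] by (simp add: H_def[abs_def])
  have Ff: "F x = f x" if "x \<in> I" for x using f0[of x] that by (auto simp: F_def trunc_def)
  have "qd I F f1 H"
    using f(1) qd_sys_cong[OF interval_Ioo, where f=F and g=f and h=H, OF Ff] by (simp add: H_def Ff)
  moreover have "\<forall>x\<in>I - {s..t}. F x = 0" by (auto simp: F_def trunc_def)
  moreover have "s \<le> t" using st by simp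
  ultimately have "(F, H) \<in> T0 p q r a b"
    unfolding T0_def using FL HL st(1,3) aeq_refl[of I F] by blast
  from orth[OF this] have e1: "ipw r I H w = ipw r I F z" .
  have e2: "ipw r I H w = ipw r I k w + \<Lambda> * ipw r I F w"
    using WI.ipw_combine_left[OF kI FL w, of 1 "\<Lambda>"] by (simp add: H_def[abs_def])
  have e3: "ipw r I F \<kappa> = ipw r I F z - \<Lambda> * ipw r I F w"
    using WI.ipw_combine_right[OF z w FL, of 1 "- \<Lambda>"] by (simp add: \<kappa>_def[abs_def])
  \<comment> \<open>The adjoint relation for \<open>(F, H)\<close>, with the terms containing
    \<open>lam0\<close> cancelled. The Lagrange identity for \<open>f\<close> and \<open>y\<close>
    on \<open>{s..t}\<close>, where \<open>f\<close> and \<open>f1\<close> vanish at both ends,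
    gives \<open>y\<close> the same pairing with \<open>k\<close> as \<open>w\<close>.\<close>
  have kw: "ipw r I k w = ipw r I F \<kappa>"
    unfolding e3 e1[symmetric] e2 by simp
  have kw1: "ipw r I k w = (LINT x:{s..t}|lborel. rc x * k x * cnj (w x))"
    unfolding ipw_def using k0 by (intro set_integral_restrict sub) auto
  have Fk1: "ipw r I F \<kappa> = (LINT x:{s..t}|lborel. rc x * f x * cnj (\<kappa> x))"
    unfolding ipw_def using f0 Ff sub
    by (subst set_integral_restrict[OF sub]) (auto intro!: set_lebesgue_integral_cong simp: subset_eq)
  have sI: "s \<in> I" "t \<in> I" using st by auto
  have "ac_rep I (\<lambda>x. f x * cnj (y1 x) - f1 x * cnj (y x))
     (\<lambda>x. rc x * ((k x + \<Lambda> * f x) * cnj (y x) - f x * cnj (z x - \<Lambda> * w x + \<Lambda> * y x)))"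
    by (rule lagrange_identity[OF f(1) qd_sys_cnj[OF yq] interval_Ioo])
  then have ac: "ac_rep I (\<lambda>x. f x * cnj (y1 x) - f1 x * cnj (y x))
     (\<lambda>x. rc x * k x * cnj (y x) - rc x * f x * cnj (\<kappa> x))"
    by (simp add: \<kappa>_def algebra_simps)
  have iky: "set_integrable lborel {s..t} (\<lambda>x. rc x * k x * cnj (y x))"
    by (rule integrable_mult_local[OF st(1,3)]) (use kI tk cc(3) in \<open>auto intro: continuous_intros\<close>)
  have ifk: "set_integrable lborel {s..t} (\<lambda>x. rc x * f x * cnj (\<kappa> x))"
  proof -
    have "set_integrable lborel {s..t} (\<lambda>x. rc x * F x * cnj (\<kappa> x))"
      by (rule W.ipw_integrable[OF L2w_mono[OF FL sub] L2w_mono[OF \<kappa> sub]]) auto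
    also have "?this \<longleftrightarrow> ?thesis" using Ff sub by (intro set_integrable_cong) auto
    finally show ?thesis .
  qed
  have "(LINT x:{s..t}|lborel. rc x * k x * cnj (y x) - rc x * f x * cnj (\<kappa> x)) = 0"
    using ac_repD(2)[OF ac sI] st f(2)[of s] f(3)[of s] f(4)[of t] f(5)[of t] by simp
  then have "(LINT x:{s..t}|lborel. rc x * k x * cnj (y x)) = (LINT x:{s..t}|lborel. rc x * f x * cnj (\<kappa> x))"
    by (simp only: set_integral_diff(2)[OF iky ifk] right_minus_eq)
  then have ky: "(LINT x:{s..t}|lborel. rc x * k x * cnj (w x)) = (LINT x:{s..t}|lborel. rc x * k x * cnj (y x))"
    using kw kw1 Fk1 by simp
  have ikw: "set_integrable lborel {s..t} (\<lambda>x. rc x * k x * cnj (w x))"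
    by (rule W.ipw_integrable[OF kst L2w_mono[OF w sub]]) auto
  have ikU: "set_integrable lborel {s..t} (\<lambda>x. rc x * k x * U x)"
    "set_integrable lborel {s..t} (\<lambda>x. rc x * k x * V x)"
    by (rule integrable_mult_local[OF st(1,3)]; use kI tk cc in simp)+
  \<comment> \<open>\<open>k\<close> is orthogonal to \<open>w - y\<close> and to \<open>U\<close>
    and \<open>V\<close>, hence to itself.\<close>
  have "ipw r {s..t} k k = (LINT x:{s..t}|lborel. (rc x * k x * cnj (w x) - rc x * k x * cnj (y x))
      - (cnj c1 * (rc x * k x * U x) + cnj c2 * (rc x * k x * V x)))"
    unfolding ipw_def
  proof (intro set_lebesgue_integral_cong allI impI)
    fix x assume x: "x \<in> {s..t}"
    have "cnj (k x) = cnj (w x) - cnj (y x) - (cnj c1 * U x + cnj c2 * V x)" unfolding kdef'[OF x] \<zeta>_def by simp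
    then have "rc x * k x * cnj (k x) = rc x * k x * (cnj (w x) - cnj (y x) - (cnj c1 * U x + cnj c2 * V x))"
      by (simp only:)
    also have "\<dots> = (rc x * k x * cnj (w x) - rc x * k x * cnj (y x))
      - (cnj c1 * (rc x * k x * U x) + cnj c2 * (rc x * k x * V x))"
      by (simp add: algebra_simps)
    finally show "rc x * k x * cnj (k x) = (rc x * k x * cnj (w x) - rc x * k x * cnj (y x))
      - (cnj c1 * (rc x * k x * U x) + cnj c2 * (rc x * k x * V x))" .
  qed simp
  also have "\<dots> = 0"
    using iky ikw ikU ky ik[of "\<lambda>x. U x"] ik[of "\<lambda>x. V x"] by simp
  finally have "aeq {s..t} k (\<lambda>x. 0)" by (rule W.ipw_self_zero_imp[OF kst])
  then have "AE x in lborel. x \<in> {s..t} \<longrightarrow> w x - y x = c1 * U x + c2 * V x"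
    unfolding aeq_def by eventually_elim (auto simp: kdef' \<zeta>_def)
  then show ?thesis by (rule that)
qed

text \<open>Variation of constants supplies a locally absolutely continuous \<open>y\<close> for the
  right hand side of \<open>w\<close>. On compact intervals \<open>w - y\<close> is a combination of
  \<open>U\<close> and \<open>V\<close>; since its coefficients do not depend on the interval,
  adding it to \<open>y\<close> represents \<open>w\<close> on all of \<open>I\<close>.\<close>

lemma adj_T0_subset_Tmax: "adjw r I (T0 p q r a b) \<subseteq> Tmax p q r a b"
proof
  fix wz assume "wz \<in> adjw r I (T0 p q r a b)"
  then obtain w z where wz: "wz = (w, z)" "(w, z) \<in> adjw r I (T0 p q r a b)" by (cases wz) auto
  have w: "L2w r I w" and z: "L2w r I z" using wz(2) unfolding adjw_def by auto
  have [measurable]: "w \<in> borel_measurable borel" "z \<in> borel_measurable borel"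
    using w z WI.L2w_measurable by auto
  define \<kappa> where "\<kappa> x = z x - \<Lambda> * w x" for x
  have \<kappa>: "L2w r I \<kappa>" using WI.L2w_combine[OF z w, of 1 "- \<Lambda>"] by (simp add: \<kappa>_def[abs_def])
  have t\<kappa>: "L2w r I (trunc I \<kappa>)" using \<kappa> L2w_trunc_iff[OF WI.weighted_L2_axioms WI.L2w_measurable[OF \<kappa>]] by simp
  have c: "(a + b) / 2 \<in> I" using ab by auto
  have int: "set_integrable lborel {l..m} (\<lambda>x. rc x * \<kappa> x * g x)"
    if "l \<in> I" "m \<in> I" "continuous_on I g" for l m g
    using that by (intro integrable_mult_local t\<kappa> continuous_on_subset[OF that(3)]) auto
  have "\<exists>A. ac_rep I A (\<lambda>x. - 1 * (rc x * \<kappa> x * V x)) \<and> A ((a + b) / 2) = 0"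
    by (intro ac_rep_exists c set_integrable_mult_right int continuous_UV)
  then obtain A where A: "ac_rep I A (\<lambda>x. - (rc x * \<kappa> x * V x))" by auto
  have "\<exists>B. ac_rep I B (\<lambda>x. rc x * \<kappa> x * U x) \<and> B ((a + b) / 2) = 0"
    by (intro ac_rep_exists c int continuous_UV)
  then obtain B where B: "ac_rep I B (\<lambda>x. rc x * \<kappa> x * U x)" by auto
  define y where "y x = A x * U x + B x * V x" for x
  define y1 where "y1 x = A x * U1 x + B x * V1 x" for x
  have yq: "qd I y y1 (\<lambda>x. z x - \<Lambda> * w x + \<Lambda> * y x)"
    using variation_of_constants[OF interval_Ioo subset_refl A B] unfolding y_def y1_def \<kappa>_def .
  note range = orthogonal_range[OF wz(2) _ _ _ yq]
  \<comment> \<open>The offset 3 makes the intervals nondegenerate already for \<open>n = 0\<close>.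
    All contain \<open>{s 0..t 0}\<close>, where the coefficients are compared.\<close>
  define s where "s n = a + (b - a) / (real n + 3)" for n :: nat
  define t where "t n = b - (b - a) / (real n + 3)" for n :: nat
  have st: "a < s n" "s n < t n" "t n < b" for n
  proof -
    have "(b - a) / (real n + 3) \<le> (b - a) / 3" using ab by (intro divide_left_mono) auto
    moreover have "0 < (b - a) / (real n + 3)" using ab by (intro divide_pos_pos) auto
    moreover define \<delta> where "\<delta> = (b - a) / (real n + 3)"
    ultimately have "0 < \<delta>" "\<delta> \<le> (b - a) / 3" by simp_all
    then show "a < s n" "s n < t n" "t n < b" using ab unfolding s_def t_def \<delta>_def[symmetric] by auto
  qed
  have mono: "s n \<le> s 0" "t 0 \<le> t n" for n
  proof -
    have "(b - a) / (real n + 3) \<le> (b - a) / 3" using ab by (intro divide_left_mono) auto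
    then show "s n \<le> s 0" "t 0 \<le> t n" unfolding s_def t_def by auto
  qed
  obtain c1 c2 where c0: "AE x in lborel. x \<in> {s 0..t 0} \<longrightarrow> w x - y x = c1 * U x + c2 * V x"
    using range[OF st] by blast
  have "AE x in lborel. x \<in> {s n..t n} \<longrightarrow> w x - y x = c1 * U x + c2 * V x" for n
  proof -
    obtain d1 d2 where d: "AE x in lborel. x \<in> {s n..t n} \<longrightarrow> w x - y x = d1 * U x + d2 * V x"
      using range[OF st] by blast
    have "AE x in lborel. x \<in> {s 0..t 0} \<longrightarrow> d1 * U x + d2 * V x = c1 * U x + c2 * V x"
      using d c0 by eventually_elim (use mono[of n] in auto)
    then have "d1 = c1 \<and> d2 = c2" by (rule comb_AE_unique[OF st])
    then show ?thesis using d by simp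
  qed
  then have "AE x in lborel. \<forall>n. x \<in> {s n..t n} \<longrightarrow> w x - y x = c1 * U x + c2 * V x"
    by (simp only: AE_all_countable simp_thms)
  moreover have "\<exists>n. x \<in> {s n..t n}" if x: "x \<in> I" for x
  proof -
    define \<delta> where "\<delta> = min (x - a) (b - x)"
    have \<delta>: "0 < \<delta>" "\<delta> \<le> x - a" "\<delta> \<le> b - x" using x by (auto simp: \<delta>_def)
    obtain n :: nat where n: "(b - a) / \<delta> < real n" using reals_Archimedean2 by blast
    then have "b - a < real n * \<delta>" using \<delta>(1) by (simp add: pos_divide_less_eq)
    also have "\<dots> \<le> \<delta> * (real n + 3)" using \<delta>(1) by (simp add: algebra_simps)
    finally have "(b - a) / (real n + 3) \<le> \<delta>" by (simp add: pos_divide_le_eq)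
    with \<delta> show ?thesis by (intro exI[of _ n]) (auto simp: s_def t_def)
  qed
  ultimately have ae: "AE x in lborel. x \<in> I \<longrightarrow> w x - y x = c1 * U x + c2 * V x"
    by (elim eventually_mono) blast
  define g where "g x = y x + (c1 * U x + c2 * V x)" for x
  define g1 where "g1 x = y1 x + (c1 * U1 x + c2 * V1 x)" for x
  have wg: "aeq I w g" using ae unfolding aeq_def g_def by eventually_elim (auto simp: algebra_simps)
  have gq: "qd I g g1 (\<lambda>x. \<kappa> x + \<Lambda> * g x)"
    using qd_sys_combine[OF yq qd_sys_combine[OF U_qd V_qd, of c1 c2], of 1 1]
    by (simp add: g_def[abs_def] g1_def[abs_def] \<kappa>_def algebra_simps)
  have gm: "trunc I g \<in> borel_measurable borel"
    using measurable_trunc_continuous[OF qd_sys_continuous(1)[OF gq interval_Ioo]] by simp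
  have "qd I g g1 z"
  proof (rule qd_cong_AE[OF interval_Ioo gq])
    show "aeq I (\<lambda>x. \<kappa> x + \<Lambda> * g x) z"
      using wg unfolding aeq_def by eventually_elim (auto simp: \<kappa>_def)
    have "trunc I (\<lambda>x. \<kappa> x + \<Lambda> * g x) = (\<lambda>x. trunc I \<kappa> x + \<Lambda> * trunc I g x)"
      by (auto simp: trunc_def)
    moreover have "trunc I \<kappa> \<in> borel_measurable borel" using t\<kappa> WI.L2w_measurable by blast
    ultimately show "trunc I (\<lambda>x. \<kappa> x + \<Lambda> * g x) \<in> borel_measurable borel" using gm by simp
  qed measurable
  then show "wz \<in> Tmax p q r a b" unfolding Tmax_def wz(1) using w z wg by blast
qed

end

section \<open>Boundary conditions that split under the reflection\<close>

abbreviation bcond :: "real \<Rightarrow> complex \<Rightarrow> complex \<Rightarrow> bool" where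
  "bcond \<alpha> x y \<equiv> complex_of_real (cos \<alpha>) * x + complex_of_real (sin \<alpha>) * y = 0"

text \<open>The line is spanned by the real unit vector
  \<open>(sin \<alpha>, - cos \<alpha>)\<close>, and \<open>t\<close> is the component along
  it.\<close>

lemma bc_parametrize:
  fixes x y :: complex
  assumes "bcond \<alpha> x y"
  obtains t where "x = complex_of_real (sin \<alpha>) * t" "y = - complex_of_real (cos \<alpha>) * t"
proof -
  let ?c = "complex_of_real (cos \<alpha>)" and ?s = "complex_of_real (sin \<alpha>)"
  have cs: "?s * ?s + ?c * ?c = 1"
    by (metis of_real_1 of_real_add of_real_mult power2_eq_square sin_cos_squared_add)
  have cx: "?c * x = - (?s * y)"
    unfolding eq_neg_iff_add_eq_0 by (rule assms)
  then have sy: "?s * y = - (?c * x)" by simp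
  have "?s * (?s * x - ?c * y) = ?s * ?s * x - ?c * (?s * y)" by (simp add: algebra_simps)
  also have "\<dots> = (?s * ?s + ?c * ?c) * x" unfolding sy by (simp add: algebra_simps)
  finally have 1: "x = ?s * (?s * x - ?c * y)" using cs by simp
  have "- ?c * (?s * x - ?c * y) = - ?s * (?c * x) + ?c * ?c * y" by (simp add: algebra_simps)
  also have "\<dots> = (?s * ?s + ?c * ?c) * y" unfolding cx by (simp add: algebra_simps)
  finally have 2: "y = - ?c * (?s * x - ?c * y)" using cs by simp
  show ?thesis by (rule that[OF 1 2])
qed

lemma sform_bc_zero:
  assumes "bcond \<alpha> x y"
    "bcond \<alpha> x' y'"
  shows "sform x y x' y' = 0"
proof -
  obtain t where "x = complex_of_real (sin \<alpha>) * t" "y = - complex_of_real (cos \<alpha>) * t"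
    by (rule bc_parametrize[OF assms(1)])
  moreover obtain t' where "x' = complex_of_real (sin \<alpha>) * t'" "y' = - complex_of_real (cos \<alpha>) * t'"
    by (rule bc_parametrize[OF assms(2)])
  ultimately show ?thesis by (simp add: sform_def)
qed

text \<open>\<open>W\<close> need not be known to be a subspace. Without a nonzero vector in
  \<open>W\<close>, \<open>max\<close> would force every vector into it. A nonzero vector paired
  with itself shows that its components have a real ratio, which gives the angle; pairing with this
  vector puts all of \<open>W\<close> on the line, and \<open>max\<close> fills the line.\<close>

lemma lagrangian_line:
  assumes iso: "\<And>x y x' y'. (x, y) \<in> W \<Longrightarrow> (x', y') \<in> W \<Longrightarrow> sform x y x' y' = 0"
    and max: "\<And>x y. (\<And>x' y'. (x', y') \<in> W \<Longrightarrow> sform x y x' y' = 0) \<Longrightarrow> (x, y) \<in> W"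
  shows "\<exists>\<alpha>\<in>{0<..pi}. \<forall>x y. (x, y) \<in> W \<longleftrightarrow> bcond \<alpha> x y"
proof -
  have "\<exists>x y. (x, y) \<in> W \<and> (x, y) \<noteq> (0, 0)"
  proof (rule ccontr)
    assume "\<not> ?thesis"
    then have z: "x = 0 \<and> y = 0" if "(x, y) \<in> W" for x y using that by blast
    have "(1, 0) \<in> W" by (rule max) (use z in \<open>force simp: sform_def\<close>)
    then show False using z by fastforce
  qed
  then obtain x y where xy: "(x, y) \<in> W" "x \<noteq> 0 \<or> y \<noteq> 0" by auto
  have real: "x * cnj y = y * cnj x" using iso[OF xy(1,1)] by (simp add: sform_def)
  obtain \<alpha> where \<alpha>: "\<alpha> \<in> {0<..pi}" and bc: "bcond \<alpha> x y"
  proof (cases "x = 0")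
    case True
    then show ?thesis using that[of pi] by simp
  next
    case False
    define \<rho> where "\<rho> = Re (y / x)"
    have "cnj (y / x) = y / x" using real False by (simp add: field_simps)
    then have "y / x = complex_of_real \<rho>" unfolding \<rho>_def by (metis Reals_cnj_iff of_real_Re)
    then have y: "y = complex_of_real \<rho> * x" using False by (simp add: field_simps)
    \<comment> \<open>The angle is \<open>pi / 2 + arctan \<rho>\<close>, with cotangent
      \<open>- \<rho>\<close>. The value \<open>pi\<close> is reserved for
      \<open>x = 0\<close>.\<close>
    define \<theta> where "\<theta> = arctan (- \<rho>)"
    have \<theta>: "- (pi / 2) < \<theta>" "\<theta> < pi / 2" unfolding \<theta>_def using arctan_bounded by auto
    then have "cos \<theta> \<noteq> 0" using cos_gt_zero_pi[of \<theta>] by auto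
    moreover have "tan \<theta> = - \<rho>" unfolding \<theta>_def by (rule tan_arctan)
    ultimately have "sin \<theta> = - \<rho> * cos \<theta>" by (simp add: tan_def field_simps)
    then have eq: "cos (pi / 2 - \<theta>) + sin (pi / 2 - \<theta>) * \<rho> = 0" by (simp add: cos_diff sin_diff)
    have "complex_of_real (cos (pi / 2 - \<theta>)) * x + complex_of_real (sin (pi / 2 - \<theta>)) * y
      = complex_of_real (cos (pi / 2 - \<theta>) + sin (pi / 2 - \<theta>) * \<rho>) * x"
      unfolding y of_real_add of_real_mult by (simp add: algebra_simps)
    also have "\<dots> = 0" unfolding eq by simp
    finally show ?thesis using that[of "pi / 2 - \<theta>"] \<theta> by auto
  qed
  let ?c = "complex_of_real (cos \<alpha>)" and ?s = "complex_of_real (sin \<alpha>)"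
  obtain t where t: "x = ?s * t" "y = - ?c * t" by (rule bc_parametrize[OF bc])
  have t0: "t \<noteq> 0" using t xy(2) by auto
  have bcW: "?c * x' + ?s * y' = 0" if "(x', y') \<in> W" for x' y'
  proof -
    have "cnj t * (?c * x' + ?s * y') = - sform x' y' x y" unfolding t sform_def by (simp add: algebra_simps)
    then show ?thesis using iso[OF that xy(1)] t0 by simp
  qed
  have "(x', y') \<in> W \<longleftrightarrow> ?c * x' + ?s * y' = 0" for x' y'
    using bcW max sform_bc_zero by blast
  with \<alpha> show ?thesis by blast
qed

section \<open>Extensions with one angle on the odd and one on the even part\<close>

context sl_problem
begin

abbreviation "Xo g g1 \<equiv> X g g1 - Xm g g1"
abbreviation "Yo g g1 \<equiv> Y g g1 - Ym g g1"
abbreviation "Xe g g1 \<equiv> X g g1 + Xm g g1"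
abbreviation "Ye g g1 \<equiv> Y g g1 + Ym g g1"

lemma XYm_combine:
  assumes "tpair g g1 h" "tpair k k1 l"
  shows "Xm (\<lambda>x. c * g x + d * k x) (\<lambda>x. c * g1 x + d * k1 x) = c * Xm g g1 + d * Xm k k1"
    "Ym (\<lambda>x. c * g x + d * k x) (\<lambda>x. c * g1 x + d * k1 x) = c * Ym g g1 + d * Ym k k1"
proof -
  have e: "(\<lambda>x. - (c * mirror g1 x + d * mirror k1 x)) = (\<lambda>x. c * (- mirror g1 x) + d * (- mirror k1 x))"
    by (simp add: fun_eq_iff)
  show "Xm (\<lambda>x. c * g x + d * k x) (\<lambda>x. c * g1 x + d * k1 x) = c * Xm g g1 + d * Xm k k1"
    "Ym (\<lambda>x. c * g x + d * k x) (\<lambda>x. c * g1 x + d * k1 x) = c * Ym g g1 + d * Ym k k1"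
    unfolding mirror_combine e
    by (rule XY_combine[OF tpair_adm[OF tpair_mirror[OF assms(1)]] tpair_adm[OF tpair_mirror[OF assms(2)]]])+
qed

lemma XYm_mirror: "Xm (mirror g) (\<lambda>x. - mirror g1 x) = X g g1" "Ym (mirror g) (\<lambda>x. - mirror g1 x) = Y g g1"
proof -
  have "(\<lambda>x. - mirror (\<lambda>x. - mirror g1 x) x) = g1" by (simp add: mirror_def)
  then show "Xm (mirror g) (\<lambda>x. - mirror g1 x) = X g g1" "Ym (mirror g) (\<lambda>x. - mirror g1 x) = Y g g1"
    by (simp_all add: mirror_mirror)
qed

text \<open>Add a function that vanishes near \<open>b\<close> and the mirror image of another such
  function: the values at the two ends then do not interfere.\<close>

lemma bv_surj_all:
  obtains g g1 h where "tpair g g1 h" "X g g1 = x" "Y g g1 = y" "Xm g g1 = x'" "Ym g g1 = y'"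
proof -
  obtain g g1 h where g: "tpair g g1 h" "X g g1 = x" "Y g g1 = y" "Xm g g1 = 0" "Ym g g1 = 0"
    by (rule bv_surj)
  obtain k k1 l where k: "tpair k k1 l" "X k k1 = x'" "Y k k1 = y'" "Xm k k1 = 0" "Ym k k1 = 0"
    by (rule bv_surj)
  note mk = tpair_mirror[OF k(1)]
  note bv = XY_combine[OF tpair_adm[OF g(1)] tpair_adm[OF mk], of 1 1] XYm_combine[OF g(1) mk, of 1 1]
  show ?thesis
    by (rule that[OF tpair_combine[OF g(1) mk, of 1 1]]; unfold bv XYm_mirror g(2-5) k(2-5)) simp_all
qed

lemma tpair_trunc:
  assumes "tpair g g1 h"
  shows "tpair g g1 (trunc I h)"
proof -
  have "trunc I (trunc I h) = trunc I h" by (simp add: trunc_def fun_eq_iff)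
  moreover have "qd I g g1 (trunc I h) \<longleftrightarrow> qd I g g1 h"
    by (rule qd_sys_cong[OF interval_Ioo]) simp_all
  ultimately show ?thesis using assms unfolding tpair_def by (simp only:)
qed

text \<open>The normal form to which \<open>Tab\<close>, \<open>TetaR\<close> and every commuting
  self-adjoint extension are reduced, so that self-adjointness and the unitary equivalence are
  proved once.\<close>

definition split_ext :: "real \<Rightarrow> real \<Rightarrow> ((real \<Rightarrow> complex) \<times> (real \<Rightarrow> complex)) set" where
  "split_ext \<alpha> \<alpha>' = {(f, h). L2w r I f \<and> L2w r I h \<and> (\<exists>g g1. aeq I f g \<and> tpair g g1 h \<and>
     bcond \<alpha> (Xo g g1) (Yo g g1) \<and>
     bcond \<alpha>' (Xe g g1) (Ye g g1))}"

text \<open>Passing from the values of \<open>g\<close> and its mirror image to their difference and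
  sum doubles the total form, hence the factor \<open>1 / 2\<close>.\<close>

lemma ipw_green:
  assumes "L2w r I f" "aeq I f g" "tpair g g1 h" "L2w r I h"
    and "L2w r I f'" "aeq I f' k" "tpair k k1 l" "L2w r I l"
  shows "ipw r I h f' - ipw r I f l = - (1 / 2) *
    (sform (Xo g g1) (Yo g g1) (Xo k k1) (Yo k k1) +
     sform (Xe g g1) (Ye g g1) (Xe k k1) (Ye k k1))"
proof -
  have Lg: "L2w r I (trunc I g)" and Lk: "L2w r I (trunc I k)" using assms unfolding tpair_def by auto
  have "ipw r I h f' = ipw r I h (trunc I k)" "ipw r I f l = ipw r I (trunc I g) l"
    using assms Lg Lk WI.L2w_measurable aeq_refl aeq_trans aeq_trunc by (auto intro!: WI.ipw_cong_AE)
  then have "ipw r I h f' - ipw r I f l =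
     (LINT x:I|lborel. rc x * h x * cnj (trunc I k x) - rc x * trunc I g x * cnj (l x))"
    using WI.ipw_integrable[OF assms(4) Lk] WI.ipw_integrable[OF Lg assms(8)] by (simp add: ipw_def)
  also have "\<dots> = (LINT x:I|lborel. rc x * (h x * cnj (k x) - g x * cnj (l x)))"
    by (intro set_lebesgue_integral_cong) (auto simp: algebra_simps)
  also have "\<dots> = - (sform (X g g1) (Y g g1) (X k k1) (Y k k1) + sform (Xm g g1) (Ym g g1) (Xm k k1) (Ym k k1))"
    by (rule green[OF assms(3,7)])
  finally show ?thesis by (simp add: sform_def algebra_simps)
qed

text \<open>On an interval where \<open>g\<close> vanishes, \<open>cnj g1 * g\<close> vanishes and has derivative \<open>\<bar>g1\<bar>\<^sup>2 / p\<close>.\<close>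

lemma quasi_derivative_zero:
  assumes g: "qd I g g1 h" and st: "a < s" "s < t" "t < b" and z: "\<And>x. x \<in> {s..t} \<Longrightarrow> g x = 0"
  obtains x where "s < x" "x < t" "g1 x = 0"
proof -
  have sub: "{s..t} \<subseteq> I" using st by auto
  have int: "is_interval {s..t}" by (simp add: is_interval_1)
  have gc: "ac_rep I g (\<lambda>x. g1 x / p x)" and gc1: "ac_rep I (\<lambda>x. cnj (g1 x)) (\<lambda>x. cnj (q x * g x - r x * h x))"
    using g ac_rep_cnj[of I g1] unfolding qd_sys_def by blast+
  have "ac_rep {s..t} (\<lambda>x. cnj (g1 x) * g x) (\<lambda>x. cnj (q x * g x - r x * h x) * g x + cnj (g1 x) * (g1 x / p x))"
    by (rule ac_rep_mono[OF ac_rep_mult[OF gc1 gc interval_Ioo] sub])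
  also have "?this \<longleftrightarrow> ac_rep {s..t} (\<lambda>x. 0) (\<lambda>x. complex_of_real ((cmod (g1 x))^2 / p x))"
  proof (rule ac_rep_cong[OF int])
    fix x assume x: "x \<in> {s..t}"
    show "cnj (g1 x) * g x = 0" using z[OF x] by simp
    have "cnj (g1 x) * g1 x = complex_of_real ((cmod (g1 x))^2)"
      using complex_norm_square[of "g1 x"] by (simp add: mult.commute)
    then show "cnj (q x * g x - r x * h x) * g x + cnj (g1 x) * (g1 x / p x) = complex_of_real ((cmod (g1 x))^2 / p x)"
      using z[OF x] by (simp del: of_real_power)
  qed
  finally have ac: "ac_rep {s..t} (\<lambda>x. 0) (\<lambda>x. complex_of_real ((cmod (g1 x))^2 / p x))" .
  have "set_integrable lborel {s..t} (\<lambda>x. (cmod (g1 x))^2 / p x)" "(LINT x:{s..t}|lborel. (cmod (g1 x))^2 / p x) = 0"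
    using ac_repD[OF ac, of s t] st
    by (simp_all add: set_integrable_complex_of_real set_integral_complex_of_real del: of_real_power of_real_divide)
  moreover have "AE x in lborel. x \<in> {s..t} \<longrightarrow> 0 \<le> (cmod (g1 x))^2 / p x"
    using p_pos by eventually_elim (use sub in auto)
  ultimately have "AE x in lborel. x \<in> {s..t} \<longrightarrow> (cmod (g1 x))^2 / p x = 0"
    by (intro set_integral_zero_AE)
  then have "AE x in lborel. x \<in> {s..t} \<longrightarrow> g1 x = 0"
    using p_pos by eventually_elim (use sub in fastforce)
  then obtain x where "s < x" "x < t" "x \<in> {s..t} \<longrightarrow> g1 x = 0" by (rule AE_exists_Ioo[OF _ st(2)])
  then show ?thesis using that by auto
qed

text \<open>The limits exist because \<open>g\<close> is admissible. To show that they are 0, common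
  zeros of \<open>g\<close> and \<open>g1\<close> that accumulate at \<open>a\<close>
  suffice.\<close>

lemma XY_zero_near:
  assumes g: "tpair g g1 h" and s: "a < s" "s \<le> b" and z: "\<And>x. x \<in> {a<..<s} \<Longrightarrow> g x = 0"
  shows "X g g1 = 0" "Y g g1 = 0"
proof -
  have pt: "\<exists>x\<in>{a<..<e}. g x = 0 \<and> g1 x = 0" if e: "a < e" for e
  proof -
    define m where "m = min e s"
    have m: "a < m" "m \<le> s" "m \<le> e" using e s by (auto simp: m_def)
    obtain x where "(2 * a + m) / 3 < x" "x < (a + 2 * m) / 3" "g1 x = 0"
    proof (rule quasi_derivative_zero[of g g1 h "(2 * a + m) / 3" "(a + 2 * m) / 3"])
      show "qd I g g1 h" using g unfolding tpair_def by simp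
      show "g x = 0" if "x \<in> {(2 * a + m) / 3..(a + 2 * m) / 3}" for x
        using that m by (intro z) (auto simp: field_simps)
    qed (use m s in \<open>auto simp: field_simps\<close>)
    moreover have "x \<in> {a<..<m}" using calculation m by (auto simp: field_simps)
    ultimately show ?thesis using m z by (intro bexI[of _ x]) auto
  qed
  have L0: "L = 0" if "(\<phi> \<longlongrightarrow> L) (at_right a)" "\<And>x. g x = 0 \<Longrightarrow> g1 x = 0 \<Longrightarrow> \<phi> x = 0" for \<phi> :: "real \<Rightarrow> complex" and L
  proof (rule ccontr)
    assume "L \<noteq> 0"
    then have "eventually (\<lambda>x. \<phi> x \<noteq> 0) (at_right a)" by (rule tendsto_imp_eventually_ne[OF that(1)])
    then obtain e where e: "a < e" "\<And>y. a < y \<Longrightarrow> y < e \<Longrightarrow> \<phi> y \<noteq> 0" unfolding eventually_at_right_field by blast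
    obtain x where x: "x \<in> {a<..<e}" "g x = 0" "g1 x = 0" using pt[OF e(1)] by blast
    then show False using e(2)[of x] that(2)[OF x(2,3)] by simp
  qed
  have "- X g g1 = 0" by (rule L0[OF X_tendsto[OF tpair_adm[OF g]]]) simp
  then show "X g g1 = 0" by simp
  show "Y g g1 = 0" by (rule L0[OF Y_tendsto[OF tpair_adm[OF g]]]) simp
qed

lemma T0_rep:
  assumes "(f, h) \<in> T0 p q r a b"
  obtains g g1 where "L2w r I f" "L2w r I h" "aeq I f g" "tpair g g1 h" "X g g1 = 0" "Y g g1 = 0" "Xm g g1 = 0" "Ym g g1 = 0"
proof -
  obtain g g1 s t where g: "L2w r I f" "L2w r I h" "aeq I f g" "qd I g g1 h" "a < s" "s \<le> t" "t < b"
    "\<And>x. x \<in> I - {s..t} \<Longrightarrow> g x = 0"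
    using assms unfolding T0_def by auto
  have tp: "tpair g g1 h"
    unfolding tpair_def using g L2w_trunc[OF WI.weighted_L2_axioms g(1,3) qd_sys_continuous(1)[OF g(4) interval_Ioo]]
      L2w_trunc_iff[OF WI.weighted_L2_axioms WI.L2w_measurable[OF g(2)]] by blast
  have "X g g1 = 0" "Y g g1 = 0" by (rule XY_zero_near[OF tp, of s]; use g(5-8) in auto)+
  moreover have "Xm g g1 = 0" "Ym g g1 = 0"
    by (rule XY_zero_near[OF tpair_mirror[OF tp], of "a + b - t"]; use g(5-8) in \<open>auto simp: mirror_def\<close>)+
  ultimately show ?thesis using that g tp by blast
qed

lemma T0_subset_split_ext: "T0 p q r a b \<subseteq> split_ext \<alpha> \<alpha>'"
proof
  fix fh assume "fh \<in> T0 p q r a b"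
  then obtain f h where fh: "fh = (f, h)" "(f, h) \<in> T0 p q r a b" by (cases fh) auto
  obtain g g1 where "L2w r I f" "L2w r I h" "aeq I f g" "tpair g g1 h" "X g g1 = 0" "Y g g1 = 0" "Xm g g1 = 0" "Ym g g1 = 0"
    by (rule T0_rep[OF fh(2)])
  then show "fh \<in> split_ext \<alpha> \<alpha>'" unfolding split_ext_def fh(1) by force
qed

lemma adjw_anti: "S \<subseteq> T \<Longrightarrow> adjw r I T \<subseteq> adjw r I S"
  unfolding adjw_def by blast

text \<open>One inclusion is isotropy of the two lines. For the other, the adjoint lies in the
  maximal operator, and test functions with arbitrary boundary values on the two lines force its
  boundary values onto them.\<close>

lemma split_ext_selfadjoint: "split_ext \<alpha> \<alpha>' = adjw r I (split_ext \<alpha> \<alpha>')"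
proof
  show "split_ext \<alpha> \<alpha>' \<subseteq> adjw r I (split_ext \<alpha> \<alpha>')"
  proof
    fix kl assume "kl \<in> split_ext \<alpha> \<alpha>'"
    then obtain f' l k k1 where k: "kl = (f', l)" "L2w r I f'" "L2w r I l" "aeq I f' k" "tpair k k1 l"
     "bcond \<alpha> (Xo k k1) (Yo k k1)"
     "bcond \<alpha>' (Xe k k1) (Ye k k1)"
      unfolding split_ext_def by blast
    have "ipw r I h f' = ipw r I f l" if fh: "(f, h) \<in> split_ext \<alpha> \<alpha>'" for f h
    proof -
      obtain g g1 where g: "L2w r I f" "L2w r I h" "aeq I f g" "tpair g g1 h"
       "bcond \<alpha> (Xo g g1) (Yo g g1)"
       "bcond \<alpha>' (Xe g g1) (Ye g g1)"
        using fh unfolding split_ext_def by blast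
      have "ipw r I h f' - ipw r I f l = 0"
        unfolding ipw_green[OF g(1,3,4,2) k(2,4,5,3)] sform_bc_zero[OF g(5) k(6)] sform_bc_zero[OF g(6) k(7)] by simp
      then show ?thesis by simp
    qed
    then show "kl \<in> adjw r I (split_ext \<alpha> \<alpha>')" unfolding adjw_def k(1) using k(2,3) by auto
  qed
  show "adjw r I (split_ext \<alpha> \<alpha>') \<subseteq> split_ext \<alpha> \<alpha>'"
  proof
    fix kl assume kl: "kl \<in> adjw r I (split_ext \<alpha> \<alpha>')"
    then have "kl \<in> Tmax p q r a b" using adjw_anti[OF T0_subset_split_ext] adj_T0_subset_Tmax by blast
    then obtain f' l k k1 where k: "kl = (f', l)" "L2w r I f'" "L2w r I l" "aeq I f' k" "tpair k k1 l"
      using Tmax_iff by (cases kl) auto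
    have orth: "sform x y (Xo k k1) (Yo k k1) + sform x' y' (Xe k k1) (Ye k k1) = 0"
      if "bcond \<alpha> x y"
        "bcond \<alpha>' x' y'" for x y x' y'
    proof -
      \<comment> \<open>These values invert the passage to differences and sums, so
        \<open>(x, y)\<close> becomes the odd and \<open>(x', y')\<close> the even boundary
        data.\<close>
      obtain g g1 h where g: "tpair g g1 h" "X g g1 = (x + x') / 2" "Y g g1 = (y + y') / 2"
         "Xm g g1 = (x' - x) / 2" "Ym g g1 = (y' - y) / 2"
        by (rule bv_surj_all)
      have o: "X g g1 - Xm g g1 = x" "Y g g1 - Ym g g1 = y" "X g g1 + Xm g g1 = x'" "Y g g1 + Ym g g1 = y'"
        unfolding g(2-5) by (simp_all add: field_simps)
      have L: "L2w r I (trunc I g)" "L2w r I (trunc I h)" using g(1) unfolding tpair_def by auto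
      have ac: "tpair g g1 (trunc I h)" by (rule tpair_trunc[OF g(1)])
      have "(trunc I g, trunc I h) \<in> split_ext \<alpha> \<alpha>'"
        unfolding split_ext_def using L ac aeq_trunc(1)[of I g] that o by auto
      then have "ipw r I (trunc I h) f' = ipw r I (trunc I g) l" using kl unfolding k(1) adjw_def by auto
      then show ?thesis using ipw_green[OF L(1) aeq_trunc(1) ac L(2) k(2,4,5,3)] unfolding o by simp
    qed
    \<comment> \<open>Pairing with the spanning vector of the line reproduces the conjugate of the
      boundary condition, up to sign.\<close>
    have "sform (complex_of_real (sin \<alpha>)) (- complex_of_real (cos \<alpha>)) (Xo k k1) (Yo k k1) + sform 0 0 (Xe k k1) (Ye k k1) = 0"
      by (rule orth) simp_all
    then have "cnj (complex_of_real (cos \<alpha>) * (Xo k k1) + complex_of_real (sin \<alpha>) * (Yo k k1)) = 0"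
      by (simp add: sform_def algebra_simps)
    then have 1: "bcond \<alpha> (Xo k k1) (Yo k k1)"
      by (simp only: complex_cnj_zero_iff)
    have "sform 0 0 (Xo k k1) (Yo k k1) + sform (complex_of_real (sin \<alpha>')) (- complex_of_real (cos \<alpha>')) (Xe k k1) (Ye k k1) = 0"
      by (rule orth) simp_all
    then have "cnj (complex_of_real (cos \<alpha>') * (Xe k k1) + complex_of_real (sin \<alpha>') * (Ye k k1)) = 0"
      by (simp add: sform_def algebra_simps)
    then have 2: "bcond \<alpha>' (Xe k k1) (Ye k k1)"
      by (simp only: complex_cnj_zero_iff)
    show "kl \<in> split_ext \<alpha> \<alpha>'" unfolding split_ext_def k(1) using k 1 2 by blast
  qed
qed

text \<open>An adjoint is closed: its defining relation passes to norm limits because the inner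
  product is continuous.\<close>

lemma Tmin_subset_selfadjoint:
  assumes "T0 p q r a b \<subseteq> S" "S = adjw r I S"
  shows "Tmin p q r a b \<subseteq> S"
proof
  fix fh assume "fh \<in> Tmin p q r a b"
  then obtain f h F H where fh: "fh = (f, h)" "L2w r I f" "L2w r I h" "\<And>n. (F n, H n) \<in> T0 p q r a b"
    "(\<lambda>n. normw r I (\<lambda>x. F n x - f x)) \<longlonglongrightarrow> 0" "(\<lambda>n. normw r I (\<lambda>x. H n x - h x)) \<longlonglongrightarrow> 0"
    unfolding Tmin_def by blast
  have FL: "L2w r I (F n)" "L2w r I (H n)" for n using fh(4)[of n] unfolding T0_def by auto
  have "ipw r I l f = ipw r I k h" if kl: "(k, l) \<in> S" for k l
  proof -
    have L: "L2w r I k" "L2w r I l" using kl assms(2) unfolding adjw_def by auto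
    have "(\<lambda>n. ipw r I l (F n)) \<longlonglongrightarrow> ipw r I l f" by (rule WI.ipw_tendsto[OF FL(1) fh(2) L(2) fh(5)])
    moreover have "(\<lambda>n. ipw r I k (H n)) \<longlonglongrightarrow> ipw r I k h" by (rule WI.ipw_tendsto[OF FL(2) fh(3) L(1) fh(6)])
    moreover have "ipw r I l (F n) = ipw r I k (H n)" for n
    proof -
      have "(F n, H n) \<in> adjw r I S" using fh(4)[of n] assms by blast
      then show ?thesis using kl unfolding adjw_def by auto
    qed
    ultimately show ?thesis using LIMSEQ_unique by simp
  qed
  then have "fh \<in> adjw r I S" unfolding adjw_def fh(1) using fh(2,3) by auto
  then show "fh \<in> S" using assms(2) by simp
qed

lemma T0_subset_Tmin: "T0 p q r a b \<subseteq> Tmin p q r a b"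
proof
  fix fh assume fh: "fh \<in> T0 p q r a b"
  then obtain f h where eq: "fh = (f, h)" by (cases fh)
  have L: "L2w r I f" "L2w r I h" using fh unfolding eq T0_def by auto
  have "normw r I (\<lambda>x. k x - k x) = 0" for k by (simp add: normw_def)
  then have "\<exists>F H. (\<forall>n::nat. (F n, H n) \<in> T0 p q r a b) \<and> (\<lambda>n. normw r I (\<lambda>x. F n x - f x)) \<longlonglongrightarrow> 0 \<and>
      (\<lambda>n. normw r I (\<lambda>x. H n x - h x)) \<longlonglongrightarrow> 0"
    using fh[unfolded eq] by (intro exI[of _ "\<lambda>n. f"] exI[of _ "\<lambda>n. h"]) simp
  then show "fh \<in> Tmin p q r a b" unfolding Tmin_def eq using L by blast
qed

lemma split_ext_sa: "sa_ext p q r a b (split_ext \<alpha> \<alpha>')"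
  unfolding sa_ext_def
  using Tmin_subset_selfadjoint[OF T0_subset_split_ext split_ext_selfadjoint] split_ext_selfadjoint by blast

lemma split_ext_commP: "commP a b (split_ext \<alpha> \<alpha>')"
proof -
  have "(mirror f, mirror h) \<in> split_ext \<alpha> \<alpha>'" if fh: "(f, h) \<in> split_ext \<alpha> \<alpha>'" for f h
  proof -
    obtain g g1 where g: "L2w r I f" "L2w r I h" "aeq I f g" "tpair g g1 h"
       "bcond \<alpha> (Xo g g1) (Yo g g1)"
       "bcond \<alpha>' (Xe g g1) (Ye g g1)"
      using fh unfolding split_ext_def by blast
    have "complex_of_real (cos \<alpha>) * (Xm g g1 - X g g1) + complex_of_real (sin \<alpha>) * (Ym g g1 - Y g g1) =
      - (complex_of_real (cos \<alpha>) * (Xo g g1) + complex_of_real (sin \<alpha>) * (Yo g g1))"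
      by (simp add: algebra_simps)
    then have 1: "bcond \<alpha> (Xm g g1 - X g g1) (Ym g g1 - Y g g1)"
      unfolding g(5) by simp
    have 2: "bcond \<alpha>' (Xm g g1 + X g g1) (Ym g g1 + Y g g1)"
      using g(6) by (simp add: add.commute)
    note e1 = 1[folded XYm_mirror[of g g1]] and e2 = 2[folded XYm_mirror[of g g1]]
    show ?thesis unfolding split_ext_def
      using L2w_mirror[OF g(1)] L2w_mirror[OF g(2)] aeq_mirror[OF g(3)] tpair_mirror[OF g(4)] e1 e2 by blast
  qed
  then show ?thesis unfolding commP_def mirror_def by auto
qed

text \<open>Self-adjointness makes the set of boundary data of \<open>S\<close> maximal isotropic in
  four dimensions. Commutation with the reflection splits it into \<open>VO\<close> and
  \<open>VE\<close>, each maximal isotropic in two dimensions, to which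
  \<open>lagrangian_line\<close> applies.\<close>

lemma commuting_extension_split:
  assumes sa: "sa_ext p q r a b S" and comm: "commP a b S"
  obtains \<alpha> \<alpha>' where "\<alpha> \<in> {0<..pi}" "\<alpha>' \<in> {0<..pi}" "S = split_ext \<alpha> \<alpha>'"
proof -
  have S: "S = adjw r I S" and "Tmin p q r a b \<subseteq> S" using sa unfolding sa_ext_def by auto
  then have T0S: "T0 p q r a b \<subseteq> S" using T0_subset_Tmin by blast
  \<comment> \<open>Taking adjoints reverses \<open>T0 \<subseteq> S\<close>, and \<open>S\<close>
    is its own adjoint; so every element of \<open>S\<close> has a representative with boundary
    values.\<close>
  have Smax: "S \<subseteq> Tmax p q r a b" using adjw_anti[OF T0S] adj_T0_subset_Tmax S by blast
  define R where "R g g1 f h \<longleftrightarrow> (f, h) \<in> S \<and> aeq I f g \<and> tpair g g1 h" for g g1 f h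
  have RL: "L2w r I f" "L2w r I h" if "R g g1 f h" for g g1 f h
    using that S unfolding R_def adjw_def by auto
  have Rm: "R (mirror g) (\<lambda>x. - mirror g1 x) (mirror f) (mirror h)" if "R g g1 f h" for g g1 f h
    using that comm aeq_mirror tpair_mirror unfolding R_def commP_def mirror_def by auto
  have iso: "sform (Xo g g1) (Yo g g1) (Xo k k1) (Yo k k1) +
     sform (Xe g g1) (Ye g g1) (Xe k k1) (Ye k k1) = 0"
    if g: "R g g1 f h" and k: "R k k1 f' l" for g g1 f h k k1 f' l
  proof -
    have "(f', l) \<in> adjw r I S" using k S unfolding R_def by blast
    then have "ipw r I h f' - ipw r I f l = 0" using g unfolding R_def adjw_def by auto
    then show ?thesis
      using ipw_green[OF RL(1)[OF g] _ _ RL(2)[OF g] RL(1)[OF k] _ _ RL(2)[OF k]] g k unfolding R_def by simp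
  qed
  have iso2: "sform (Xo g g1) (Yo g g1) (Xo k k1) (Yo k k1) = 0"
     "sform (Xe g g1) (Ye g g1) (Xe k k1) (Ye k k1) = 0"
    if g: "R g g1 f h" and k: "R k k1 f' l" for g g1 f h k k1 f' l
  proof -
    let ?o = "sform (Xo g g1) (Yo g g1) (Xo k k1) (Yo k k1)"
    let ?e = "sform (Xe g g1) (Ye g g1) (Xe k k1) (Ye k k1)"
    have 1: "?o + ?e = 0" by (rule iso[OF g k])
    \<comment> \<open>Reflecting the first argument negates its odd data and keeps the even ones;
      together with \<open>1\<close> this isolates each form.\<close>
    have "sform (Xm g g1 - X g g1) (Ym g g1 - Y g g1) (Xo k k1) (Yo k k1) +
      sform (Xm g g1 + X g g1) (Ym g g1 + Y g g1) (Xe k k1) (Ye k k1) = 0"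
      using iso[OF Rm[OF g] k] unfolding XYm_mirror .
    then have 2: "?e - ?o = 0" unfolding sform_def by (simp add: algebra_simps)
    have "2 * ?e = (?o + ?e) + (?e - ?o)" "2 * ?o = (?o + ?e) - (?e - ?o)" by simp_all
    then show "?o = 0" "?e = 0" unfolding 1 2 by simp_all
  qed
  define VO where "VO = {(Xo g g1, Yo g g1) | g g1. \<exists>f h. R g g1 f h}"
  define VE where "VE = {(Xe g g1, Ye g g1) | g g1. \<exists>f h. R g g1 f h}"
  have maxS: "(f, h) \<in> S"
    if g: "L2w r I f" "aeq I f g" "tpair g g1 h" "L2w r I h"
      and o: "\<And>x' y'. (x', y') \<in> VO \<Longrightarrow> sform (Xo g g1) (Yo g g1) x' y' = 0"
      and e: "\<And>x' y'. (x', y') \<in> VE \<Longrightarrow> sform (Xe g g1) (Ye g g1) x' y' = 0"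
    for f g g1 h
  proof -
    have "ipw r I l f = ipw r I f' h" if fl: "(f', l) \<in> S" for f' l
    proof -
      have "(f', l) \<in> Tmax p q r a b" using fl Smax by blast
      then obtain k k1 where k: "R k k1 f' l" using fl unfolding R_def Tmax_iff by blast
      have k': "aeq I f' k" "tpair k k1 l" using k unfolding R_def by auto
      have "(Xo k k1, Yo k k1) \<in> VO" "(Xe k k1, Ye k k1) \<in> VE"
        using k unfolding VO_def VE_def by blast+
      then have "ipw r I h f' - ipw r I f l = 0"
        unfolding ipw_green[OF g RL(1)[OF k] k' RL(2)[OF k]] using o e by simp
      then show ?thesis using WI.ipw_cnj[of h f'] WI.ipw_cnj[of f l] by simp
    qed
    then have "(f, h) \<in> adjw r I S" unfolding adjw_def using g by auto
    then show ?thesis using S by simp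
  qed
  \<comment> \<open>Whatever is orthogonal to both \<open>VO\<close> and \<open>VE\<close> is
    realised by an element of \<open>S\<close>. Data with zero even or zero odd part then give
    maximality of \<open>VO\<close> and \<open>VE\<close> separately.\<close>
  have rep: "(x - x', y - y') \<in> VO \<and> (x + x', y + y') \<in> VE"
    if "\<And>x1 y1. (x1, y1) \<in> VO \<Longrightarrow> sform (x - x') (y - y') x1 y1 = 0"
      "\<And>x1 y1. (x1, y1) \<in> VE \<Longrightarrow> sform (x + x') (y + y') x1 y1 = 0" for x y x' y'
  proof -
    obtain g g1 h where g: "tpair g g1 h" "X g g1 = x" "Y g g1 = y" "Xm g g1 = x'" "Ym g g1 = y'"
      by (rule bv_surj_all)
    have L: "L2w r I (trunc I g)" "L2w r I (trunc I h)" using g(1) unfolding tpair_def by auto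
    have tp: "tpair g g1 (trunc I h)" by (rule tpair_trunc[OF g(1)])
    have "(trunc I g, trunc I h) \<in> S"
      by (rule maxS[OF L(1) aeq_trunc(1) tp L(2)]) (use that g in auto)
    then have "R g g1 (trunc I g) (trunc I h)" unfolding R_def using tp aeq_trunc(1) by blast
    then show ?thesis unfolding VO_def VE_def using g by blast
  qed
  have zero: "sform 0 0 x y = 0" for x y by (simp add: sform_def)
  have "sform x y x' y' = 0" if "(x, y) \<in> VO" "(x', y') \<in> VO" for x y x' y'
    using that iso2(1) unfolding VO_def by blast
  moreover have "(x, y) \<in> VO" if "\<And>x' y'. (x', y') \<in> VO \<Longrightarrow> sform x y x' y' = 0" for x y
    using rep[of "x / 2" "- x / 2" "y / 2" "- y / 2"] that zero by simp
  ultimately have "\<exists>\<alpha>\<in>{0<..pi}. \<forall>x y. (x, y) \<in> VO \<longleftrightarrow> bcond \<alpha> x y"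
    by (rule lagrangian_line)
  then obtain \<alpha> where \<alpha>: "\<alpha> \<in> {0<..pi}"
    "\<And>x y. (x, y) \<in> VO \<longleftrightarrow> bcond \<alpha> x y"
    by blast
  have "sform x y x' y' = 0" if "(x, y) \<in> VE" "(x', y') \<in> VE" for x y x' y'
    using that iso2(2) unfolding VE_def by blast
  moreover have "(x, y) \<in> VE" if "\<And>x' y'. (x', y') \<in> VE \<Longrightarrow> sform x y x' y' = 0" for x y
    using rep[of "x / 2" "x / 2" "y / 2" "y / 2"] that zero by simp
  ultimately have "\<exists>\<alpha>\<in>{0<..pi}. \<forall>x y. (x, y) \<in> VE \<longleftrightarrow> bcond \<alpha> x y"
    by (rule lagrangian_line)
  then obtain \<alpha>' where \<alpha>': "\<alpha>' \<in> {0<..pi}"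
    "\<And>x y. (x, y) \<in> VE \<longleftrightarrow> bcond \<alpha>' x y"
    by blast
  have "S = split_ext \<alpha> \<alpha>'"
  proof
    show "S \<subseteq> split_ext \<alpha> \<alpha>'"
    proof
      fix fh assume fh: "fh \<in> S"
      then obtain f h g g1 where g: "fh = (f, h)" "L2w r I f" "L2w r I h" "aeq I f g" "tpair g g1 h"
        using Smax Tmax_iff by (cases fh) blast
      then have "R g g1 f h" using fh unfolding R_def by blast
      then have "(Xo g g1, Yo g g1) \<in> VO" "(Xe g g1, Ye g g1) \<in> VE"
        unfolding VO_def VE_def by blast+
      then show "fh \<in> split_ext \<alpha> \<alpha>'" unfolding split_ext_def g(1) \<alpha>(2) \<alpha>'(2) using g by blast
    qed
    show "split_ext \<alpha> \<alpha>' \<subseteq> S"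
    proof
      fix fh assume "fh \<in> split_ext \<alpha> \<alpha>'"
      then obtain f h g g1 where g: "fh = (f, h)" "L2w r I f" "L2w r I h" "aeq I f g" "tpair g g1 h"
        "bcond \<alpha> (Xo g g1) (Yo g g1)"
        "bcond \<alpha>' (Xe g g1) (Ye g g1)"
        unfolding split_ext_def by blast
      show "fh \<in> S" unfolding g(1)
        by (rule maxS[OF g(2,4,5,3)]) (use \<alpha>(2) \<alpha>'(2) sform_bc_zero[OF g(6)] sform_bc_zero[OF g(7)] in blast)+
    qed
  qed
  then show ?thesis using that \<alpha>(1) \<alpha>'(1) by blast
qed

lemma tpair_iff:
  assumes "L2w r I f" "L2w r I h" "aeq I f g"
  shows "tpair g g1 h \<longleftrightarrow> qd I g g1 h"
  using assms L2w_trunc[OF WI.weighted_L2_axioms assms(1,3)] qd_sys_continuous(1)[OF _ interval_Ioo]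
    L2w_trunc_iff[OF WI.weighted_L2_axioms WI.L2w_measurable[OF assms(2)]]
  unfolding tpair_def by blast

text \<open>For equal angles the conditions at \<open>a\<close> and \<open>b\<close> are the same
  linear form applied to \<open>g\<close> and to its mirror image; their difference and sum are the
  odd and even conditions.\<close>

lemma Tab_eq_split_ext: "Tab p q r a b u u1 v v1 \<alpha> \<alpha> = split_ext \<alpha> \<alpha>"
proof -
  let ?c = "complex_of_real (cos \<alpha>)" and ?s = "complex_of_real (sin \<alpha>)"
  have bc: "?c * X g g1 + ?s * Y g g1 = 0 \<and> ?c * bv_b a b u u1 g g1 - ?s * bv'_b a b v v1 g g1 = 0 \<longleftrightarrow>
    ?c * (Xo g g1) + ?s * (Yo g g1) = 0 \<and> ?c * (Xe g g1) + ?s * (Ye g g1) = 0"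
    if "tpair g g1 h" for g g1 h
  proof -
    have eq: "?c * (Xo g g1) + ?s * (Yo g g1) = (?c * X g g1 + ?s * Y g g1) - (?c * Xm g g1 + ?s * Ym g g1)"
      "?c * (Xe g g1) + ?s * (Ye g g1) = (?c * X g g1 + ?s * Y g g1) + (?c * Xm g g1 + ?s * Ym g g1)"
      "?c * bv_b a b u u1 g g1 - ?s * bv'_b a b v v1 g g1 = ?c * Xm g g1 + ?s * Ym g g1"
      unfolding bv_b_eq bv'_b_eq[OF that] by (simp_all add: algebra_simps)
    have "A = 0 \<and> B = 0 \<longleftrightarrow> A - B = 0 \<and> A + B = 0" for A B :: complex by auto
    then show ?thesis unfolding eq .
  qed
  have "(f, h) \<in> Tab p q r a b u u1 v v1 \<alpha> \<alpha> \<longleftrightarrow> (f, h) \<in> split_ext \<alpha> \<alpha>" for f h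
    using tpair_iff[of f h] bc unfolding Tab_def split_ext_def by blast
  then show ?thesis by auto
qed

end

section \<open>From two angles to a matrix in SL(2)\<close>

lemma acot_cot:
  assumes "0 < \<alpha>" "\<alpha> < pi"
  shows "acot (cos \<alpha> / sin \<alpha>) = \<alpha>"
proof -
  have "tan (pi / 2 - \<alpha>) = cos \<alpha> / sin \<alpha>" by (simp add: tan_def sin_diff cos_diff)
  then have "arctan (cos \<alpha> / sin \<alpha>) = pi / 2 - \<alpha>" using assms by (intro arctan_unique) auto
  then show ?thesis by (simp add: acot_def)
qed

lemma bc_cot:
  fixes z w :: complex
  assumes "0 < \<alpha>" "\<alpha> < pi"
  shows "bcond \<alpha> z w \<longleftrightarrow>
    complex_of_real (cos \<alpha> / sin \<alpha>) * z + w = 0"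
proof -
  have s: "sin \<alpha> \<noteq> 0" using sin_gt_zero[OF assms] by simp
  have "complex_of_real (cos \<alpha>) = complex_of_real (sin \<alpha>) * complex_of_real (cos \<alpha> / sin \<alpha>)"
    using s by (simp add: of_real_mult[symmetric] del: of_real_mult of_real_divide)
  then have "complex_of_real (cos \<alpha>) * z + complex_of_real (sin \<alpha>) * w =
      complex_of_real (sin \<alpha>) * (complex_of_real (cos \<alpha> / sin \<alpha>) * z + w)"
    by (simp only: distrib_left mult.assoc)
  then show ?thesis using s by simp
qed

lemma bc_pi: "bcond pi z w \<longleftrightarrow> z = 0"
  by simp

text \<open>With \<open>A = K (x - x') + (y - y')\<close> and \<open>B = K' (x + x') + (y + y')\<close>, solving \<open>A = B = 0\<close>
  for \<open>x'\<close> and \<open>y'\<close> amounts to \<open>A + B = 0\<close> and \<open>K' A + K B = 0\<close>.\<close>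

lemma bc_matrix:
  fixes K K' x y x' y' :: complex
  assumes "K \<noteq> K'"
  shows "(x' = (K + K') / (K - K') * x + 2 / (K - K') * y \<and> - y' = 2 * K * K' / (K - K') * x + (K + K') / (K - K') * y)
    \<longleftrightarrow> K * (x - x') + (y - y') = 0 \<and> K' * (x + x') + (y + y') = 0"
proof -
  let ?d = "K - K'"
  define A where "A = K * (x - x') + (y - y')"
  define B where "B = K' * (x + x') + (y + y')"
  have d: "?d \<noteq> 0" using assms by simp
  have div: "z = s / ?d * x + t / ?d * y \<longleftrightarrow> ?d * z = s * x + t * y" for z s t
  proof -
    have e: "s / ?d * x + t / ?d * y = (s * x + t * y) / ?d" by (simp add: add_divide_distrib)
    show ?thesis unfolding e eq_divide_eq mult.commute[of ?d] if_P[OF d] ..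
  qed
  have sum: "A + B = (K + K') * x + 2 * y - ?d * x'" unfolding A_def B_def by (simp add: algebra_simps)
  have elim: "K' * A + K * B = 2 * K * K' * x + (K + K') * y - ?d * (- y')"
    unfolding A_def B_def by (simp add: algebra_simps)
  have 1: "x' = (K + K') / ?d * x + 2 / ?d * y \<longleftrightarrow> A + B = 0" unfolding div sum right_minus_eq by (rule eq_commute)
  have 2: "- y' = 2 * K * K' / ?d * x + (K + K') / ?d * y \<longleftrightarrow> K' * A + K * B = 0" unfolding div elim right_minus_eq by (rule eq_commute)
  have 3: "A + B = 0 \<and> K' * A + K * B = 0 \<longleftrightarrow> A = 0 \<and> B = 0"
  proof
    assume AB: "A + B = 0 \<and> K' * A + K * B = 0"
    have "?d * B = (K' * A + K * B) - K' * (A + B)" by (simp add: algebra_simps)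
    then have "?d * B = 0" using AB by simp
    then show "A = 0 \<and> B = 0" using d AB by simp
  qed simp
  show ?thesis unfolding 1 2 3 unfolding A_def B_def ..
qed

text \<open>Solving \<open>k = (R11 + 1) / R12\<close> and \<open>k' = (R11 - 1) / R12\<close> for
  the entries gives \<open>R12 = 2 / (k - k')\<close> and \<open>R11 = (k + k') / (k - k')\<close>;
  the determinant then fixes \<open>R21\<close>. An angle \<open>pi\<close> is the limit of infinite
  cotangent. The sign in \<open>- y'\<close> is that of \<open>bv'_b_eq\<close>.\<close>

lemma matrix_of_angles:
  assumes \<alpha>: "\<alpha> \<in> {0<..pi}" and \<alpha>': "\<alpha>' \<in> {0<..pi}" and ne: "\<alpha> \<noteq> \<alpha>'"
  obtains R11 R12 R21 :: real where "R11 * R11 - R12 * R21 = 1"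
    "R12 \<noteq> 0 \<Longrightarrow> \<alpha> = acot ((R11 + 1) / R12) \<and> \<alpha>' = acot ((R11 - 1) / R12)"
    "R12 = 0 \<Longrightarrow> R11 = - 1 \<Longrightarrow> \<alpha> = acot (- R21 / 2) \<and> \<alpha>' = pi"
    "R12 = 0 \<Longrightarrow> R11 = 1 \<Longrightarrow> \<alpha> = pi \<and> \<alpha>' = acot (R21 / 2)"
    "\<And>x y x' y' :: complex. (x' = complex_of_real R11 * x + complex_of_real R12 * y \<and>
        - y' = complex_of_real R21 * x + complex_of_real R11 * y) \<longleftrightarrow>
      bcond \<alpha> (x - x') (y - y') \<and>
      bcond \<alpha>' (x + x') (y + y')"
proof -
  define k where "k = cos \<alpha> / sin \<alpha>"
  define k' where "k' = cos \<alpha>' / sin \<alpha>'"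
  have ak: "acot k = \<alpha>" if "\<alpha> \<noteq> pi" using acot_cot[of \<alpha>] \<alpha> that unfolding k_def by auto
  have ak': "acot k' = \<alpha>'" if "\<alpha>' \<noteq> pi" using acot_cot[of \<alpha>'] \<alpha>' that unfolding k'_def by auto
  have bk: "bcond \<alpha> z w \<longleftrightarrow> complex_of_real k * z + w = 0"
    if "\<alpha> \<noteq> pi" for z w using bc_cot[of \<alpha>] \<alpha> that unfolding k_def by auto
  have bk': "bcond \<alpha>' z w \<longleftrightarrow> complex_of_real k' * z + w = 0"
    if "\<alpha>' \<noteq> pi" for z w using bc_cot[of \<alpha>'] \<alpha>' that unfolding k'_def by auto
  consider "\<alpha> \<noteq> pi" "\<alpha>' \<noteq> pi" | "\<alpha> \<noteq> pi" "\<alpha>' = pi" | "\<alpha> = pi" "\<alpha>' \<noteq> pi" using ne by blast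
  then show ?thesis
  proof cases
    case 1
    have kk: "k \<noteq> k'" using ak[OF 1(1)] ak'[OF 1(2)] ne by auto
    define d where "d = k - k'"
    have d: "d \<noteq> 0" using kk by (simp add: d_def)
    show ?thesis
    proof (rule that[of "(k + k') / d" "2 / d" "2 * k * k' / d"])
      have "(k + k') * (k + k') - 2 * (2 * k * k') = d * d" unfolding d_def by (simp add: algebra_simps)
      then have "((k + k') * (k + k') - 2 * (2 * k * k')) / (d * d) = 1" using d by simp
      then show "(k + k') / d * ((k + k') / d) - 2 / d * (2 * k * k' / d) = 1" by (simp add: diff_divide_distrib)
      have "(e / d + 1) / (2 / d) = (e + d) / 2" "(e / d - 1) / (2 / d) = (e - d) / 2" for e
        using d by (simp_all add: field_simps)
      then have "((k + k') / d + 1) / (2 / d) = (k + k' + (k - k')) / 2" "((k + k') / d - 1) / (2 / d) = (k + k' - (k - k')) / 2"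
        by (simp_all only: d_def)
      then have "((k + k') / d + 1) / (2 / d) = k" "((k + k') / d - 1) / (2 / d) = k'" by simp_all
      then show "\<alpha> = acot (((k + k') / d + 1) / (2 / d)) \<and> \<alpha>' = acot (((k + k') / d - 1) / (2 / d))"
        using ak[OF 1(1)] ak'[OF 1(2)] by simp
      have K: "complex_of_real k \<noteq> complex_of_real k'" using kk by simp
      show "(x' = complex_of_real ((k + k') / d) * x + complex_of_real (2 / d) * y \<and>
        - y' = complex_of_real (2 * k * k' / d) * x + complex_of_real ((k + k') / d) * y) \<longleftrightarrow>
        bcond \<alpha> (x - x') (y - y') \<and>
        bcond \<alpha>' (x + x') (y + y')" for x y x' y' :: complex
        unfolding bk[OF 1(1)] bk'[OF 1(2)] bc_matrix[OF K, symmetric] d_def by simp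
    qed (use d in auto)
  next
    case 2
    show ?thesis
    \<comment> \<open>The limits of the generic entries as \<open>k'\<close> becomes infinite. In
      the third case \<open>k\<close> becomes infinite instead.\<close>
    proof (rule that[of "- 1" 0 "- 2 * k"])
      show "\<alpha> = acot (- (- 2 * k) / 2) \<and> \<alpha>' = pi" using ak[OF 2(1)] 2(2) by simp
      show "(x' = complex_of_real (- 1) * x + complex_of_real 0 * y \<and>
        - y' = complex_of_real (- 2 * k) * x + complex_of_real (- 1) * y) \<longleftrightarrow>
        bcond \<alpha> (x - x') (y - y') \<and>
        bcond \<alpha>' (x + x') (y + y')" for x y x' y' :: complex
        unfolding bk[OF 2(1)] 2(2) bc_pi
        by (auto simp: algebra_simps add_eq_0_iff)
    qed auto
  next
    case 3
    show ?thesis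
    proof (rule that[of 1 0 "2 * k'"])
      show "\<alpha> = pi \<and> \<alpha>' = acot (2 * k' / 2)" using ak'[OF 3(2)] 3(1) by simp
      show "(x' = complex_of_real 1 * x + complex_of_real 0 * y \<and>
        - y' = complex_of_real (2 * k') * x + complex_of_real 1 * y) \<longleftrightarrow>
        bcond \<alpha> (x - x') (y - y') \<and>
        bcond \<alpha>' (x + x') (y + y')" for x y x' y' :: complex
        unfolding bk'[OF 3(2)] 3(1) bc_pi
        by (auto simp: algebra_simps add_eq_0_iff)
    qed auto
  qed
qed

context sl_problem
begin

lemma TetaR_eq_split_ext:
  assumes "\<And>x y x' y' :: complex. (x' = complex_of_real R11 * x + complex_of_real R12 * y \<and>
        - y' = complex_of_real R21 * x + complex_of_real R22 * y) \<longleftrightarrow>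
      bcond \<alpha> (x - x') (y - y') \<and>
      bcond \<alpha>' (x + x') (y + y')"
  shows "TetaR p q r a b u u1 v v1 0 R11 R12 R21 R22 = split_ext \<alpha> \<alpha>'"
proof -
  have bc: "bv_b a b u u1 g g1 = cis 0 * (complex_of_real R11 * X g g1 + complex_of_real R12 * Y g g1) \<and>
        bv'_b a b v v1 g g1 = cis 0 * (complex_of_real R21 * X g g1 + complex_of_real R22 * Y g g1) \<longleftrightarrow>
      bcond \<alpha> (Xo g g1) (Yo g g1) \<and>
      bcond \<alpha>' (Xe g g1) (Ye g g1)"
    if "tpair g g1 h" for g g1 h
    unfolding bv_b_eq bv'_b_eq[OF that] cis_zero mult_1 by (rule assms)
  have "(f, h) \<in> TetaR p q r a b u u1 v v1 0 R11 R12 R21 R22 \<longleftrightarrow> (f, h) \<in> split_ext \<alpha> \<alpha>'" for f h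
    using tpair_iff[of f h] bc unfolding TetaR_def split_ext_def by blast
  then show ?thesis by auto
qed

section \<open>Unfolding a pair of half-interval functions\<close>

abbreviation "mid \<equiv> (a + b) / 2"
abbreviation "half \<equiv> {a<..<(a + b) / 2}"

definition rt :: complex where "rt = complex_of_real (1 / sqrt 2)"

text \<open>The first component becomes the odd part and the second the even part of the glued
  function, and the factor \<open>rt\<close> makes the map isometric. The midpoint belongs to the
  second branch.\<close>

definition glue :: "(real \<Rightarrow> complex) \<times> (real \<Rightarrow> complex) \<Rightarrow> real \<Rightarrow> complex" where
  "glue fg = (\<lambda>x. if x < mid then rt * (snd fg x + fst fg x)
     else rt * (snd fg (a + b - x) - fst fg (a + b - x)))"

lemma rt_sq: "rt * rt = 1 / 2"
proof -
  have "1 / sqrt 2 * (1 / sqrt 2) = (1 / 2 :: real)" by simp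
  from arg_cong[OF this, of complex_of_real] show ?thesis
    unfolding rt_def of_real_mult[symmetric] by simp
qed

lemma cmod_rt_sq: "(cmod (rt * z))^2 = (cmod z)^2 / 2"
proof -
  have "cmod rt = 1 / sqrt 2" unfolding rt_def norm_of_real by simp
  then show ?thesis by (simp add: norm_mult power_mult_distrib power_divide)
qed

lemma glue_left: "x < mid \<Longrightarrow> glue (f1, f2) x = rt * (f2 x + f1 x)"
  by (simp add: glue_def)

lemma glue_right: "mid \<le> x \<Longrightarrow> glue (f1, f2) x = rt * (f2 (a + b - x) - f1 (a + b - x))"
  by (simp add: glue_def)

lemma half_subset: "half \<subseteq> I" "half \<in> sets borel"
  using ab by auto

sublocale WH: weighted_L2 r half
  by (rule weighted[OF half_subset])

lemma set_integral_split_mid: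
  fixes F :: "real \<Rightarrow> real"
  assumes F: "set_integrable lborel half F" and G: "set_integrable lborel half (\<lambda>x. F (a + b - x))"
  shows "set_integrable lborel I F" "(LINT x:I|lborel. F x) = (LINT x:half|lborel. F x) + (LINT x:half|lborel. F (a + b - x))"
proof -
  let ?H = "{x. a + b - x \<in> half}"
  have H: "?H = {mid<..<b}" by (auto simp: field_simps)
  have F2: "set_integrable lborel ?H F"
    using G set_integrable_lborel_reflect[of "a + b" half "\<lambda>x. F (a + b - x)"] by simp
  have val: "(LINT x:?H|lborel. F x) = (LINT x:half|lborel. F (a + b - x))"
    using set_integral_lborel_reflect[of "a + b" half "\<lambda>x. F (a + b - x)"] by simp
  have disj: "half \<inter> ?H = {}" unfolding H by auto
  have U: "set_integrable lborel (half \<union> ?H) F" using F F2 unfolding H by (intro set_integrable_Un) auto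
  have diff: "((half \<union> ?H) - I) \<union> (I - (half \<union> ?H)) \<subseteq> {mid}" unfolding H using ab by auto
  show "set_integrable lborel I F"
    using U set_integrable_discrete_difference[of "{mid}" "half \<union> ?H" I lborel F] diff by auto
  show "(LINT x:I|lborel. F x) = (LINT x:half|lborel. F x) + (LINT x:half|lborel. F (a + b - x))"
    using set_integral_discrete_difference[of "{mid}" "half \<union> ?H" I lborel F] diff
      set_integral_Un[OF disj F F2] val by auto
qed

text \<open>The norm identity is the parallelogram law, applied pointwise to the values at
  \<open>x\<close> and at its reflection.\<close>

lemma glue_L2w:
  assumes "L2w r half f1" "L2w r half f2"
  shows "L2w r I (glue (f1, f2))" "(normw r I (glue (f1, f2)))^2 = (normw r half f1)^2 + (normw r half f2)^2"
proof -
  have m [measurable]: "f1 \<in> borel_measurable borel" "f2 \<in> borel_measurable borel"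
    using assms by (auto intro: WH.L2w_measurable)
  have [measurable]: "(\<lambda>x. f1 (a + b - x)) \<in> borel_measurable borel" "(\<lambda>x. f2 (a + b - x)) \<in> borel_measurable borel"
    by (rule measurable_compose[OF _ m(1)] measurable_compose[OF _ m(2)], measurable)+
  have gm: "glue (f1, f2) \<in> borel_measurable borel" unfolding glue_def fst_conv snd_conv by measurable
  let ?F = "\<lambda>x. r x * (cmod (glue (f1, f2) x))^2"
  have Fl: "?F x = r x * (cmod (f2 x + f1 x))^2 / 2" if "x \<in> half" for x
    using that by (simp add: glue_left cmod_rt_sq)
  have Fr: "?F (a + b - x) = r x * (cmod (f2 x - f1 x))^2 / 2" if "x \<in> half" for x
  proof -
    have "a + b - x \<in> I" "mid \<le> a + b - x" using that ab by auto
    then show ?thesis using glue_right[of "a + b - x" f1 f2] sym_mirror[of x] by (simp add: cmod_rt_sq)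
  qed
  have ip: "set_integrable lborel half (\<lambda>x. r x * (cmod (f2 x + f1 x))^2)" "set_integrable lborel half (\<lambda>x. r x * (cmod (f2 x - f1 x))^2)"
    using WH.L2w_integrable[OF WH.L2w_add[OF assms(2,1)]] WH.L2w_integrable[OF WH.L2w_diff[OF assms(2,1)]] by auto
  have i1: "set_integrable lborel half ?F \<longleftrightarrow> set_integrable lborel half (\<lambda>x. r x * (cmod (f2 x + f1 x))^2 / 2)"
    by (intro set_integrable_cong Fl) auto
  have i2: "set_integrable lborel half (\<lambda>x. ?F (a + b - x)) \<longleftrightarrow> set_integrable lborel half (\<lambda>x. r x * (cmod (f2 x - f1 x))^2 / 2)"
    by (intro set_integrable_cong Fr) auto
  have i: "set_integrable lborel half ?F" "set_integrable lborel half (\<lambda>x. ?F (a + b - x))"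
    unfolding i1 i2 using ip by (auto intro: set_integrable_divide)
  show "L2w r I (glue (f1, f2))" unfolding L2w_def using gm set_integral_split_mid(1)[OF i] by simp
  have "(normw r I (glue (f1, f2)))^2 = (LINT x:half|lborel. ?F x) + (LINT x:half|lborel. ?F (a + b - x))"
    unfolding WI.normw_sq by (rule set_integral_split_mid(2)[OF i])
  also have "\<dots> = (LINT x:half|lborel. ?F x + ?F (a + b - x))" using i by simp
  also have "\<dots> = (LINT x:half|lborel. r x * (cmod (f1 x))^2 + r x * (cmod (f2 x))^2)"
  proof (intro set_lebesgue_integral_cong allI impI)
    fix x assume x: "x \<in> half"
    have "(cmod (f2 x + f1 x))^2 + (cmod (f2 x - f1 x))^2 = 2 * (cmod (f1 x))^2 + 2 * (cmod (f2 x))^2"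
      by (simp add: cmod_power2 power2_sum power2_diff)
    then have "r x * ((cmod (f2 x + f1 x))^2 + (cmod (f2 x - f1 x))^2) / 2 = r x * (2 * (cmod (f1 x))^2 + 2 * (cmod (f2 x))^2) / 2"
      by (simp only:)
    then show "?F x + ?F (a + b - x) = r x * (cmod (f1 x))^2 + r x * (cmod (f2 x))^2"
      unfolding Fl[OF x] Fr[OF x] by (simp add: algebra_simps add_divide_distrib)
  qed simp
  also have "\<dots> = (normw r half f1)^2 + (normw r half f2)^2"
    unfolding WH.normw_sq using assms[THEN WH.L2w_integrable] by simp
  finally show "(normw r I (glue (f1, f2)))^2 = (normw r half f1)^2 + (normw r half f2)^2" .
qed

lemma aeq_glue:
  assumes "aeq half f1 k1" "aeq half f2 k2"
  shows "aeq I (glue (f1, f2)) (glue (k1, k2))"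
proof -
  have "AE x in lborel. (a + b - x \<in> half \<longrightarrow> f1 (a + b - x) = k1 (a + b - x))"
    "AE x in lborel. (a + b - x \<in> half \<longrightarrow> f2 (a + b - x) = k2 (a + b - x))"
    using AE_lborel_reflect[OF assms(1)[unfolded aeq_def]] AE_lborel_reflect[OF assms(2)[unfolded aeq_def]] by blast+
  \<comment> \<open>At \<open>mid\<close> the glued functions read values outside
    \<open>half\<close>, where nothing is assumed, so this point is discarded.\<close>
  with assms AE_lborel_singleton[of mid] show ?thesis
    unfolding aeq_def
  proof eventually_elim
    case (elim x)
    show ?case
    proof
      assume "x \<in> I"
      then consider "x \<in> half" | "a + b - x \<in> half" "mid \<le> x" using elim by (fastforce simp: field_simps)
      then show "glue (f1, f2) x = glue (k1, k2) x"
        by cases (use elim in \<open>auto simp: glue_left glue_right\<close>)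
    qed
  qed
qed

definition odd_part :: "(real \<Rightarrow> complex) \<Rightarrow> real \<Rightarrow> complex" where
  "odd_part h = (\<lambda>x. rt * h x + (- rt) * mirror h x)"

definition even_part :: "(real \<Rightarrow> complex) \<Rightarrow> real \<Rightarrow> complex" where
  "even_part h = (\<lambda>x. rt * h x + rt * mirror h x)"

lemma rt_double: "rt * (rt * z + rt * z) = z"
proof -
  have "rt * (rt * z + rt * z) = (rt * rt) * (2 * z)" by (simp add: algebra_simps)
  then show ?thesis unfolding rt_sq by simp
qed

lemma glue_parts: "aeq I (glue (odd_part h, even_part h)) h"
  unfolding aeq_def
proof (intro always_eventually allI impI)
  fix x assume "x \<in> I"
  show "glue (odd_part h, even_part h) x = h x"
  proof (cases "x < mid")
    case True
    have "even_part h x + odd_part h x = rt * h x + rt * h x" by (simp add: even_part_def odd_part_def)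
    then show ?thesis using True by (simp only: glue_left rt_double)
  next
    case False
    have "even_part h (a + b - x) - odd_part h (a + b - x) = rt * h x + rt * h x"
      by (simp add: even_part_def odd_part_def mirror_def)
    then show ?thesis using False by (simp only: glue_right not_less rt_double)
  qed
qed

lemma L2w_parts:
  assumes "L2w r I h"
  shows "L2w r half (odd_part h)" "L2w r half (even_part h)"
  unfolding odd_part_def even_part_def
  by (rule L2w_mono[OF WI.L2w_combine[OF assms L2w_mirror[OF assms]] half_subset])+

lemma unitary_glue: "unitary2 r I half glue"
  unfolding unitary2_def
proof (intro conjI allI impI)
  show "L2w r I (glue (f1, f2))" if "L2w r half f1 \<and> L2w r half f2" for f1 f2
    using that by (intro glue_L2w) auto
  show "aeq I (glue ((\<lambda>x. c * f1 x + g1 x), (\<lambda>x. c * f2 x + g2 x))) (\<lambda>x. c * glue (f1, f2) x + glue (g1, g2) x)"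
    for f1 f2 g1 g2 and c :: complex
    by (rule aeq_eqI) (simp add: glue_def algebra_simps)
  show "(normw r I (glue (f1, f2)))^2 = (normw r half f1)^2 + (normw r half f2)^2"
    if "L2w r half f1 \<and> L2w r half f2" for f1 f2
    using that by (intro glue_L2w) auto
  show "\<exists>f1 f2. L2w r half f1 \<and> L2w r half f2 \<and> aeq I (glue (f1, f2)) h" if "L2w r I h" for h
    using L2w_parts[OF that] glue_parts by blast
qed

lemma adm_half:
  assumes "L2w r half f" "aeq half f k" "qd {a<..mid} k k1 h" "L2w r half h"
  shows "adm k k1 h"
proof -
  have q: "qd half k k1 h" by (rule qd_sys_mono[OF assms(3)]) auto
  have "L2w r half (trunc half k)"
    by (rule L2w_trunc[OF WH.weighted_L2_axioms assms(1,2) qd_sys_continuous(1)[OF q interval_Ioo]])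
  moreover have "L2w r half (trunc half h)"
    using L2w_trunc_iff[OF WH.weighted_L2_axioms WH.L2w_measurable[OF assms(4)]] assms(4) by simp
  ultimately show ?thesis unfolding adm_def using q ab by (intro exI[of _ mid]) auto
qed

text \<open>The pieces are glued as quasi-derivative systems on \<open>{a<..mid}\<close> and \<open>{mid..<b}\<close>; for the right hand
  sides to agree at \<open>mid\<close> the odd one is first changed to \<open>0\<close> there.\<close>

lemma qd_glue:
  assumes k: "qd {a<..mid} k k1 h" "qd {a<..mid} l l1 m" and z: "k mid = 0" "l1 mid = 0"
    and [measurable]: "h \<in> borel_measurable borel" "m \<in> borel_measurable borel"
  defines "G1 \<equiv> \<lambda>x. if x < mid then rt * (l1 x + k1 x) else - (rt * (l1 (a + b - x) - k1 (a + b - x)))"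
  shows "qd I (glue (k, l)) G1 (glue (h(mid := 0), m))"
proof -
  let ?h = "h(mid := 0)"
  have J: "is_interval {a<..mid}" "is_interval {mid..<b}" by (simp_all add: is_interval_1)
  have hm: "?h \<in> borel_measurable borel" unfolding fun_upd_def by measurable
  have k': "qd {a<..mid} k k1 ?h"
  proof (rule qd_cong_AE[OF J(1) k(1) _ hm])
    show "aeq {a<..mid} h ?h" unfolding aeq_def using AE_lborel_singleton[of mid] by eventually_elim auto
    show "trunc {a<..mid} h \<in> borel_measurable borel" unfolding trunc_def by measurable
  qed
  have L: "qd {a<..mid} (\<lambda>x. rt * l x + rt * k x) (\<lambda>x. rt * l1 x + rt * k1 x) (\<lambda>x. rt * m x + rt * ?h x)"
    by (rule qd_sys_combine[OF k(2) k'])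
  \<comment> \<open>At \<open>mid\<close> the definitions use the right branch; it agrees with the
    left formula because \<open>k\<close>, \<open>l1\<close> and the modified \<open>h\<close>
    vanish there.\<close>
  have eL: "glue (k, l) x = rt * l x + rt * k x \<and> G1 x = rt * l1 x + rt * k1 x \<and> glue (?h, m) x = rt * m x + rt * ?h x"
    if x: "x \<in> {a<..mid}" for x
  proof (cases "x = mid")
    case True
    then have e: "a + b - x = x" and n: "\<not> x < mid" by simp_all
    have "k x = 0" "l1 x = 0" "?h x = 0" unfolding True using z by simp_all
    then show ?thesis by (simp only: glue_def G1_def fst_conv snd_conv if_not_P[OF n] e) simp
  next
    case False
    then have "x < mid" using x by simp
    then show ?thesis by (simp only: glue_def G1_def fst_conv snd_conv if_P) (simp add: algebra_simps)
  qed
  have left: "qd {a<..mid} (glue (k, l)) G1 (glue (?h, m))"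
    using L qd_sys_cong[OF J(1), of "glue (k, l)" "\<lambda>x. rt * l x + rt * k x" G1 "\<lambda>x. rt * l1 x + rt * k1 x"
      "glue (?h, m)" "\<lambda>x. rt * m x + rt * ?h x"] eL by blast
  let ?S = "{x. a + b - x \<in> {a<..mid}}"
  have S: "?S = {mid..<b}" by (auto simp: field_simps)
  have Rc: "qd {a<..mid} (\<lambda>x. rt * l x + (- rt) * k x) (\<lambda>x. rt * l1 x + (- rt) * k1 x) (\<lambda>x. rt * m x + (- rt) * ?h x)"
    by (rule qd_sys_combine[OF k(2) k'])
  have sy: "p (a + b - x) = p x \<and> q (a + b - x) = q x \<and> r (a + b - x) = r x" if "a + b - x \<in> {a<..mid}" for x
    using that ab by (intro sym_mirror) auto
  have R: "qd {mid..<b} (\<lambda>x. rt * l (a + b - x) + (- rt) * k (a + b - x)) (\<lambda>x. - (rt * l1 (a + b - x) + (- rt) * k1 (a + b - x)))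
     (\<lambda>x. rt * m (a + b - x) + (- rt) * ?h (a + b - x))"
    using qd_sys_reflect[OF Rc J(1) sy] unfolding S .
  have eR: "glue (k, l) x = rt * l (a + b - x) + (- rt) * k (a + b - x)"
      "G1 x = - (rt * l1 (a + b - x) + (- rt) * k1 (a + b - x))"
      "glue (?h, m) x = rt * m (a + b - x) + (- rt) * ?h (a + b - x)"
    if "x \<in> {mid..<b}" for x
    using that by (auto simp: glue_def G1_def algebra_simps)
  have right: "qd {mid..<b} (glue (k, l)) G1 (glue (?h, m))"
    by (rule qd_sys_cong[OF J(2) eR, THEN iffD2, OF _ _ _ R])
  have "{a<..mid} \<union> {mid..<b} = I" using ab by auto
  then show ?thesis
    using left right ac_rep_Un[of "{a<..mid}" _ _ "{mid..<b}" mid] ab unfolding qd_sys_def by auto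
qed

text \<open>One direction takes odd and even parts: an odd function vanishes at the fixed point of
  the reflection, and so does the quasi-derivative of an even one. Conversely, these two conditions
  are exactly what lets the glued representatives join at the midpoint.\<close>

lemma ueq_split_ext:
  "ueq_sum r I half (split_ext \<alpha> \<alpha>') (Thalf p q r a mid u u1 v v1 \<alpha> pi) (Thalf p q r a mid u u1 v v1 \<alpha>' (pi / 2))"
  unfolding ueq_sum_def
proof (intro exI conjI)
  let ?c = "complex_of_real (cos \<alpha>)" and ?s = "complex_of_real (sin \<alpha>)"
  let ?c' = "complex_of_real (cos \<alpha>')" and ?s' = "complex_of_real (sin \<alpha>')"
  let ?A = "Thalf p q r a mid u u1 v v1 \<alpha> pi" and ?B = "Thalf p q r a mid u u1 v v1 \<alpha>' (pi / 2)"
  show "unitary2 r I half glue" by (rule unitary_glue)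
  have le: "\<exists>f1 h1 f2 h2. (f1, h1) \<in> ?A \<and> (f2, h2) \<in> ?B \<and> aeq I \<phi> (glue (f1, f2)) \<and> aeq I \<psi> (glue (h1, h2))"
    if fh: "(\<phi>, \<psi>) \<in> split_ext \<alpha> \<alpha>'" for \<phi> \<psi>
  proof -
    obtain g g1 where g: "L2w r I \<phi>" "L2w r I \<psi>" "aeq I \<phi> g" "tpair g g1 \<psi>"
      "?c * (Xo g g1) + ?s * (Yo g g1) = 0"
      "?c' * (Xe g g1) + ?s' * (Ye g g1) = 0"
      using fh unfolding split_ext_def by blast
    note mg = tpair_mirror[OF g(4)]
    have sub: "{a<..mid} \<subseteq> I" using ab by auto
    have o: "tpair (odd_part g) (\<lambda>x. rt * g1 x + (- rt) * (- mirror g1 x)) (odd_part \<psi>)"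
      unfolding odd_part_def by (rule tpair_combine[OF g(4) mg])
    have e: "tpair (even_part g) (\<lambda>x. rt * g1 x + rt * (- mirror g1 x)) (even_part \<psi>)"
      unfolding even_part_def by (rule tpair_combine[OF g(4) mg])
    have oe: "aeq half (odd_part \<phi>) (odd_part g)" "aeq half (even_part \<phi>) (even_part g)"
      unfolding odd_part_def even_part_def
      by (rule aeq_mono[OF aeq_combine[OF g(3) aeq_mirror[OF g(3)]] half_subset(1)])+
    have bo: "X (odd_part g) (\<lambda>x. rt * g1 x + (- rt) * (- mirror g1 x)) = rt * (Xo g g1)"
      "Y (odd_part g) (\<lambda>x. rt * g1 x + (- rt) * (- mirror g1 x)) = rt * (Yo g g1)"
      unfolding odd_part_def XY_combine[OF tpair_adm[OF g(4)] tpair_adm[OF mg]] by (simp_all add: algebra_simps)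
    have be: "X (even_part g) (\<lambda>x. rt * g1 x + rt * (- mirror g1 x)) = rt * (Xe g g1)"
      "Y (even_part g) (\<lambda>x. rt * g1 x + rt * (- mirror g1 x)) = rt * (Ye g g1)"
      unfolding even_part_def XY_combine[OF tpair_adm[OF g(4)] tpair_adm[OF mg]] by (simp_all add: algebra_simps)
    have "?c * (rt * (Xo g g1)) + ?s * (rt * (Yo g g1)) = rt * (?c * (Xo g g1) + ?s * (Yo g g1))"
      by (simp add: algebra_simps)
    then have bc: "?c * (rt * (Xo g g1)) + ?s * (rt * (Yo g g1)) = 0" unfolding g(5) by simp
    have "?c' * (rt * (Xe g g1)) + ?s' * (rt * (Ye g g1)) = rt * (?c' * (Xe g g1) + ?s' * (Ye g g1))"
      by (simp add: algebra_simps)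
    then have bc': "?c' * (rt * (Xe g g1)) + ?s' * (rt * (Ye g g1)) = 0" unfolding g(6) by simp
    have mm: "mirror k mid = k mid" for k by (simp add: mirror_def field_simps)
    have "qd {a<..mid} (odd_part g) (\<lambda>x. rt * g1 x + (- rt) * (- mirror g1 x)) (odd_part \<psi>)"
      using o sub qd_sys_mono unfolding tpair_def by blast
    moreover have "complex_of_real (cos pi) * odd_part g mid - complex_of_real (sin pi) * (rt * g1 mid + (- rt) * (- mirror g1 mid)) = 0"
      by (simp add: odd_part_def mm)
    ultimately have "(odd_part \<phi>, odd_part \<psi>) \<in> ?A"
      unfolding Thalf_def mem_Collect_eq prod.case
      using L2w_parts(1)[OF g(1)] L2w_parts(1)[OF g(2)] oe(1) bc[folded bo] by blast
    moreover have "qd {a<..mid} (even_part g) (\<lambda>x. rt * g1 x + rt * (- mirror g1 x)) (even_part \<psi>)"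
      using e sub qd_sys_mono unfolding tpair_def by blast
    moreover have "complex_of_real (cos (pi / 2)) * even_part g mid - complex_of_real (sin (pi / 2)) * (rt * g1 mid + rt * (- mirror g1 mid)) = 0"
      by (simp add: mm)
    ultimately have "(odd_part \<phi>, odd_part \<psi>) \<in> ?A" "(even_part \<phi>, even_part \<psi>) \<in> ?B"
      unfolding Thalf_def mem_Collect_eq prod.case
      using L2w_parts(2)[OF g(1)] L2w_parts(2)[OF g(2)] oe(2) bc'[folded be] by blast+
    then show ?thesis using aeq_sym[OF glue_parts] by blast
  qed
  have ge: "(\<phi>, \<psi>) \<in> split_ext \<alpha> \<alpha>'"
    if \<phi>: "L2w r I \<phi>" and \<psi>: "L2w r I \<psi>" and A: "(f1, h1) \<in> ?A" and B: "(f2, h2) \<in> ?B"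
      and ae: "aeq I \<phi> (glue (f1, f2))" "aeq I \<psi> (glue (h1, h2))" for \<phi> \<psi> f1 h1 f2 h2
  proof -
    obtain k k1 where k: "L2w r half f1" "L2w r half h1" "aeq half f1 k" "qd {a<..mid} k k1 h1"
      "?c * X k k1 + ?s * Y k k1 = 0" "k mid = 0"
      using A unfolding Thalf_def by auto
    obtain l l1 where l: "L2w r half f2" "L2w r half h2" "aeq half f2 l" "qd {a<..mid} l l1 h2"
      "?c' * X l l1 + ?s' * Y l l1 = 0" "l1 mid = 0"
      using B unfolding Thalf_def by auto
    have [measurable]: "h1 \<in> borel_measurable borel" "h2 \<in> borel_measurable borel" "\<psi> \<in> borel_measurable borel"
      using WH.L2w_measurable k(2) l(2) WI.L2w_measurable \<psi> by auto
    define G where "G = glue (k, l)"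
    define G1 where "G1 = (\<lambda>x. if x < mid then rt * (l1 x + k1 x) else - (rt * (l1 (a + b - x) - k1 (a + b - x))))"
    have qG: "qd I G G1 (glue (h1(mid := 0), h2))"
      unfolding G_def G1_def by (rule qd_glue[OF k(4) l(4) k(6) l(6)]) measurable
    have h0: "L2w r half (h1(mid := 0))"
    proof (rule WH.L2w_cong_AE[OF k(2)])
      show "h1(mid := 0) \<in> borel_measurable borel" unfolding fun_upd_def by measurable
    qed (auto simp: aeq_def)
    have "aeq I (glue (h1, h2)) (glue (h1(mid := 0), h2))"
      by (rule aeq_glue) (auto simp: aeq_def)
    then have ae2: "aeq I (glue (h1(mid := 0), h2)) \<psi>" using ae(2) aeq_trans aeq_sym by blast
    have Lm: "L2w r I (glue (h1(mid := 0), h2))" by (rule glue_L2w[OF h0 l(2)])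
    have "trunc I (glue (h1(mid := 0), h2)) \<in> borel_measurable borel"
      using L2w_trunc_iff[OF WI.weighted_L2_axioms WI.L2w_measurable[OF Lm]] Lm WI.L2w_measurable by blast
    then have qG': "qd I G G1 \<psi>" by (intro qd_cong_AE[OF interval_Ioo qG ae2]) auto
    have \<phi>G: "aeq I \<phi> G" unfolding G_def using ae(1) aeq_glue[OF k(3) l(3)] aeq_trans by blast
    have tp: "tpair G G1 \<psi>" using tpair_iff[OF \<phi> \<psi> \<phi>G] qG' by simp
    note ak = adm_half[OF k(1,3,4,2)] and al = adm_half[OF l(1,3,4,2)]
    have nearX: "X G G1 = X (\<lambda>x. rt * l x + rt * k x) (\<lambda>x. rt * l1 x + rt * k1 x)"
      "Y G G1 = Y (\<lambda>x. rt * l x + rt * k x) (\<lambda>x. rt * l1 x + rt * k1 x)"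
      by (rule XY_cong[of mid]; use ab in \<open>auto simp: G_def G1_def glue_left algebra_simps\<close>)+
    have far: "mirror G x = rt * l x + (- rt) * k x" "- mirror G1 x = rt * l1 x + (- rt) * k1 x" if "x \<in> half" for x
    proof -
      have n: "mid \<le> a + b - x" "\<not> a + b - x < mid" using that by (auto simp: field_simps)
      have "mirror G x = rt * (l x - k x)" "mirror G1 x = - (rt * (l1 x - k1 x))"
        unfolding mirror_def G_def G1_def glue_right[OF n(1)] if_not_P[OF n(2)] by simp_all
      then show "mirror G x = rt * l x + (- rt) * k x" "- mirror G1 x = rt * l1 x + (- rt) * k1 x"
        by (simp_all add: algebra_simps)
    qed
    have am: "a < mid" using ab by simp
    have farX: "Xm G G1 = X (\<lambda>x. rt * l x + (- rt) * k x) (\<lambda>x. rt * l1 x + (- rt) * k1 x)"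
      "Ym G G1 = Y (\<lambda>x. rt * l x + (- rt) * k x) (\<lambda>x. rt * l1 x + (- rt) * k1 x)"
      by (rule XY_cong(1)[OF am far], assumption+) (rule XY_cong(2)[OF am far], assumption+)
    \<comment> \<open>Difference and sum with the mirror image leave only \<open>k\<close> or only
      \<open>l\<close>; the common factor \<open>2 * rt\<close> disappears in the homogeneous
      boundary conditions.\<close>
    have val: "X G G1 - Xm G G1 = 2 * rt * X k k1" "Y G G1 - Ym G G1 = 2 * rt * Y k k1"
      "X G G1 + Xm G G1 = 2 * rt * X l l1" "Y G G1 + Ym G G1 = 2 * rt * Y l l1"
      unfolding nearX farX XY_combine[OF al ak] by (simp_all add: algebra_simps)
    have "?c * (2 * rt * X k k1) + ?s * (2 * rt * Y k k1) = 2 * rt * (?c * X k k1 + ?s * Y k k1)" by (simp add: algebra_simps)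
    then have 1: "?c * (X G G1 - Xm G G1) + ?s * (Y G G1 - Ym G G1) = 0" unfolding val k(5) by simp
    have "?c' * (2 * rt * X l l1) + ?s' * (2 * rt * Y l l1) = 2 * rt * (?c' * X l l1 + ?s' * Y l l1)" by (simp add: algebra_simps)
    then have 2: "?c' * (X G G1 + Xm G G1) + ?s' * (Y G G1 + Ym G G1) = 0" unfolding val l(5) by simp
    show ?thesis unfolding split_ext_def using \<phi> \<psi> \<phi>G tp 1 2 by blast
  qed
  have L2: "L2w r I \<phi> \<and> L2w r I \<psi>" if "(\<phi>, \<psi>) \<in> split_ext \<alpha> \<alpha>'" for \<phi> \<psi>
    using that unfolding split_ext_def by blast
  have "(\<phi>, \<psi>) \<in> split_ext \<alpha> \<alpha>' \<longleftrightarrow> L2w r I \<phi> \<and> L2w r I \<psi> \<and> (\<exists>f1 h1 f2 h2. (f1, h1) \<in> ?A \<and> (f2, h2) \<in> ?B \<and>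
      aeq I \<phi> (glue (f1, f2)) \<and> aeq I \<psi> (glue (h1, h2)))" for \<phi> \<psi>
    using le[of \<phi> \<psi>] ge[of \<phi> \<psi>] L2[of \<phi> \<psi>] by blast
  then show "split_ext \<alpha> \<alpha>' = {(\<phi>, \<psi>). L2w r I \<phi> \<and> L2w r I \<psi> \<and> (\<exists>f1 h1 f2 h2. (f1, h1) \<in> ?A \<and> (f2, h2) \<in> ?B \<and>
      aeq I \<phi> (glue (f1, f2)) \<and> aeq I \<psi> (glue (h1, h2)))}"
    by (simp only: set_eq_iff split_paired_all mem_Collect_eq prod.case) blast
qed

end

theorem theorem4p7:
  fixes a b lam0 :: real and p q r ua ua1 hua hua1 :: "real \<Rightarrow> real"
  assumes ab: "a < b"
    and meas: "p \<in> borel_measurable lborel" "q \<in> borel_measurable lborel" "r \<in> borel_measurable lborel"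
    and pos: "AE x in lborel. x \<in> {a<..<b} \<longrightarrow> p x > 0" "AE x in lborel. x \<in> {a<..<b} \<longrightarrow> r x > 0"
    and loc: "\<And>s t. a < s \<Longrightarrow> s \<le> t \<Longrightarrow> t < b \<Longrightarrow>
        set_integrable lborel {s..t} (\<lambda>x. 1 / p x) \<and> set_integrable lborel {s..t} q \<and>
        set_integrable lborel {s..t} r"
    and sym: "\<And>x. x \<in> {a<..<b} \<Longrightarrow> p x = p (a + b - x) \<and> q x = q (a + b - x) \<and> r x = r (a + b - x)"
    and LC: "LC_left p q r a b" "LC_right p q r a b"
    and NO: "NO_left p q r a b" "NO_right p q r a b"
    and bdd: "\<And>f g. (f, g) \<in> Tmin p q r a b \<Longrightarrow> lam0 * (normw r {a<..<b} f)^2 \<le> Re (ipw r {a<..<b} g f)"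
    and ua_sol: "rsol p q r {a<..<b} lam0 ua ua1"
    and hua_sol: "rsol p q r {a<..<b} lam0 hua hua1"
    and ua_princ: "\<exists>d. a < d \<and> d < b \<and> (\<forall>x\<in>{a<..<d}. ua x \<noteq> 0) \<and>
        (\<integral>\<^sup>+ x. ennreal (1 / (p x * (ua x)^2)) * indicator {a<..<d} x \<partial>lborel) = \<infinity>"
    and wr: "\<And>x. x \<in> {a<..<b} \<Longrightarrow> hua x * ua1 x - hua1 x * ua x = 1"
  shows
   "(\<forall>S. sa_ext p q r a b S \<and> commP a b S \<longrightarrow>
       (\<exists>\<alpha> \<alpha>'. \<alpha> \<in> {0<..pi} \<and> \<alpha>' \<in> {0<..pi} \<and>
          ueq_sum r {a<..<b} {a<..<(a+b)/2} S
            (Thalf p q r a ((a+b)/2) ua ua1 hua hua1 \<alpha> pi)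
            (Thalf p q r a ((a+b)/2) ua ua1 hua hua1 \<alpha>' (pi/2)))) \<and>
    (\<forall>\<alpha> \<alpha>'. \<alpha> \<in> {0<..pi} \<and> \<alpha>' \<in> {0<..pi} \<longrightarrow>
       (\<alpha> = \<alpha>' \<longrightarrow>
          sa_ext p q r a b (Tab p q r a b ua ua1 hua hua1 \<alpha> \<alpha>) \<and>
          commP a b (Tab p q r a b ua ua1 hua hua1 \<alpha> \<alpha>) \<and>
          ueq_sum r {a<..<b} {a<..<(a+b)/2} (Tab p q r a b ua ua1 hua hua1 \<alpha> \<alpha>)
            (Thalf p q r a ((a+b)/2) ua ua1 hua hua1 \<alpha> pi)
            (Thalf p q r a ((a+b)/2) ua ua1 hua hua1 \<alpha>' (pi/2))) \<and>
       (\<alpha> \<noteq> \<alpha>' \<longrightarrow>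
          (\<exists>R11 R12 R21 R22. R11 * R22 - R12 * R21 = 1 \<and> R11 = R22 \<and>
             (R12 \<noteq> 0 \<longrightarrow> \<alpha> = acot ((R11 + 1) / R12) \<and> \<alpha>' = acot ((R11 - 1) / R12)) \<and>
             (R12 = 0 \<and> R11 = -1 \<longrightarrow> \<alpha> = acot (- R21 / 2) \<and> \<alpha>' = pi) \<and>
             (R12 = 0 \<and> R11 = 1 \<longrightarrow> \<alpha> = pi \<and> \<alpha>' = acot (R21 / 2)) \<and>
             sa_ext p q r a b (TetaR p q r a b ua ua1 hua hua1 0 R11 R12 R21 R22) \<and>
             commP a b (TetaR p q r a b ua ua1 hua hua1 0 R11 R12 R21 R22) \<and>
             ueq_sum r {a<..<b} {a<..<(a+b)/2} (TetaR p q r a b ua ua1 hua hua1 0 R11 R12 R21 R22)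
               (Thalf p q r a ((a+b)/2) ua ua1 hua hua1 \<alpha> pi)
               (Thalf p q r a ((a+b)/2) ua ua1 hua hua1 \<alpha>' (pi/2)))))"
proof -
  interpret sl_problem a b lam0 p q r ua ua1 hua hua1
  proof
    show "r \<in> borel_measurable borel" using meas(3) by simp
  qed (fact ab pos(1) pos(2) loc sym LC(1) ua_sol hua_sol wr)+
  show ?thesis
  proof (intro conjI allI impI)
    fix S assume S: "sa_ext p q r a b S \<and> commP a b S"
    obtain \<alpha> \<alpha>' where "\<alpha> \<in> {0<..pi}" "\<alpha>' \<in> {0<..pi}" "S = split_ext \<alpha> \<alpha>'"
      using commuting_extension_split S by blast
    then show "\<exists>\<alpha> \<alpha>'. \<alpha> \<in> {0<..pi} \<and> \<alpha>' \<in> {0<..pi} \<and>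
          ueq_sum r {a<..<b} {a<..<(a+b)/2} S
            (Thalf p q r a ((a+b)/2) ua ua1 hua hua1 \<alpha> pi)
            (Thalf p q r a ((a+b)/2) ua ua1 hua hua1 \<alpha>' (pi/2))"
      using ueq_split_ext by blast
  next
    fix \<alpha> \<alpha>' :: real
    assume "\<alpha> = \<alpha>'"
    then show "sa_ext p q r a b (Tab p q r a b ua ua1 hua hua1 \<alpha> \<alpha>)"
      "commP a b (Tab p q r a b ua ua1 hua hua1 \<alpha> \<alpha>)"
      "ueq_sum r {a<..<b} {a<..<(a+b)/2} (Tab p q r a b ua ua1 hua hua1 \<alpha> \<alpha>)
            (Thalf p q r a ((a+b)/2) ua ua1 hua hua1 \<alpha> pi)
            (Thalf p q r a ((a+b)/2) ua ua1 hua hua1 \<alpha>' (pi/2))"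
      unfolding Tab_eq_split_ext using split_ext_sa split_ext_commP ueq_split_ext by blast+
  next
    fix \<alpha> \<alpha>' :: real
    assume \<alpha>: "\<alpha> \<in> {0<..pi} \<and> \<alpha>' \<in> {0<..pi}" and ne: "\<alpha> \<noteq> \<alpha>'"
    show "\<exists>R11 R12 R21 R22. R11 * R22 - R12 * R21 = 1 \<and> R11 = R22 \<and>
             (R12 \<noteq> 0 \<longrightarrow> \<alpha> = acot ((R11 + 1) / R12) \<and> \<alpha>' = acot ((R11 - 1) / R12)) \<and>
             (R12 = 0 \<and> R11 = -1 \<longrightarrow> \<alpha> = acot (- R21 / 2) \<and> \<alpha>' = pi) \<and>
             (R12 = 0 \<and> R11 = 1 \<longrightarrow> \<alpha> = pi \<and> \<alpha>' = acot (R21 / 2)) \<and>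
             sa_ext p q r a b (TetaR p q r a b ua ua1 hua hua1 0 R11 R12 R21 R22) \<and>
             commP a b (TetaR p q r a b ua ua1 hua hua1 0 R11 R12 R21 R22) \<and>
             ueq_sum r {a<..<b} {a<..<(a+b)/2} (TetaR p q r a b ua ua1 hua hua1 0 R11 R12 R21 R22)
               (Thalf p q r a ((a+b)/2) ua ua1 hua hua1 \<alpha> pi)
               (Thalf p q r a ((a+b)/2) ua ua1 hua hua1 \<alpha>' (pi/2))"
    proof (rule matrix_of_angles[OF conjunct1[OF \<alpha>] conjunct2[OF \<alpha>] ne])
      fix R11 R12 R21 :: real
      assume R: "R11 * R11 - R12 * R21 = 1"
        "R12 \<noteq> 0 \<Longrightarrow> \<alpha> = acot ((R11 + 1) / R12) \<and> \<alpha>' = acot ((R11 - 1) / R12)"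
        "R12 = 0 \<Longrightarrow> R11 = - 1 \<Longrightarrow> \<alpha> = acot (- R21 / 2) \<and> \<alpha>' = pi"
        "R12 = 0 \<Longrightarrow> R11 = 1 \<Longrightarrow> \<alpha> = pi \<and> \<alpha>' = acot (R21 / 2)"
        and bc: "\<And>x y x' y' :: complex. (x' = complex_of_real R11 * x + complex_of_real R12 * y \<and>
            - y' = complex_of_real R21 * x + complex_of_real R11 * y) \<longleftrightarrow>
          bcond \<alpha> (x - x') (y - y') \<and>
          bcond \<alpha>' (x + x') (y + y')"
      show ?thesis
        using R split_ext_sa[of \<alpha> \<alpha>'] split_ext_commP[of \<alpha> \<alpha>'] ueq_split_ext[of \<alpha> \<alpha>']
        unfolding TetaR_eq_split_ext[OF bc, symmetric] by blast
    qed
  qed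
qed

end
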